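(* Let $f\in L^2(\Omega)$ and let $w$ be a strong solution, on $[0,T]$ for every $T>0$, of the Corrected Smagorinsky Model $$w_t-\frac{C_s^4\delta^2}{\mu^{2}}\Delta w_t+w\cdot\nabla w-\nu\Delta w+\nabla q-\nabla\cdot\big((C_s\delta)^2|\nabla w|\nabla w\big)=f(x),\qquad \nabla\cdot w=0\ \text{ in }\Omega,\qquad w=0\ \text{ on }\partial\Omega .$$ Set $\alpha=\min\Big\{\dfrac{\nu}{2C_{PF}^2},\ \dfrac{\mu^2\nu}{C_s^4\delta^2}\Big\}$ and $C=\dfrac{2}{\nu}C_{PF}^2\|f\|^2$. Then the model is unconditionally stable, in the following sense. (i) For every $T>0$, $$\|w(T)\|^2+\frac{C_s^4}{\mu^2}\delta^2\|\nabla w(T)\|^2\le e^{-\alpha T}\Big\{\|w(0)\|^2+\frac{C_s^4}{\mu^2}\delta^2\|\nabla w(0)\|^2+\frac{C}{\alpha}(e^{\alpha T}-1)\Big\}.$$ (ii) There is a constant $C'<\infty$ with $$\sup_{0\le t<\infty}\Big(\|w(t)\|^2+\frac{C_s^4\delta^2}{\mu^2}\|\nabla w(t)\|^2\Big)\le C'.$$ (iii) There is a real-valued function $R(T)$ with $R(T)=\mathcal{O}(1/T)$ as $T\to\infty$ such that $$R(T)+\frac{1}{|\Omega|}\frac1T\int_0^T\Big(\frac{\nu}{2}\|\nabla w\|^2+(C_s\delta)^2\|\nabla w\|_{L^3}^3\Big)dt\le\frac{1}{|\Omega|}\frac1T\int_0^T\frac{C_{PF}^2}{2\nu}\|f\|^2\,dt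 .$$
   Context: $\Omega\subset\mathbb{R}^d$ ($d=2$ or $3$) is a regular bounded flow domain and $|\Omega|$ is its measure. $\nu>0$ is the kinematic viscosity, $C_s,\delta,\mu>0$ are constants, and $f=f(x)$ is a prescribed body force. $\|\cdot\|$ and $(\cdot,\cdot)$ are the $L^2(\Omega)$ norm and inner product, $\|\cdot\|_{L^p}$ is the $L^p(\Omega)$ norm. $|\nabla w|$ is the Euclidean (Frobenius) norm of the velocity gradient. Spaces: $X=\{v\in L^3(\Omega):\nabla v\in L^3(\Omega),\ v=0\text{ on }\partial\Omega\}$ (vector fields), $Q=\{q\in L^2(\Omega):\int_\Omega q\,dx=0\}$. $C_{PF}=C_{PF}(\Omega)>0$ is a Poincaré–Friedrichs constant: $\|u\|\le C_{PF}\|\nabla u\|$ for all $u\in X$. Weak form of the model: $(w,p)\in(X,Q)$ satisfies $$(w_t,v)+\tfrac{C_s^4}{\mu^2}\delta^2(\nabla w_t,\nabla v)+(w\cdot\nabla w,v)+\nu(\nabla w,\nabla v)-(p,\nabla\cdot v)+\big((C_s\delta)^2|\nabla w|\nabla w,\nabla v\big)=(f,v)\quad\forall v\in X,$$ $$(q,\nabla\cdot w)=0\quad\forall q\in Q .$$ Strong solution: $w$ is a strong solution (with initial value $w(0)=w_0$) on $[0,T]$ if (1) $w\in L^\infty(0,T;H^1(\Omega))\cap L^2(0,T;W^{1,3}(\Omega))\cap L^2(0,T;L^6(\Omega))$; (2) $w(\cdot,t)\to w_0$ in $L^2(\Omega)$ as $t\to0$; (3) $w$ satisfies the weak form above for all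 $v\in L^\infty(0,T;H^1(\Omega))\cap L^2(0,T;W^{1,3}(\Omega))\cap L^2(0,T;L^6(\Omega))$ (vanishing on $\partial\Omega$). *)

theory Defs
  imports "HOL-Analysis.Analysis" "HOL-Library.Landau_Symbols"
begin

section \<open>Lebesgue spaces\<close>

text \<open>
  Elements of \<open>L\<^sup>p\<close> spaces are given by Borel representatives: every class of Lebesgue measurable
  functions contains one, and the notions below depend on the class only.
\<close>

abbreviation vol :: "'a::euclidean_space set \<Rightarrow> 'a measure" where
  "vol S \<equiv> restrict_space lborel S"

definition Lp :: "real \<Rightarrow> 'a::euclidean_space set \<Rightarrow> ('a \<Rightarrow> 'b::euclidean_space) set" where
  "Lp p S = {u \<in> borel_measurable (vol S). integrable (vol S) (\<lambda>x. norm (u x) powr p)}"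

definition Linf :: "'a::euclidean_space set \<Rightarrow> ('a \<Rightarrow> 'b::euclidean_space) set" where
  "Linf S = {u \<in> borel_measurable (vol S). \<exists>M. AE x in vol S. norm (u x) \<le> M}"

definition Lp_norm :: "real \<Rightarrow> 'a::euclidean_space set \<Rightarrow> ('a \<Rightarrow> 'b::euclidean_space) \<Rightarrow> real" where
  "Lp_norm p S u = (\<integral>x. norm (u x) powr p \<partial>vol S) powr (1 / p)"

definition L2_inner ::
  "'a::euclidean_space set \<Rightarrow> ('a \<Rightarrow> 'b::euclidean_space) \<Rightarrow> ('a \<Rightarrow> 'b) \<Rightarrow> real" where
  "L2_inner S u v = (\<integral>x. u x \<bullet> v x \<partial>vol S)"

text \<open>Pressures: square integrable with mean zero.\<close>

definition Qspace :: "'a::euclidean_space set \<Rightarrow> ('a \<Rightarrow> real) set" where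
  "Qspace S = {q \<in> Lp 2 S. (\<integral>x. q x \<partial>vol S) = 0}"

section \<open>Test functions and weak gradients\<close>

text \<open>\<open>C\<^sup>k\<close> on the whole space: differentiable with all partial derivatives of class \<open>C\<^sup>k\<^sup>-\<^sup>1\<close>.\<close>

primrec C_k :: "nat \<Rightarrow> ('a::euclidean_space \<Rightarrow> real) \<Rightarrow> bool" where
  "C_k 0 \<phi> \<longleftrightarrow> continuous_on UNIV \<phi>"
| "C_k (Suc k) \<phi> \<longleftrightarrow> (\<forall>x. \<phi> differentiable at x) \<and>
     (\<forall>b\<in>Basis. C_k k (\<lambda>x. frechet_derivative \<phi> (at x) b))"

definition test_functions :: "'a::euclidean_space set \<Rightarrow> ('a \<Rightarrow> real) set" where
  "test_functions S = {\<phi>. (\<forall>k. C_k k \<phi>) \<and>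
     compact (closure {x. \<phi> x \<noteq> 0}) \<and> closure {x. \<phi> x \<noteq> 0} \<subseteq> S}"

text \<open>
  Gradients of vector fields are matrix fields with entries \<open>G $ i $ j = \<partial>\<^sub>j u\<^sub>i\<close>, the convention of
  \<open>matrix (frechet_derivative u (at x))\<close>. The norm and inner product of \<open>real ^ 'd ^ 'd\<close> are the
  Frobenius ones.
\<close>

definition has_weak_gradient ::
  "(real ^ 'd) set \<Rightarrow> (real ^ 'd \<Rightarrow> real ^ 'd) \<Rightarrow> (real ^ 'd \<Rightarrow> real ^ 'd ^ 'd) \<Rightarrow> bool" where
  "has_weak_gradient \<Omega> u G \<longleftrightarrow>
     (\<forall>K. compact K \<and> K \<subseteq> \<Omega> \<longrightarrow> set_integrable lborel K u \<and> set_integrable lborel K G) \<and>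
     (\<forall>\<phi>\<in>test_functions \<Omega>. \<forall>i j.
        (\<integral>x. u x $ i * frechet_derivative \<phi> (at x) (axis j 1) \<partial>vol \<Omega>)
          = - (\<integral>x. G x $ i $ j * \<phi> x \<partial>vol \<Omega>))"

text \<open>On an open set the weak gradient is unique up to a null set.\<close>

definition weak_grad ::
  "(real ^ 'd) set \<Rightarrow> (real ^ 'd \<Rightarrow> real ^ 'd) \<Rightarrow> real ^ 'd \<Rightarrow> real ^ 'd ^ 'd" where
  "weak_grad \<Omega> u = (SOME G. has_weak_gradient \<Omega> u G)"

definition weak_div ::
  "(real ^ 'd) set \<Rightarrow> (real ^ 'd \<Rightarrow> real ^ 'd) \<Rightarrow> real ^ 'd \<Rightarrow> real" where
  "weak_div \<Omega> u x = trace (weak_grad \<Omega> u x)"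

section \<open>Sobolev spaces\<close>

definition W1 :: "real \<Rightarrow> (real ^ 'd) set \<Rightarrow> (real ^ 'd \<Rightarrow> real ^ 'd) set" where
  "W1 p \<Omega> = {u \<in> Lp p \<Omega>. \<exists>G \<in> Lp p \<Omega>. has_weak_gradient \<Omega> u G}"

text \<open>
  The boundary condition \<open>u = 0\<close> on \<open>\<partial>\<Omega>\<close> for \<open>u \<in> W\<^sup>1\<^sup>,\<^sup>p\<close>: \<open>u\<close> lies in the \<open>W\<^sup>1\<^sup>,\<^sup>p\<close>-closure of the
  smooth compactly supported fields.
\<close>

definition zero_on_boundary ::
  "real \<Rightarrow> (real ^ 'd) set \<Rightarrow> (real ^ 'd \<Rightarrow> real ^ 'd) \<Rightarrow> bool" where
  "zero_on_boundary p \<Omega> u \<longleftrightarrow> (\<exists>\<phi> :: nat \<Rightarrow> real ^ 'd \<Rightarrow> real ^ 'd.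
     (\<forall>n i. (\<lambda>x. \<phi> n x $ i) \<in> test_functions \<Omega>) \<and>
     (\<lambda>n. Lp_norm p \<Omega> (\<lambda>x. \<phi> n x - u x)) \<longlonglongrightarrow> 0 \<and>
     (\<lambda>n. Lp_norm p \<Omega> (\<lambda>x. matrix (frechet_derivative (\<phi> n) (at x)) - weak_grad \<Omega> u x))
        \<longlonglongrightarrow> 0)"

definition Xspace :: "(real ^ 'd) set \<Rightarrow> (real ^ 'd \<Rightarrow> real ^ 'd) set" where
  "Xspace \<Omega> = {v \<in> W1 3 \<Omega>. zero_on_boundary 3 \<Omega> v}"

section \<open>Time-dependent fields\<close>

text \<open>
  \<open>Bochner_Lp Y r T \<Omega>\<close> consists of the fields \<open>u t x\<close> with \<open>u t \<in> L\<^sup>r(\<Omega>)\<close> for almost every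
  \<open>t \<in> (0,T)\<close> and \<open>t \<mapsto> \<parallel>u t\<parallel>\<close> in \<open>Y\<close>; so it is \<open>L\<^sup>q(0,T; L\<^sup>r(\<Omega>))\<close> for
  \<open>Y = Lp q {0<..<T}\<close>, and \<open>L\<^sup>\<infinity>(0,T; L\<^sup>r(\<Omega>))\<close> for \<open>Y = Linf {0<..<T}\<close>. Likewise \<open>Bochner_W1\<close> with
  \<open>W\<^sup>1\<^sup>,\<^sup>r(\<Omega>)\<close> in place of \<open>L\<^sup>r(\<Omega>)\<close>. For \<open>r < \<infinity>\<close>, Bochner measurability amounts to joint measurability
  on \<open>(0,T) \<times> \<Omega>\<close>.
\<close>

definition Bochner_Lp :: "(real \<Rightarrow> real) set \<Rightarrow> real \<Rightarrow> real \<Rightarrow> (real ^ 'd) set \<Rightarrow>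
    (real \<Rightarrow> real ^ 'd \<Rightarrow> 'b::euclidean_space) set" where
  "Bochner_Lp Y r T \<Omega> = {u.
     (\<lambda>(t, x). u t x) \<in> borel_measurable (vol ({0<..<T} \<times> \<Omega>)) \<and>
     (AE t\<in>{0<..<T} in lborel. u t \<in> Lp r \<Omega>) \<and>
     (\<lambda>t. Lp_norm r \<Omega> (u t)) \<in> Y}"

definition Bochner_W1 :: "(real \<Rightarrow> real) set \<Rightarrow> real \<Rightarrow> real \<Rightarrow> (real ^ 'd) set \<Rightarrow>
    (real \<Rightarrow> real ^ 'd \<Rightarrow> real ^ 'd) set" where
  "Bochner_W1 Y r T \<Omega> = {u \<in> Bochner_Lp Y r T \<Omega>. \<exists>G \<in> Bochner_Lp Y r T \<Omega>.
     AE t\<in>{0<..<T} in lborel. has_weak_gradient \<Omega> (u t) (G t)}"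

text \<open>
  \<open>L\<^sup>\<infinity>(0,T; H\<^sup>1(\<Omega>)) \<inter> L\<^sup>2(0,T; W\<^sup>1\<^sup>,\<^sup>3(\<Omega>)) \<inter> L\<^sup>2(0,T; L\<^sup>6(\<Omega>))\<close>
\<close>

definition solution_class ::
  "real \<Rightarrow> (real ^ 'd) set \<Rightarrow> (real \<Rightarrow> real ^ 'd \<Rightarrow> real ^ 'd) set" where
  "solution_class T \<Omega> =
     Bochner_W1 (Linf {0<..<T}) 2 T \<Omega> \<inter>
     Bochner_W1 (Lp 2 {0<..<T}) 3 T \<Omega> \<inter>
     Bochner_Lp (Lp 2 {0<..<T}) 6 T \<Omega>"

definition has_weak_time_derivative ::
  "real \<Rightarrow> (real ^ 'd) set \<Rightarrow> (real \<Rightarrow> real ^ 'd \<Rightarrow> real ^ 'd) \<Rightarrow>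
   (real \<Rightarrow> real ^ 'd \<Rightarrow> real ^ 'd) \<Rightarrow> bool" where
  "has_weak_time_derivative T \<Omega> w wt \<longleftrightarrow>
     (\<forall>\<psi>\<in>test_functions {0<..<T}. AE x\<in>\<Omega> in lborel.
        (\<integral>t. deriv \<psi> t *\<^sub>R w t x \<partial>vol {0<..<T}) = - (\<integral>t. \<psi> t *\<^sub>R wt t x \<partial>vol {0<..<T}))"

definition continuous_into_L2 ::
  "real \<Rightarrow> (real ^ 'd) set \<Rightarrow> (real \<Rightarrow> real ^ 'd \<Rightarrow> real ^ 'd) \<Rightarrow> bool" where
  "continuous_into_L2 T \<Omega> w \<longleftrightarrow>
     (\<forall>t\<in>{0..T}. w t \<in> Lp 2 \<Omega>) \<and>
     (\<forall>s\<in>{0..T}. ((\<lambda>t. Lp_norm 2 \<Omega> (\<lambda>x. w t x - w s x)) \<longlongrightarrow> 0) (at s within {0..T}))"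

section \<open>The Corrected Smagorinsky Model\<close>

text \<open>A bounded domain with Lipschitz boundary: near each boundary point it is, in the direction of
  some unit vector \<open>e\<close>, the region above the graph of a Lipschitz function on the hyperplane
  orthogonal to \<open>e\<close>.\<close>

definition regular_domain :: "(real ^ 'd) set \<Rightarrow> bool" where
  "regular_domain \<Omega> \<longleftrightarrow> open \<Omega> \<and> connected \<Omega> \<and> \<Omega> \<noteq> {} \<and> bounded \<Omega> \<and>
     (\<forall>z\<in>frontier \<Omega>. \<exists>r e L. \<exists>\<gamma> :: real ^ 'd \<Rightarrow> real. r > 0 \<and> norm e = 1 \<and>
        L-lipschitz_on {y. y \<bullet> e = 0} \<gamma> \<and>
        \<Omega> \<inter> ball z r = {x \<in> ball z r. \<gamma> (x - (x \<bullet> e) *\<^sub>R e) < x \<bullet> e})"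

text \<open>
  The momentum equation, for fixed time, tested with \<open>v\<close>; here \<open>wt\<close> is the time derivative, and the
  convective term is \<open>(w \<cdot> \<nabla>w)\<^sub>i = \<Sum>\<^sub>j w\<^sub>j \<partial>\<^sub>j w\<^sub>i\<close>.
\<close>

definition csm_momentum ::
  "real \<Rightarrow> real \<Rightarrow> real \<Rightarrow> real \<Rightarrow> (real ^ 'd) set \<Rightarrow> (real ^ 'd \<Rightarrow> real ^ 'd) \<Rightarrow>
   (real ^ 'd \<Rightarrow> real ^ 'd) \<Rightarrow> (real ^ 'd \<Rightarrow> real ^ 'd) \<Rightarrow> (real ^ 'd \<Rightarrow> real) \<Rightarrow>
   (real ^ 'd \<Rightarrow> real ^ 'd) \<Rightarrow> bool" where
  "csm_momentum \<nu> Cs \<delta> \<mu> \<Omega> f w wt p v \<longleftrightarrow>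
     L2_inner \<Omega> wt v
     + Cs ^ 4 / \<mu>\<^sup>2 * \<delta>\<^sup>2 * L2_inner \<Omega> (weak_grad \<Omega> wt) (weak_grad \<Omega> v)
     + L2_inner \<Omega> (\<lambda>x. weak_grad \<Omega> w x *v w x) v
     + \<nu> * L2_inner \<Omega> (weak_grad \<Omega> w) (weak_grad \<Omega> v)
     - L2_inner \<Omega> p (weak_div \<Omega> v)
     + L2_inner \<Omega> (\<lambda>x. ((Cs * \<delta>)\<^sup>2 * norm (weak_grad \<Omega> w x)) *\<^sub>R weak_grad \<Omega> w x) (weak_grad \<Omega> v)
     = L2_inner \<Omega> f v"

text \<open>
  The weak form is imposed at almost every time. The time derivative is taken in
  \<open>L\<^sup>1(0,T; H\<^sup>1(\<Omega>))\<close>, the weakest such class in which both \<open>(w\<^sub>t, v)\<close> and \<open>(\<nabla>w\<^sub>t, \<nabla>v)\<close> are meaningful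
  for test fields in \<open>L\<^sup>\<infinity>(0,T; H\<^sup>1(\<Omega>))\<close>. A field with such a derivative is, up to changing it on a null
  set of times, continuous into \<open>L\<^sup>2(\<Omega>)\<close>; \<open>continuous_into_L2\<close> selects that representative, so that
  \<open>w t\<close> is meaningful for each single \<open>t\<close>. The initial value is \<open>w 0\<close>.
\<close>

definition strong_solution ::
  "real \<Rightarrow> real \<Rightarrow> real \<Rightarrow> real \<Rightarrow> (real ^ 'd) set \<Rightarrow> (real ^ 'd \<Rightarrow> real ^ 'd) \<Rightarrow> real \<Rightarrow>
   (real \<Rightarrow> real ^ 'd \<Rightarrow> real ^ 'd) \<Rightarrow> bool" where
  "strong_solution \<nu> Cs \<delta> \<mu> \<Omega> f T w \<longleftrightarrow>
     w \<in> solution_class T \<Omega> \<and>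
     continuous_into_L2 T \<Omega> w \<and>
     ((\<lambda>t. Lp_norm 2 \<Omega> (\<lambda>x. w t x - w 0 x)) \<longlongrightarrow> 0) (at_right 0) \<and>
     (\<exists>wt p.
        wt \<in> Bochner_W1 (Lp 1 {0<..<T}) 2 T \<Omega> \<and>
        has_weak_time_derivative T \<Omega> w wt \<and>
        (AE t\<in>{0<..<T} in lborel. w t \<in> Xspace \<Omega> \<and> p t \<in> Qspace \<Omega>) \<and>
        (\<forall>v \<in> solution_class T \<Omega>.
           (AE t\<in>{0<..<T} in lborel. v t \<in> Xspace \<Omega>) \<longrightarrow>
           (AE t\<in>{0<..<T} in lborel. csm_momentum \<nu> Cs \<delta> \<mu> \<Omega> f (w t) (wt t) (p t) (v t))) \<and>
        (AE t\<in>{0<..<T} in lborel. \<forall>q\<in>Qspace \<Omega>. L2_inner \<Omega> q (weak_div \<Omega> (w t)) = 0))"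

end

theory Submission
  imports Defs
begin

text \<open>
  The whole theorem comes from one computation: test the momentum equation with \<open>v = w\<close>. The
  convective term vanishes because \<open>w\<close> is divergence free and zero on the boundary
  (\<open>convection_vanishes\<close>), the pressure term vanishes by incompressibility, and the two terms with
  \<open>w\<^sub>t\<close> form the time derivative of half the energy
  \<open>E(t) = \<parallel>w(t)\<parallel>\<^sup>2 + \<kappa> \<parallel>\<nabla>w(t)\<parallel>\<^sup>2\<close>, where \<open>\<kappa> = Cs\<^sup>4 \<delta>\<^sup>2 / \<mu>\<^sup>2\<close>. What remains is
  \<open>E' = 2 ((f, w) - \<nu> \<parallel>\<nabla>w\<parallel>\<^sup>2 - (Cs \<delta>)\<^sup>2 \<parallel>\<nabla>w\<parallel>\<^sup>3)\<close> with the cube of the \<open>L\<^sup>3\<close> norm. By the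
  Poincare inequality and Young's inequality the right-hand side is at most \<open>C - \<alpha> E\<close>
  (\<open>energy_dissipation_bound\<close>), so Gronwall's inequality gives the exponential estimate (i), and
  (ii) is immediate from (i). Integrating \<open>E'\<close> over \<open>[0, T]\<close> and spending half of the viscous
  term on the forcing gives (iii) with \<open>R(T) = (E(T) - E(0)) / (2 T |\<Omega>|)\<close>, which is \<open>O(1/T)\<close> because \<open>E\<close> is
  bounded.

  Most of the work is to justify the computation for a strong solution, whose derivatives are all
  weak and whose gradient is controlled only at almost every time.

  Uniqueness of weak gradients (\<open>weak_gradient_unique\<close>) makes \<open>weak_grad\<close> a meaningful choice. Since
  \<open>w\<^sub>t\<close> lies in \<open>L\<^sup>1(0,T; H\<^sup>1)\<close>, both \<open>w\<close> and \<open>\<nabla>w\<close> are primitives in time of integrable fields: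
  \<open>w(t) = w(0) + \<integral>\<^sub>0\<^sup>t w\<^sub>t\<close> almost everywhere (\<open>weak_time_derivative_evolve\<close>), and
  \<open>G\<^sub>0 + \<integral>\<^sub>0\<^sup>t \<nabla>w\<^sub>t\<close> is a weak gradient of \<open>w(t)\<close> for every single \<open>t\<close>, the end points included
  (\<open>strong_solution_gradient\<close>). For such primitives the identity
  \<open>\<parallel>u(t)\<parallel>\<^sup>2 = \<parallel>u(0)\<parallel>\<^sup>2 + 2 \<integral>\<^sub>0\<^sup>t (u\<^sub>t, u)\<close> is a consequence of Fubini's theorem (\<open>evolve_energy\<close>),
  so that \<open>E\<close> is absolutely continuous and the formula for \<open>E'\<close> holds in integrated form
  (\<open>strong_solution_energy_balance\<close>).
\<close>

section \<open>Smooth functions\<close>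

lemma C_k_SucI:
  assumes "\<And>x. (\<phi> has_derivative D x) (at x)" and "\<And>b. b \<in> Basis \<Longrightarrow> C_k k (\<lambda>x. D x b)"
  shows "C_k (Suc k) \<phi>"
proof -
  have "frechet_derivative \<phi> (at x) = D x" for x
    using frechet_derivative_at[OF assms(1)] by simp
  then show ?thesis
    using assms by (auto simp: differentiable_def)
qed

lemma C_k_SucD:
  assumes "C_k (Suc k) \<phi>"
  shows "(\<phi> has_derivative frechet_derivative \<phi> (at x)) (at x)"
    and "b \<in> Basis \<Longrightarrow> C_k k (\<lambda>x. frechet_derivative \<phi> (at x) b)"
  using assms by (auto simp: frechet_derivative_works[symmetric])

lemma C_k_Suc_imp: "C_k (Suc k) \<phi> \<Longrightarrow> C_k k \<phi>"
proof (induction k arbitrary: \<phi>)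
  case 0
  then show ?case
    by (auto intro!: continuous_at_imp_continuous_on differentiable_imp_continuous_within)
next
  case (Suc k)
  then show ?case by (metis C_k.simps(2))
qed

lemma C_k_const: "C_k k (\<lambda>x. c)"
  by (induction k arbitrary: c) auto

lemma C_k_add: "C_k k f \<Longrightarrow> C_k k g \<Longrightarrow> C_k k (\<lambda>x. f x + g x)"
proof (induction k arbitrary: f g)
  case 0 then show ?case by (auto intro: continuous_intros)
next
  case (Suc k)
  show ?case
    by (rule C_k_SucI[OF has_derivative_add[OF C_k_SucD(1)[OF Suc.prems(1)] C_k_SucD(1)[OF Suc.prems(2)]]])
       (intro Suc.IH C_k_SucD(2)[OF Suc.prems(1)] C_k_SucD(2)[OF Suc.prems(2)])
qed

lemma C_k_mult: "C_k k f \<Longrightarrow> C_k k g \<Longrightarrow> C_k k (\<lambda>x. f x * g x)"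
proof (induction k arbitrary: f g)
  case 0 then show ?case by (auto intro: continuous_intros)
next
  case (Suc k)
  show ?case
    by (rule C_k_SucI[OF has_derivative_mult[OF C_k_SucD(1)[OF Suc.prems(1)] C_k_SucD(1)[OF Suc.prems(2)]]])
       (intro C_k_add Suc.IH C_k_Suc_imp[OF Suc.prems(1)] C_k_Suc_imp[OF Suc.prems(2)]
          C_k_SucD(2)[OF Suc.prems(1)] C_k_SucD(2)[OF Suc.prems(2)])
qed

lemma C_k_inverse: "C_k k f \<Longrightarrow> (\<And>x. f x \<noteq> 0) \<Longrightarrow> C_k k (\<lambda>x. inverse (f x))"
proof (induction k arbitrary: f)
  case 0 then show ?case by (auto intro!: continuous_intros)
next
  case (Suc k)
  have D: "((\<lambda>x. inverse (f x)) has_derivative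
     (\<lambda>b. (-1) * (inverse (f x) * frechet_derivative f (at x) b * inverse (f x)))) (at x)" for x
    using Deriv.has_derivative_inverse[OF Suc.prems(2) C_k_SucD(1)[OF Suc.prems(1)], of x] by simp
  show ?case
    by (rule C_k_SucI[OF D])
       (intro C_k_mult C_k_const Suc.IH[OF C_k_Suc_imp[OF Suc.prems(1)]] Suc.prems(2)
          C_k_SucD(2)[OF Suc.prems(1)])
qed

lemma C_k_prod: "finite A \<Longrightarrow> (\<And>i. i \<in> A \<Longrightarrow> C_k k (f i)) \<Longrightarrow> C_k k (\<lambda>x. \<Prod>i\<in>A. f i x)"
  by (induction A rule: finite_induct) (auto intro: C_k_const C_k_mult)

text \<open>
  By the chain rule a directional derivative of the composition is a constant times \<open>f'\<close> composed
  with the same affine function, to which the induction hypothesis applies.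
\<close>

lemma C_k_compose_affine:
  fixes f :: "real \<Rightarrow> real" and l :: "'a::euclidean_space \<Rightarrow> real"
  assumes "bounded_linear l"
  shows "C_k k f \<Longrightarrow> C_k k (\<lambda>x. f (l x + c))"
proof (induction k arbitrary: f)
  case 0
  then have "continuous_on UNIV f" by simp
  then have "continuous_on UNIV (f \<circ> (\<lambda>x. l x + c))"
    by (intro continuous_on_compose continuous_intros continuous_on_subset[OF \<open>continuous_on UNIV f\<close>]
        bounded_linear.continuous_on[OF assms]) auto
  then show ?case by (simp add: o_def)
next
  case (Suc k)
  have D: "((\<lambda>x. f (l x + c)) has_derivative
      (\<lambda>b. l b * frechet_derivative f (at (l x + c)) 1)) (at x)" for x
  proof -
    have "((\<lambda>x. l x + c) has_derivative l) (at x)"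
      by (auto intro!: derivative_eq_intros bounded_linear_imp_has_derivative assms)
    from has_derivative_compose[OF this C_k_SucD(1)[OF Suc.prems]]
    have *: "((\<lambda>x. f (l x + c)) has_derivative (\<lambda>b. frechet_derivative f (at (l x + c)) (l b))) (at x)" .
    have "frechet_derivative f (at y) r = r * frechet_derivative f (at y) 1" for y r
      using linear_cmul[OF linear_frechet_derivative, of f "at y" r 1] Suc.prems by simp
    then have "(\<lambda>b. frechet_derivative f (at (l x + c)) (l b))
        = (\<lambda>b. l b * frechet_derivative f (at (l x + c)) 1)"
      by (intro ext)
    with * show ?thesis by simp
  qed
  show ?case
  proof (rule C_k_SucI[OF D])
    fix b :: 'a
    have "C_k k (\<lambda>x. frechet_derivative f (at (l x + c)) 1)"
      by (rule Suc.IH[OF C_k_SucD(2)[OF Suc.prems]]) simp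
    then show "C_k k (\<lambda>x. l b * frechet_derivative f (at (l x + c)) 1)"
      by (rule C_k_mult[OF C_k_const])
  qed
qed

text \<open>
  For \<open>m = 0\<close> this is the classical smooth function with all derivatives zero at the origin. The
  derivative of a member of the family is a linear combination of two other members, so smoothness
  of all of them follows by one induction on the order of differentiability.
\<close>

definition flat :: "nat \<Rightarrow> real \<Rightarrow> real" where
  "flat m x = (if x \<le> 0 then 0 else exp (- inverse x) * inverse x ^ m)"

lemma flat_nonpos [simp]: "x \<le> 0 \<Longrightarrow> flat m x = 0"
  by (simp add: flat_def)

lemma flat_pos: "x > 0 \<Longrightarrow> flat m x > 0"
  by (simp add: flat_def)

lemma flat_nonneg: "flat m x \<ge> 0"
  by (simp add: flat_def)

text \<open>
  Substituting \<open>y = 1 / x\<close>, this says that \<open>exp y\<close> grows faster than any power of \<open>y\<close>. Applied to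
  \<open>m + 1\<close> it gives the derivative zero of \<open>flat m\<close> at the origin.
\<close>

lemma flat_tendsto_0: "(flat m \<longlongrightarrow> 0) (at 0)"
proof -
  have "((\<lambda>x. inverse x ^ m / exp (inverse x)) \<longlongrightarrow> 0) (at_right (0::real))"
    by (rule filterlim_compose[OF tendsto_power_div_exp_0 filterlim_inverse_at_top_right])
  moreover have "\<forall>\<^sub>F x in at_right 0. inverse x ^ m / exp (inverse x) = flat m x"
    by (auto simp: eventually_at_right_field flat_def exp_minus field_simps intro!: exI[of _ 1])
  ultimately have "(flat m \<longlongrightarrow> 0) (at_right 0)"
    by (rule Lim_transform_eventually)
  moreover have "(flat m \<longlongrightarrow> 0) (at_left 0)"
  proof (rule tendsto_eventually)
    show "\<forall>\<^sub>F x in at_left 0. flat m x = 0"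
      by (auto simp: eventually_at_left_field intro!: exI[of _ "-1"])
  qed
  ultimately show ?thesis by (rule filterlim_split_at_real[rotated])
qed

lemma flat_has_real_derivative:
  "(flat m has_real_derivative (flat (m + 2) x - real m * flat (m + 1) x)) (at x)"
proof (cases x "0::real" rule: linorder_cases)
  case less
  have "((\<lambda>x. 0) has_real_derivative 0) (at x)" by simp
  then have "(flat m has_real_derivative 0) (at x)"
    by (rule has_field_derivative_transform_within_open[where S="{..<0}"]) (use less in auto)
  then show ?thesis using less by simp
next
  case equal
  have "(\<lambda>h. (flat m (0 + h) - flat m 0) / h) = (\<lambda>h. flat (m + 1) h)"
    by (auto simp: flat_def field_simps)
  then have "(flat m has_real_derivative 0) (at 0)"
    using flat_tendsto_0[of "m + 1"] by (simp add: DERIV_def)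
  then show ?thesis using equal by simp
next
  case greater
  have "(inverse x)\<^sup>2 * exp (- inverse x) * inverse x ^ m
        - real m * inverse x ^ (m - 1) * (inverse x)\<^sup>2 * exp (- inverse x)
      = flat (m + 2) x - real m * flat (m + 1) x"
    using greater by (cases m) (simp_all add: flat_def power_add power2_eq_square algebra_simps)
  moreover have "((\<lambda>x. exp (- inverse x) * inverse x ^ m) has_real_derivative
      (inverse x)\<^sup>2 * exp (- inverse x) * inverse x ^ m
        - real m * inverse x ^ (m - 1) * (inverse x)\<^sup>2 * exp (- inverse x)) (at x)"
    using greater by (auto intro!: derivative_eq_intros simp: power2_eq_square)
  ultimately have "((\<lambda>x. exp (- inverse x) * inverse x ^ m) has_real_derivative
      (flat (m + 2) x - real m * flat (m + 1) x)) (at x)"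
    by simp
  then show ?thesis
    by (rule has_field_derivative_transform_within_open[where S="{0<..}"])
       (use greater in \<open>auto simp: flat_def\<close>)
qed

lemma C_k_flat: "C_k k (flat m)"
proof (induction k arbitrary: m)
  case 0
  have "isCont (flat m) x" for x
    using flat_has_real_derivative by (rule DERIV_isCont)
  then show ?case by (simp add: continuous_at_imp_continuous_on)
next
  case (Suc k)
  have D: "(flat m has_derivative (\<lambda>b. (flat (m + 2) x + (- real m) * flat (m + 1) x) * b)) (at x)" for x
    using flat_has_real_derivative[of m x] by (simp add: has_field_derivative_def)
  show ?case
    by (rule C_k_SucI[OF D]) (intro C_k_mult C_k_add C_k_const Suc.IH)
qed

section \<open>Test functions\<close>

lemma test_functionsI:
  assumes "\<And>k. C_k k \<phi>" and "compact K" "K \<subseteq> S" and "\<And>x. x \<notin> K \<Longrightarrow> \<phi> x = 0"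
  shows "\<phi> \<in> test_functions S"
proof -
  have sub: "closure {x. \<phi> x \<noteq> 0} \<subseteq> K"
    using assms(2,4) by (intro closure_minimal) (auto intro: compact_imp_closed)
  then have "compact (closure {x. \<phi> x \<noteq> 0})"
    using assms(2) by (metis closed_Int_compact closed_closure inf.absorb_iff1)
  with sub assms show ?thesis
    by (auto simp: test_functions_def)
qed

lemma test_functionsE:
  assumes "\<phi> \<in> test_functions S"
  obtains K where "\<And>k. C_k k \<phi>" "compact K" "K \<subseteq> S" "\<And>x. x \<notin> K \<Longrightarrow> \<phi> x = 0"
  using assms closure_subset[of "{x. \<phi> x \<noteq> 0}"]
  by (intro that[of "closure {x. \<phi> x \<noteq> 0}"]) (auto simp: test_functions_def)

lemma test_functions_continuous: "\<phi> \<in> test_functions S \<Longrightarrow> continuous_on UNIV \<phi>"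
  by (metis (no_types, lifting) C_k.simps(1) mem_Collect_eq test_functions_def)

lemma test_functions_borel [measurable_dest]: "\<phi> \<in> test_functions S \<Longrightarrow> \<phi> \<in> borel_measurable borel"
  by (rule borel_measurable_continuous_onI) (rule test_functions_continuous)

lemma test_functions_has_derivative:
  "\<phi> \<in> test_functions S \<Longrightarrow> (\<phi> has_derivative frechet_derivative \<phi> (at x)) (at x)"
  by (rule C_k_SucD(1)) (auto simp: test_functions_def)

lemma test_functions_bounded:
  assumes "\<phi> \<in> test_functions S"
  obtains B where "\<And>x. \<bar>\<phi> x\<bar> \<le> B"
proof -
  obtain K where K: "compact K" "\<And>x. x \<notin> K \<Longrightarrow> \<phi> x = 0"
    using assms by (rule test_functionsE) blast
  have "compact (\<phi> ` K)"
    using K(1) test_functions_continuous[OF assms] continuous_on_subset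
    by (blast intro: compact_continuous_image)
  then have "\<exists>B. \<forall>x\<in>K. \<bar>\<phi> x\<bar> \<le> B"
    by (auto dest!: compact_imp_bounded simp: bounded_iff)
  then obtain B where B: "\<And>x. x \<in> K \<Longrightarrow> \<bar>\<phi> x\<bar> \<le> B" by blast
  have "\<bar>\<phi> x\<bar> \<le> max B 0" for x
    using B[of x] K(2)[of x] by (cases "x \<in> K") auto
  then show ?thesis by (rule that)
qed

text \<open>
  Off a compact set that carries \<open>\<phi>\<close> the function is locally constant zero, so differentiation
  does not enlarge the support.
\<close>

lemma test_functions_partial:
  assumes "\<phi> \<in> test_functions S" "b \<in> Basis"
  shows "(\<lambda>x. frechet_derivative \<phi> (at x) b) \<in> test_functions S"
proof -
  obtain K where K: "\<And>k. C_k k \<phi>" "compact K" "K \<subseteq> S" "\<And>x. x \<notin> K \<Longrightarrow> \<phi> x = 0"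
    using assms(1) by (rule test_functionsE) blast
  show ?thesis
  proof (rule test_functionsI[OF _ K(2,3)])
    show "C_k k (\<lambda>x. frechet_derivative \<phi> (at x) b)" for k
      using K(1) assms(2) by (rule C_k_SucD(2))
    show "frechet_derivative \<phi> (at x) b = 0" if "x \<notin> K" for x
    proof -
      have "(\<phi> has_derivative (\<lambda>h. 0)) (at x)"
        by (rule has_derivative_transform_within_open[where f = "\<lambda>x. 0" and s = "- K"])
           (use that K in \<open>auto simp: open_Compl compact_imp_closed\<close>)
      then show ?thesis by (metis frechet_derivative_at)
    qed
  qed
qed

lemma test_functions_add:
  assumes "\<phi> \<in> test_functions S" "\<psi> \<in> test_functions S"
  shows "(\<lambda>x. \<phi> x + \<psi> x) \<in> test_functions S"
proof -
  obtain K where K: "\<And>k. C_k k \<phi>" "compact K" "K \<subseteq> S" "\<And>x. x \<notin> K \<Longrightarrow> \<phi> x = 0"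
    using assms(1) by (rule test_functionsE) blast
  obtain L where L: "\<And>k. C_k k \<psi>" "compact L" "L \<subseteq> S" "\<And>x. x \<notin> L \<Longrightarrow> \<psi> x = 0"
    using assms(2) by (rule test_functionsE) blast
  show ?thesis
    by (rule test_functionsI[where K = "K \<union> L"]) (use K L in \<open>auto intro: C_k_add\<close>)
qed

lemma test_functions_mult:
  assumes "\<phi> \<in> test_functions S" "\<And>k. C_k k \<psi>"
  shows "(\<lambda>x. \<phi> x * \<psi> x) \<in> test_functions S"
proof -
  obtain K where K: "\<And>k. C_k k \<phi>" "compact K" "K \<subseteq> S" "\<And>x. x \<notin> K \<Longrightarrow> \<phi> x = 0"
    using assms(1) by (rule test_functionsE) blast
  show ?thesis
    by (rule test_functionsI[OF _ K(2,3)]) (use K assms in \<open>auto intro: C_k_mult\<close>)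
qed

lemma test_functions_sum:
  assumes "finite A" "\<And>i. i \<in> A \<Longrightarrow> \<phi> i \<in> test_functions S"
  shows "(\<lambda>x. \<Sum>i\<in>A. \<phi> i x) \<in> test_functions S"
  using assms
  by (induction A rule: finite_induct)
     (auto intro: test_functions_add test_functionsI[where K = "{}"] C_k_const)

section \<open>The fundamental lemma of the calculus of variations\<close>

text \<open>
  There is one factor for each face of the box, and \<open>n\<close> steepens the descent to zero at the faces.
\<close>

definition box_bump :: "nat \<Rightarrow> 'a::euclidean_space \<Rightarrow> 'a \<Rightarrow> 'a \<Rightarrow> real" where
  "box_bump n a b x = (\<Prod>i\<in>Basis. flat 0 (real n * (x \<bullet> i - a \<bullet> i)) * flat 0 (real n * (b \<bullet> i - x \<bullet> i)))"

lemma flat_0_le_1: "flat 0 x \<le> 1"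
  by (simp add: flat_def)

text \<open>
  For \<open>c > 0\<close> the values are \<open>exp (- 1 / (n c))\<close>. Hence the bumps built from \<open>flat 0\<close> tend to an
  indicator function without any normalisation.
\<close>

lemma flat_0_scaled_tendsto: "(\<lambda>n. flat 0 (real n * c)) \<longlonglongrightarrow> (if c > 0 then 1 else 0)"
proof (cases "c > 0")
  case True
  have "(\<lambda>n. exp (- (inverse (real n) * inverse c))) \<longlonglongrightarrow> exp (- (0 * inverse c))"
    by (intro tendsto_intros lim_inverse_n)
  moreover have "\<forall>\<^sub>F n in sequentially. exp (- (inverse (real n) * inverse c)) = flat 0 (real n * c)"
    using True by (auto simp: flat_def mult_le_0_iff eventually_sequentially intro!: exI[of _ 1])
  ultimately show ?thesis
    using True by (auto dest: Lim_transform_eventually)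
next
  case False
  then have "flat 0 (real n * c) = 0" for n
    by (intro flat_nonpos) (simp add: mult_le_0_iff)
  with False show ?thesis by simp
qed

lemma box_bump_nonneg: "box_bump n a b x \<ge> 0"
  by (auto simp: box_bump_def intro!: prod_nonneg mult_nonneg_nonneg flat_nonneg)

lemma box_bump_le_1: "box_bump n a b x \<le> 1"
  unfolding box_bump_def
  by (intro prod_le_1 conjI mult_nonneg_nonneg mult_le_one flat_nonneg flat_0_le_1)

lemma box_bump_eq_0: "x \<notin> box a b \<Longrightarrow> box_bump n a b x = 0"
  by (auto simp: box_bump_def mem_box intro!: flat_nonpos prod_zero
      simp: not_less mult_le_0_iff intro: order_trans)

lemma box_bump_tendsto: "(\<lambda>n. box_bump n a b x) \<longlonglongrightarrow> indicator (box a b) x"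
proof (cases "x \<in> box a b")
  case True
  have "(\<lambda>n. box_bump n a b x) \<longlonglongrightarrow> (\<Prod>i\<in>Basis. (if x \<bullet> i - a \<bullet> i > 0 then 1 else 0) * (if b \<bullet> i - x \<bullet> i > 0 then 1 else 0))"
    unfolding box_bump_def by (intro tendsto_intros flat_0_scaled_tendsto)
  with True show ?thesis by (simp add: mem_box cong: prod.cong)
qed (simp add: box_bump_eq_0)

lemma box_bump_test_function:
  assumes "cbox a b \<subseteq> S"
  shows "box_bump n a b \<in> test_functions S"
proof (rule test_functionsI[OF _ compact_cbox assms])
  show "C_k k (box_bump n a b)" for k
  proof -
    have "C_k k (\<lambda>x. flat 0 (real n * (x \<bullet> i) + (- real n * (a \<bullet> i))))"
         "C_k k (\<lambda>x. flat 0 (- real n * (x \<bullet> i) + (real n * (b \<bullet> i))))" for i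
      by (intro C_k_compose_affine C_k_flat bounded_linear_const_mult bounded_linear_inner_left)+
    then show ?thesis
      unfolding box_bump_def[abs_def]
      by (intro C_k_prod C_k_mult finite_Basis) (simp_all add: algebra_simps)
  qed
  show "box_bump n a b x = 0" if "x \<notin> cbox a b" for x
    using that box_subset_cbox[of a b] by (intro box_bump_eq_0) auto
qed

text \<open>
  The bumps carry the hypothesis over to the indicator of every box whose closure lies in \<open>\<Omega>\<close>.
  Boxes are stable under intersection and generate the Borel sets, so inside a fixed box the
  integral of \<open>g\<close> vanishes over all Borel sets, and \<open>g\<close> is zero there almost everywhere. Countably
  many boxes exhaust \<open>\<Omega>\<close>.
\<close>

lemma test_functions_separate:
  fixes g :: "'a::euclidean_space \<Rightarrow> real"
  assumes "open \<Omega>"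
    and loc: "\<And>K. compact K \<Longrightarrow> K \<subseteq> \<Omega> \<Longrightarrow> set_integrable lborel K g"
    and zero: "\<And>\<phi>. \<phi> \<in> test_functions \<Omega> \<Longrightarrow> (\<integral>x. g x * \<phi> x \<partial>vol \<Omega>) = 0"
  shows "AE x in vol \<Omega>. g x = 0"
proof -
  have [measurable]: "\<Omega> \<in> sets borel" using \<open>open \<Omega>\<close> by simp
  have box0: "(\<integral>x. indicator (box a b) x * g x \<partial>lborel) = 0" if "cbox a b \<subseteq> \<Omega>" for a b
  proof (rule LIMSEQ_unique)
    have int: "integrable lborel (\<lambda>x. indicator (cbox a b) x * g x)"
      using loc[OF compact_cbox that] by (simp add: set_integrable_def)
    have [measurable]: "box_bump n a b \<in> borel_measurable borel" for n
      using box_bump_test_function[OF that] by measurable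
    have eq: "box_bump n a b x * (indicator (cbox a b) x * g x) = box_bump n a b x * g x" for n x
      using box_bump_eq_0[of x a b n] box_subset_cbox[of a b] by (auto split: split_indicator)
    show "(\<lambda>n. \<integral>x. box_bump n a b x * (indicator (cbox a b) x * g x) \<partial>lborel)
        \<longlonglongrightarrow> (\<integral>x. indicator (box a b) x * g x \<partial>lborel)"
    proof (rule integral_dominated_convergence[where w = "\<lambda>x. \<bar>indicator (cbox a b) x * g x\<bar>"])
      have "(\<lambda>x. indicator (box a b) x * (indicator (cbox a b) x * g x)) \<in> borel_measurable lborel"
        using int by measurable
      also have "(\<lambda>x. indicator (box a b) x * (indicator (cbox a b) x * g x)) = (\<lambda>x. indicator (box a b) x * g x)"
        using box_subset_cbox[of a b] by (auto simp: fun_eq_iff split: split_indicator)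
      finally show "(\<lambda>x. indicator (box a b) x * g x) \<in> borel_measurable lborel" .
      show "(\<lambda>x. box_bump n a b x * (indicator (cbox a b) x * g x)) \<in> borel_measurable lborel" for n
        using int by measurable
      show "integrable lborel (\<lambda>x. \<bar>indicator (cbox a b) x * g x\<bar>)"
        using int by simp
      show "AE x in lborel. (\<lambda>n. box_bump n a b x * (indicator (cbox a b) x * g x))
          \<longlonglongrightarrow> indicator (box a b) x * g x"
        unfolding eq by (intro AE_I2 tendsto_intros box_bump_tendsto)
      show "AE x in lborel. norm (box_bump n a b x * (indicator (cbox a b) x * g x)) \<le> \<bar>indicator (cbox a b) x * g x\<bar>" for n
        using box_bump_nonneg[of n a b] box_bump_le_1[of n a b]
        by (intro AE_I2) (simp add: abs_mult mult_left_le_one_le)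
    qed
    have "(\<integral>x. box_bump n a b x * (indicator (cbox a b) x * g x) \<partial>lborel) = (\<integral>x. g x * box_bump n a b x \<partial>vol \<Omega>)" for n
    proof -
      have *: "indicator \<Omega> x *\<^sub>R (g x * box_bump n a b x) = g x * box_bump n a b x" for x
        using box_bump_eq_0[of x a b n] box_subset_cbox[of a b] that by (auto split: split_indicator)
      have "(\<integral>x. g x * box_bump n a b x \<partial>vol \<Omega>)
          = (\<integral>x. indicator \<Omega> x *\<^sub>R (g x * box_bump n a b x) \<partial>lborel)"
        by (rule integral_restrict_space) simp
      then show ?thesis
        unfolding eq by (simp only: * mult.commute[of "box_bump n a b _"])
    qed
    then show "(\<lambda>n. \<integral>x. box_bump n a b x * (indicator (cbox a b) x * g x) \<partial>lborel) \<longlonglongrightarrow> 0"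
      using zero[OF box_bump_test_function[OF that]] by simp
  qed
  have cbox_AE: "AE x in lborel. x \<in> box c d \<longrightarrow> g x = 0" if cd: "cbox c d \<subseteq> \<Omega>" for c d
  proof -
    define h where "h x = indicator (box c d) x * g x" for x
    have int: "integrable lborel h"
    proof -
      have "set_integrable lborel (box c d) g"
        by (rule set_integrable_subset[OF loc[OF compact_cbox cd]]) (auto simp: box_subset_cbox)
      then show ?thesis by (simp add: set_integrable_def h_def[abs_def])
    qed
    have "(LINT x:A|lborel. h x) = 0" if "A \<in> sets lborel" for A
    proof -
      let ?E = "range (\<lambda>(a, b). box a b :: 'a set)"
      have "Int_stable ?E" by (auto simp: Int_stable_def box_Int_box)
      moreover have "?E \<subseteq> Pow UNIV" by simp
      moreover have "A \<in> sigma_sets UNIV ?E" using that by (simp add: borel_eq_box)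
      ultimately show ?thesis
      proof (induction rule: sigma_sets_induct_disjoint[consumes 3])
        case (basic A)
        then obtain a b where A: "A = box a b" by auto
        obtain a' b' where ab: "box a b \<inter> box c d = box a' b'" and "cbox a b \<inter> cbox c d = cbox a' b'"
          by (simp add: box_Int_box Int_interval)
        then have "cbox a' b' \<subseteq> \<Omega>" using cd by blast
        from box0[OF this] show ?case
          by (simp add: A set_lebesgue_integral_def h_def ab[symmetric] indicator_inter_arith mult.assoc)
      next
        case empty
        show ?case by (simp add: set_lebesgue_integral_def)
      next
        case (compl A)
        have A: "A \<in> sets lborel" using compl by (simp add: borel_eq_box)
        have "(LINT x:UNIV - A|lborel. h x) = (LINT x|lborel. h x - indicator A x * h x)"
          unfolding set_lebesgue_integral_def by (intro Bochner_Integration.integral_cong) (auto split: split_indicator)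
        also have "\<dots> = (LINT x|lborel. h x) - (LINT x:A|lborel. h x)"
          unfolding set_lebesgue_integral_def using int integrable_mult_indicator[OF A int] by simp
        also have "\<dots> = 0"
          using compl box0[OF cd] by (simp add: h_def)
        finally show ?case .
      next
        case (union A)
        have A: "A i \<in> sets lborel" for i using union by (auto simp: borel_eq_box)
        have "(LINT x:(\<Union>i. A i)|lborel. h x) = (\<Sum>i. (LINT x:(A i)|lborel. h x))"
        proof (rule lebesgue_integral_countable_add)
          show "A i \<inter> A j = {}" if "i \<noteq> j" for i j
            using union(1) that by (auto simp: disjoint_family_on_def)
          show "set_integrable lborel (\<Union>i. A i) h"
            unfolding set_integrable_def by (rule integrable_mult_indicator[OF _ int]) (use A in auto)
        qed (rule A)
        then show ?case using union by simp
      qed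
    qed
    from sigma_finite_measure.density_zero[OF sigma_finite_lborel int this] show ?thesis
      by (rule AE_mp) (auto simp: h_def split: split_indicator)
  qed
  obtain D where D: "countable D" "D \<subseteq> Pow \<Omega>" "\<And>X. X \<in> D \<Longrightarrow> \<exists>a b. X = cbox a b" "\<Union>D = \<Omega>"
    using open_countable_Union_open_cbox[OF \<open>open \<Omega>\<close>] by metis
  have "AE x in lborel. x \<in> X \<longrightarrow> g x = 0" if "X \<in> D" for X
  proof -
    obtain a b where X: "X = cbox a b" using D(3)[OF \<open>X \<in> D\<close>] by blast
    have "cbox a b \<subseteq> \<Omega>" using D(2) that X by auto
    from cbox_AE[OF this] have "AE x in lborel. x \<in> box a b \<longrightarrow> g x = 0" .
    moreover have "AE x in lborel. x \<notin> cbox a b - box a b"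
      by (rule AE_not_in) (auto simp: null_sets_def emeasure_Diff emeasure_lborel_cbox_eq emeasure_lborel_box_eq box_subset_cbox)
    ultimately show ?thesis by eventually_elim (auto simp: X)
  qed
  then have "AE x in lborel. \<forall>X\<in>D. x \<in> X \<longrightarrow> g x = 0"
    unfolding AE_ball_countable[OF D(1)] by blast
  then show ?thesis
    using D(4) by (auto simp: AE_restrict_space_iff elim!: eventually_mono)
qed

lemma weak_gradient_unique:
  assumes "open \<Omega>" "has_weak_gradient \<Omega> u G" "has_weak_gradient \<Omega> u H"
  shows "AE x in vol \<Omega>. G x = H x"
proof -
  have [measurable]: "\<Omega> \<in> sets borel" using \<open>open \<Omega>\<close> by simp
  have comp: "set_integrable lborel K (\<lambda>x. F x $ i $ j)"
    if "has_weak_gradient \<Omega> u F" "compact K" "K \<subseteq> \<Omega>" for K i j and F :: "real^'a \<Rightarrow> real^'a^'a"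
  proof -
    have "integrable lborel (\<lambda>x. indicator K x *\<^sub>R F x)"
      using that by (simp add: has_weak_gradient_def set_integrable_def)
    from integrable_bounded_linear[OF bounded_linear_compose[OF bounded_linear_vec_nth bounded_linear_vec_nth] this, of i j]
    show ?thesis by (simp add: set_integrable_def)
  qed
  have "AE x in vol \<Omega>. (G x - H x) $ i $ j = 0" for i j
  proof (rule test_functions_separate[OF \<open>open \<Omega>\<close>])
    show "set_integrable lborel K (\<lambda>x. (G x - H x) $ i $ j)" if "compact K" "K \<subseteq> \<Omega>" for K
      using comp[OF assms(2) that] comp[OF assms(3) that] by (simp add: set_integral_diff)
    show "(\<integral>x. (G x - H x) $ i $ j * \<phi> x \<partial>vol \<Omega>) = 0" if phi: "\<phi> \<in> test_functions \<Omega>" for \<phi>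
    proof -
      have int: "integrable (vol \<Omega>) (\<lambda>x. F x $ i $ j * \<phi> x)"
        if "has_weak_gradient \<Omega> u F" for F :: "real^'a \<Rightarrow> real^'a^'a"
      proof -
        obtain K where K: "compact K" "K \<subseteq> \<Omega>" "\<And>x. x \<notin> K \<Longrightarrow> \<phi> x = 0"
          using phi by (rule test_functionsE) blast
        obtain B where B: "\<And>x. \<bar>\<phi> x\<bar> \<le> B" using test_functions_bounded[OF phi] by blast
        have [measurable]: "\<phi> \<in> borel_measurable borel" using phi by measurable
        have "integrable lborel (\<lambda>x. \<phi> x * (indicator K x * F x $ i $ j))"
        proof (rule Bochner_Integration.integrable_bound)
          show i: "integrable lborel (\<lambda>x. B * (indicator K x * F x $ i $ j))"
            using comp[OF that K(1,2)] by (simp add: set_integrable_def)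
          show "(\<lambda>x. \<phi> x * (indicator K x * F x $ i $ j)) \<in> borel_measurable lborel"
            by (rule borel_measurable_times)
               (use borel_measurable_integrable[OF comp[OF that K(1,2), unfolded set_integrable_def], of i j]
                in \<open>simp_all\<close>)
          show "AE x in lborel. norm (\<phi> x * (indicator K x * F x $ i $ j)) \<le> norm (B * (indicator K x * F x $ i $ j))"
            by (intro AE_I2) (auto simp: abs_mult intro!: mult_right_mono order_trans[OF B abs_ge_self])
        qed
        also have "(\<lambda>x. \<phi> x * (indicator K x * F x $ i $ j)) = (\<lambda>x. indicator \<Omega> x *\<^sub>R (F x $ i $ j * \<phi> x))"
          using K by (auto simp: fun_eq_iff split: split_indicator)
        finally show ?thesis by (simp add: integrable_restrict_space)
      qed
      have "(\<integral>x. (G x - H x) $ i $ j * \<phi> x \<partial>vol \<Omega>)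
          = (\<integral>x. G x $ i $ j * \<phi> x \<partial>vol \<Omega>) - (\<integral>x. H x $ i $ j * \<phi> x \<partial>vol \<Omega>)"
        using int[OF assms(2)] int[OF assms(3)]
        by (simp add: left_diff_distrib)
      also have "\<dots> = 0"
        using assms(2,3) phi by (auto simp: has_weak_gradient_def)
      finally show ?thesis .
    qed
  qed
  then have "AE x in vol \<Omega>. \<forall>i j. (G x - H x) $ i $ j = 0"
    by (simp add: AE_all_countable)
  then show ?thesis
    by eventually_elim (simp add: vec_eq_iff)
qed

section \<open>Square integrable fields\<close>

lemma finite_measure_vol:
  assumes "S \<in> sets borel" "bounded S"
  shows "finite_measure (vol S)"
  using assms emeasure_bounded_finite[of S]
  by (intro finite_measureI) (simp add: space_restrict_space emeasure_restrict_space)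

lemma measurable_vol: "f \<in> borel_measurable borel \<Longrightarrow> f \<in> borel_measurable (vol S)"
  by (rule measurable_restrict_space1) simp

definition L2_on :: "'x measure \<Rightarrow> ('x \<Rightarrow> 'b::euclidean_space) \<Rightarrow> bool" where
  "L2_on V f \<longleftrightarrow> f \<in> borel_measurable V \<and> integrable V (\<lambda>x. (norm (f x))\<^sup>2)"

lemma L2_onD [measurable_dest]: "L2_on V f \<Longrightarrow> f \<in> borel_measurable V"
  and L2_on_integrable: "L2_on V f \<Longrightarrow> integrable V (\<lambda>x. (norm (f x))\<^sup>2)"
  by (auto simp: L2_on_def)

lemma L2_on_bound:
  assumes "L2_on V g" "f \<in> borel_measurable V" "AE x in V. norm (f x) \<le> norm (g x)"
  shows "L2_on V f"
  unfolding L2_on_def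
proof (intro conjI Bochner_Integration.integrable_bound[OF L2_on_integrable[OF assms(1)]])
  show "AE x in V. norm ((norm (f x))\<^sup>2) \<le> norm ((norm (g x))\<^sup>2)"
    using assms(3) by eventually_elim (simp add: power_mono)
qed (use assms in measurable)

lemma L2_on_norm: "L2_on V f \<Longrightarrow> L2_on V (\<lambda>x. norm (f x))"
  by (auto simp: L2_on_def)

lemma L2_on_add:
  assumes "L2_on V f" "L2_on V g"
  shows "L2_on V (\<lambda>x. f x + g x)"
  unfolding L2_on_def
proof (intro conjI)
  note [measurable] = L2_onD[OF assms(1)] L2_onD[OF assms(2)]
  show "(\<lambda>x. f x + g x) \<in> borel_measurable V" by measurable
  show "integrable V (\<lambda>x. (norm (f x + g x))\<^sup>2)"
  proof (rule Bochner_Integration.integrable_bound)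
    show "integrable V (\<lambda>x. 2 * (norm (f x))\<^sup>2 + 2 * (norm (g x))\<^sup>2)"
      using assms by (simp add: L2_on_def)
    have "(norm (f x + g x))\<^sup>2 \<le> 2 * (norm (f x))\<^sup>2 + 2 * (norm (g x))\<^sup>2" for x
    proof -
      have "(norm (f x + g x))\<^sup>2 \<le> (norm (f x) + norm (g x))\<^sup>2"
        by (intro power_mono norm_triangle_ineq) simp
      also have "\<dots> \<le> 2 * (norm (f x))\<^sup>2 + 2 * (norm (g x))\<^sup>2"
        using sum_squares_bound[of "norm (f x)" "norm (g x)"] by (simp add: power2_sum)
      finally show ?thesis .
    qed
    then show "AE x in V. norm ((norm (f x + g x))\<^sup>2) \<le> norm (2 * (norm (f x))\<^sup>2 + 2 * (norm (g x))\<^sup>2)"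
      by (intro AE_I2) simp
  qed measurable
qed

lemma L2_on_uminus: "L2_on V f \<Longrightarrow> L2_on V (\<lambda>x. - f x)"
  by (simp add: L2_on_def)

lemma L2_on_diff: "L2_on V f \<Longrightarrow> L2_on V g \<Longrightarrow> L2_on V (\<lambda>x. f x - g x)"
  using L2_on_add[OF _ L2_on_uminus, of V f g] by simp

lemma Cauchy_Schwarz_norm:
  assumes f: "L2_on V f" and g: "L2_on V g"
  shows "integrable V (\<lambda>x. norm (f x) * norm (g x))"
    and "(\<integral>x. norm (f x) * norm (g x) \<partial>V) \<le> sqrt (\<integral>x. (norm (f x))\<^sup>2 \<partial>V) * sqrt (\<integral>x. (norm (g x))\<^sup>2 \<partial>V)"
proof -
  note [measurable] = L2_onD[OF f] L2_onD[OF g]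
  show int: "integrable V (\<lambda>x. norm (f x) * norm (g x))"
  proof (rule Bochner_Integration.integrable_bound)
    show "integrable V (\<lambda>x. (norm (f x))\<^sup>2 + (norm (g x))\<^sup>2)"
      using f g by (simp add: L2_on_def)
    have "norm (f x) * norm (g x) \<le> (norm (f x))\<^sup>2 + (norm (g x))\<^sup>2" for x
    proof -
      have "0 \<le> norm (f x) * norm (g x)" by simp
      then show ?thesis using sum_squares_bound[of "norm (f x)" "norm (g x)"] by linarith
    qed
    then show "AE x in V. norm (norm (f x) * norm (g x)) \<le> norm ((norm (f x))\<^sup>2 + (norm (g x))\<^sup>2)"
      by (intro AE_I2) simp
  qed measurable
  have "ennreal ((\<integral>x. norm (f x) * norm (g x) \<partial>V)\<^sup>2) = (\<integral>\<^sup>+x. ennreal (norm (f x)) * ennreal (norm (g x)) \<partial>V)\<^sup>2"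
    using int by (simp add: nn_integral_eq_integral ennreal_power flip: ennreal_mult)
  also have "\<dots> \<le> (\<integral>\<^sup>+x. (ennreal (norm (f x)))\<^sup>2 \<partial>V) * (\<integral>\<^sup>+x. (ennreal (norm (g x)))\<^sup>2 \<partial>V)"
    by (rule Cauchy_Schwarz_nn_integral) measurable
  also have "\<dots> = ennreal ((\<integral>x. (norm (f x))\<^sup>2 \<partial>V) * (\<integral>x. (norm (g x))\<^sup>2 \<partial>V))"
    using f g by (simp add: nn_integral_eq_integral ennreal_power L2_on_def ennreal_mult)
  finally have "(\<integral>x. norm (f x) * norm (g x) \<partial>V)\<^sup>2 \<le> (\<integral>x. (norm (f x))\<^sup>2 \<partial>V) * (\<integral>x. (norm (g x))\<^sup>2 \<partial>V)"
    by (subst (asm) ennreal_le_iff) (auto intro!: mult_nonneg_nonneg)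
  then show "(\<integral>x. norm (f x) * norm (g x) \<partial>V) \<le> sqrt (\<integral>x. (norm (f x))\<^sup>2 \<partial>V) * sqrt (\<integral>x. (norm (g x))\<^sup>2 \<partial>V)"
    by (simp add: real_le_rsqrt flip: real_sqrt_mult)
qed

lemma L2_on_inner:
  assumes f: "L2_on V f" and g: "L2_on V g"
  shows "integrable V (\<lambda>x. f x \<bullet> g x)"
    and "\<bar>\<integral>x. f x \<bullet> g x \<partial>V\<bar> \<le> sqrt (\<integral>x. (norm (f x))\<^sup>2 \<partial>V) * sqrt (\<integral>x. (norm (g x))\<^sup>2 \<partial>V)"
proof -
  note [measurable] = L2_onD[OF f] L2_onD[OF g]
  show int: "integrable V (\<lambda>x. f x \<bullet> g x)"
    by (rule Bochner_Integration.integrable_bound[OF Cauchy_Schwarz_norm(1)[OF f g]])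
       (auto simp: Cauchy_Schwarz_ineq2)
  have "\<bar>\<integral>x. f x \<bullet> g x \<partial>V\<bar> \<le> (\<integral>x. norm (f x) * norm (g x) \<partial>V)"
    by (rule order_trans[OF integral_abs_bound integral_mono])
       (use int Cauchy_Schwarz_norm(1)[OF f g] in \<open>auto simp: Cauchy_Schwarz_ineq2\<close>)
  also note Cauchy_Schwarz_norm(2)[OF f g]
  finally show "\<bar>\<integral>x. f x \<bullet> g x \<partial>V\<bar> \<le> sqrt (\<integral>x. (norm (f x))\<^sup>2 \<partial>V) * sqrt (\<integral>x. (norm (g x))\<^sup>2 \<partial>V)" .
qed

section \<open>Fields that are integrable in time with values in \<open>L\<^sup>2\<close>\<close>

text \<open>
  This is \<open>L\<^sup>1(L\<^sup>2)\<close>. The variables are ordered with space first because Fubini's theorem is mostly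
  used to integrate over time at a fixed point of space.
\<close>

definition L1_L2 :: "'t measure \<Rightarrow> 'x measure \<Rightarrow> ('t \<Rightarrow> 'x \<Rightarrow> 'b::euclidean_space) \<Rightarrow> bool" where
  "L1_L2 N V h \<longleftrightarrow> (\<lambda>(x, r). h r x) \<in> borel_measurable (V \<Otimes>\<^sub>M N) \<and>
     (AE r in N. integrable V (\<lambda>x. (norm (h r x))\<^sup>2)) \<and>
     integrable N (\<lambda>r. sqrt (\<integral>x. (norm (h r x))\<^sup>2 \<partial>V))"

text \<open>
  This is Minkowski's integral inequality. The square of \<open>\<integral>|h(r,x)| dr\<close> is a double integral over
  two times \<open>r\<close> and \<open>s\<close>; after exchanging it with the integral over \<open>x\<close>, the Cauchy-Schwarz
  inequality bounds the integrand by \<open>\<parallel>h(r)\<parallel> \<parallel>h(s)\<parallel>\<close>, whose double integral is finite.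
\<close>

lemma L1_L2_time_integral:
  fixes h :: "'t \<Rightarrow> 'x \<Rightarrow> 'b::euclidean_space"
  assumes "sigma_finite_measure N" "sigma_finite_measure V" and h: "L1_L2 N V h"
  shows "AE x in V. integrable N (\<lambda>r. h r x)"
    and "L2_on V (\<lambda>x. \<integral>r. norm (h r x) \<partial>N)"
proof -
  interpret N: sigma_finite_measure N by fact
  interpret V: sigma_finite_measure V by fact
  interpret VN: pair_sigma_finite V N ..
  have [measurable]: "(\<lambda>(x, r). h r x) \<in> borel_measurable (V \<Otimes>\<^sub>M N)"
    using h by (simp add: L1_L2_def)
  have [measurable]: "h r \<in> borel_measurable V" if "r \<in> space N" for r
    using measurable_Pair1[of "\<lambda>(x, r). h r x" V N borel r] that by simp
  define n where "n r = sqrt (\<integral>x. (norm (h r x))\<^sup>2 \<partial>V)" for r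
  have n_int: "integrable N n" and n_nonneg: "n r \<ge> 0" for r
    using h by (simp_all add: L1_L2_def n_def[abs_def])
  note [measurable] = borel_measurable_integrable[OF n_int]
  have L2: "AE r in N. L2_on V (h r)"
    using h by (auto simp: L1_L2_def L2_on_def elim!: AE_mp)
  define Bn where "Bn x = (\<integral>\<^sup>+r. ennreal (norm (h r x)) \<partial>N)" for x
  have [measurable]: "Bn \<in> borel_measurable V"
    unfolding Bn_def by measurable
  have inner_bound: "(\<integral>\<^sup>+x. ennreal (norm (h r x)) * Bn x \<partial>V) \<le> ennreal (n r) * (\<integral>\<^sup>+s. ennreal (n s) \<partial>N)"
    if r: "r \<in> space N" "L2_on V (h r)" for r
  proof -
    have [measurable]: "h r \<in> borel_measurable V" using r by simp
    have "(\<integral>\<^sup>+x. ennreal (norm (h r x)) * Bn x \<partial>V)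
        = (\<integral>\<^sup>+x. \<integral>\<^sup>+s. ennreal (norm (h r x)) * ennreal (norm (h s x)) \<partial>N \<partial>V)"
      unfolding Bn_def by (intro nn_integral_cong nn_integral_cmult[symmetric]) measurable
    also have "\<dots> = (\<integral>\<^sup>+s. \<integral>\<^sup>+x. ennreal (norm (h r x)) * ennreal (norm (h s x)) \<partial>V \<partial>N)"
      by (rule VN.Fubini'[symmetric]) measurable
    also have "\<dots> \<le> (\<integral>\<^sup>+s. ennreal (n r) * ennreal (n s) \<partial>N)"
    proof (rule nn_integral_mono_AE)
      show "AE s in N. (\<integral>\<^sup>+x. ennreal (norm (h r x)) * ennreal (norm (h s x)) \<partial>V) \<le> ennreal (n r) * ennreal (n s)"
        using L2
      proof eventually_elim
        case (elim s)
        have "(\<integral>\<^sup>+x. ennreal (norm (h r x)) * ennreal (norm (h s x)) \<partial>V)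
            = ennreal (\<integral>x. norm (h r x) * norm (h s x) \<partial>V)"
          using Cauchy_Schwarz_norm(1)[OF r(2) elim] by (simp add: nn_integral_eq_integral flip: ennreal_mult)
        also have "\<dots> \<le> ennreal (n r * n s)"
          unfolding n_def by (intro ennreal_leI Cauchy_Schwarz_norm(2)[OF r(2) elim])
        finally show ?case using n_nonneg by (simp add: ennreal_mult)
      qed
    qed
    also have "\<dots> = ennreal (n r) * (\<integral>\<^sup>+s. ennreal (n s) \<partial>N)"
      using n_int by (intro nn_integral_cmult) measurable
    finally show ?thesis .
  qed
  have "(\<integral>\<^sup>+x. (Bn x)\<^sup>2 \<partial>V) = (\<integral>\<^sup>+x. \<integral>\<^sup>+r. ennreal (norm (h r x)) * Bn x \<partial>N \<partial>V)"
  proof (rule nn_integral_cong)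
    fix x assume "x \<in> space V"
    then have "(\<integral>\<^sup>+r. ennreal (norm (h r x)) * Bn x \<partial>N) = (\<integral>\<^sup>+r. ennreal (norm (h r x)) \<partial>N) * Bn x"
      by (intro nn_integral_multc) measurable
    then show "(Bn x)\<^sup>2 = (\<integral>\<^sup>+r. ennreal (norm (h r x)) * Bn x \<partial>N)"
      by (simp add: Bn_def power2_eq_square)
  qed
  also have "\<dots> = (\<integral>\<^sup>+r. \<integral>\<^sup>+x. ennreal (norm (h r x)) * Bn x \<partial>V \<partial>N)"
    by (rule VN.Fubini'[symmetric]) measurable
  also have "\<dots> \<le> (\<integral>\<^sup>+r. ennreal (n r) * (\<integral>\<^sup>+s. ennreal (n s) \<partial>N) \<partial>N)"
    using L2 by (intro nn_integral_mono_AE) (auto intro!: inner_bound elim!: AE_mp)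
  also have "\<dots> = (\<integral>\<^sup>+s. ennreal (n s) \<partial>N) * (\<integral>\<^sup>+s. ennreal (n s) \<partial>N)"
    using n_int by (intro nn_integral_multc) measurable
  also have "\<dots> < \<infinity>"
    using n_int n_nonneg by (simp add: nn_integral_eq_integral ennreal_mult_less_top)
  finally have fin: "(\<integral>\<^sup>+x. (Bn x)\<^sup>2 \<partial>V) < \<infinity>" .
  then have "AE x in V. (Bn x)\<^sup>2 \<noteq> \<infinity>"
    by (intro nn_integral_noteq_infinite) auto
  then have Bfin: "AE x in V. Bn x < \<infinity>"
    by eventually_elim (auto simp: power2_eq_square top.not_eq_extremum ennreal_mult_less_top)
  show "AE x in V. integrable N (\<lambda>r. h r x)"
    using Bfin AE_space
  proof eventually_elim
    case (elim x)
    have "(\<lambda>r. h r x) \<in> borel_measurable N" using elim(2) by measurable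
    with elim(1) show ?case by (simp add: integrable_iff_bounded Bn_def)
  qed
  have B_eq: "(\<integral>r. norm (h r x) \<partial>N) = enn2real (Bn x)" if "x \<in> space V" for x
    using that unfolding Bn_def by (intro integral_eq_nn_integral) auto
  have "(\<lambda>x. \<integral>r. norm (h r x) \<partial>N) \<in> borel_measurable V" by measurable
  moreover have "(\<integral>\<^sup>+x. ennreal ((enn2real (Bn x))\<^sup>2) \<partial>V) = (\<integral>\<^sup>+x. (Bn x)\<^sup>2 \<partial>V)"
    using Bfin by (intro nn_integral_cong_AE) (auto elim!: eventually_mono simp flip: ennreal_power)
  with fin have "integrable V (\<lambda>x. (enn2real (Bn x))\<^sup>2)"
    by (simp add: integrable_iff_bounded)
  then have "integrable V (\<lambda>x. (norm (\<integral>r. norm (h r x) \<partial>N))\<^sup>2)"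
    by (rule Bochner_Integration.integrable_cong[OF refl, THEN iffD1, rotated]) (simp add: B_eq)
  ultimately show "L2_on V (\<lambda>x. \<integral>r. norm (h r x) \<partial>N)"
    by (simp add: L2_on_def)
qed

lemma L1_L2_integrable_product:
  fixes h :: "'t \<Rightarrow> 'x \<Rightarrow> 'b::euclidean_space" and g :: "'x \<Rightarrow> 'c::euclidean_space"
  assumes "sigma_finite_measure N" "sigma_finite_measure V" and h: "L1_L2 N V h" and g: "L2_on V g"
  shows "integrable (V \<Otimes>\<^sub>M N) (\<lambda>(x, r). norm (h r x) * norm (g x))"
proof -
  interpret N: sigma_finite_measure N by fact
  interpret V: sigma_finite_measure V by fact
  interpret VN: pair_sigma_finite V N ..
  have [measurable]: "(\<lambda>(x, r). h r x) \<in> borel_measurable (V \<Otimes>\<^sub>M N)"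
    using h by (simp add: L1_L2_def)
  note [measurable] = L2_onD[OF g]
  note B = L1_L2_time_integral[OF assms(1-3)]
  show ?thesis
  proof (rule VN.Fubini_integrable)
    show "(\<lambda>(x, r). norm (h r x) * norm (g x)) \<in> borel_measurable (V \<Otimes>\<^sub>M N)" by measurable
    have "integrable V (\<lambda>x. norm (\<integral>r. norm (h r x) \<partial>N) * norm (g x))"
      by (rule Cauchy_Schwarz_norm(1)[OF B(2) g])
    then show "integrable V (\<lambda>x. \<integral>r. norm (case (x, r) of (x, r) \<Rightarrow> norm (h r x) * norm (g x)) \<partial>N)"
      by (simp add: abs_mult)
    show "AE x in V. integrable N (\<lambda>r. case (x, r) of (x, r) \<Rightarrow> norm (h r x) * norm (g x))"
      using B(1) by eventually_elim simp
  qed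
qed

section \<open>Primitives in time and their energy\<close>

text \<open>
  This is \<open>d|u|\<^sup>2/dt = 2 u \<bullet> u'\<close> for an absolutely continuous \<open>u\<close>, in integrated form. The square of
  an integral over \<open>(0,t)\<close> is an integral over the square of pairs \<open>(r,s)\<close>; the diagonal is a null
  set and the two triangles on either side of it contribute equally.
\<close>

lemma norm_square_primitive:
  fixes u :: "real \<Rightarrow> 'b::euclidean_space" and a :: 'b and T t :: real
  defines "N \<equiv> vol {0<..<T::real}"
  assumes u: "integrable N u"
  shows "(norm (a + (\<integral>r. (if r < t then u r else 0) \<partial>N)))\<^sup>2 = (norm a)\<^sup>2 +
     2 * (\<integral>r. (if r < t then u r \<bullet> (a + (\<integral>s. (if s < r then u s else 0) \<partial>N)) else 0) \<partial>N)"
proof -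
  interpret N: finite_measure N
    unfolding N_def by (rule finite_measure_vol) auto
  interpret NN: pair_sigma_finite N N ..
  have [measurable]: "(\<lambda>x. x) \<in> borel_measurable N"
    unfolding N_def by (rule measurable_restrict_space1) simp
  note [measurable] = borel_measurable_integrable[OF u]
  define p where "p r = (if r < t then u r else 0)" for r
  have p: "integrable N p"
    by (rule Bochner_Integration.integrable_bound[OF u]) (auto simp: p_def[abs_def])
  note [measurable] = borel_measurable_integrable[OF p]
  define P where "P r = (\<integral>s. (if s < r then p s else 0) \<partial>N)" for r
  have [measurable]: "P \<in> borel_measurable N"
    unfolding P_def by measurable
  define q where "q r s = (if s < r then p r \<bullet> p s else 0)" for r s
  have pp_int: "integrable (N \<Otimes>\<^sub>M N) (\<lambda>(r, s). norm (p r) * norm (p s))"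
    by (rule NN.Fubini_integrable) (use p in \<open>auto simp: abs_mult\<close>)
  have q_int: "integrable (N \<Otimes>\<^sub>M N) (\<lambda>(r, s). q r s)"
    by (rule Bochner_Integration.integrable_bound[OF pp_int])
       (auto simp: q_def Cauchy_Schwarz_ineq2)
  have if_int: "integrable N (\<lambda>s. if s < r then p s else 0)" for r
    by (rule Bochner_Integration.integrable_bound[OF p]) auto
  have q_inner: "(\<integral>s. q r s \<partial>N) = p r \<bullet> P r" for r
  proof -
    have "(\<integral>s. q r s \<partial>N) = (\<integral>s. p r \<bullet> (if s < r then p s else 0) \<partial>N)"
      unfolding q_def by (intro Bochner_Integration.integral_cong) auto
    also have "\<dots> = p r \<bullet> P r"
      unfolding P_def using if_int by simp
    finally show ?thesis .
  qed
  have neq: "AE s in N. s \<noteq> r" for r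
    unfolding N_def by (auto simp: AE_restrict_space_iff intro: AE_mp[OF AE_lborel_singleton[of r]])
  have q_sec: "integrable N (\<lambda>s. q r s)" "integrable N (\<lambda>s. q s r)" for r
  proof -
    have "norm (q r s) \<le> norm (norm (p r) * norm (p s))" "norm (q s r) \<le> norm (norm (p r) * norm (p s))" for s
      using Cauchy_Schwarz_ineq2[of "p r" "p s"] by (auto simp: q_def inner_commute)
    moreover have int: "integrable N (\<lambda>s. norm (p r) * norm (p s))" using p by simp
    moreover have "(\<lambda>s. q r s) \<in> borel_measurable N" "(\<lambda>s. q s r) \<in> borel_measurable N"
      unfolding q_def by measurable
    ultimately show "integrable N (\<lambda>s. q r s)" "integrable N (\<lambda>s. q s r)"
      by (blast intro: Bochner_Integration.integrable_bound[OF int] AE_I2)+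
  qed
  have sq: "(\<integral>s. p s \<partial>N) \<bullet> (\<integral>s. p s \<partial>N) = 2 * (\<integral>r. p r \<bullet> P r \<partial>N)"
  proof -
    have "p r \<bullet> (\<integral>s. p s \<partial>N) = (\<integral>s. q r s \<partial>N) + (\<integral>s. q s r \<partial>N)" for r
    proof -
      have "p r \<bullet> (\<integral>s. p s \<partial>N) = (\<integral>s. p r \<bullet> p s \<partial>N)" using p by simp
      also have "\<dots> = (\<integral>s. q r s + q s r \<partial>N)"
        using neq[of r] by (intro integral_cong_AE) (auto simp: q_def inner_commute elim!: eventually_mono)
      also have "\<dots> = (\<integral>s. q r s \<partial>N) + (\<integral>s. q s r \<partial>N)"
        using q_sec by simp
      finally show ?thesis .
    qed
    then have "(\<integral>r. p r \<bullet> (\<integral>s. p s \<partial>N) \<partial>N) = (\<integral>r. (\<integral>s. q r s \<partial>N) + (\<integral>s. q s r \<partial>N) \<partial>N)"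
      by simp
    also have "\<dots> = (\<integral>r. \<integral>s. q r s \<partial>N \<partial>N) + (\<integral>r. \<integral>s. q s r \<partial>N \<partial>N)"
      using NN.integrable_fst'[OF q_int] NN.integrable_snd[of "\<lambda>r s. q r s"] q_int
      by (intro Bochner_Integration.integral_add) auto
    also have "(\<integral>r. \<integral>s. q s r \<partial>N \<partial>N) = (\<integral>r. \<integral>s. q r s \<partial>N \<partial>N)"
      by (rule NN.Fubini_integral) (rule q_int)
    finally show ?thesis
      using p by (simp add: q_inner inner_commute)
  qed
  have "P r = (\<integral>s. (if s < r then u s else 0) \<partial>N)" if "r < t" for r
    unfolding P_def p_def using that by (intro Bochner_Integration.integral_cong) auto
  then have "(\<integral>r. (if r < t then u r \<bullet> (a + (\<integral>s. (if s < r then u s else 0) \<partial>N)) else 0) \<partial>N)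
      = (\<integral>r. p r \<bullet> a + p r \<bullet> P r \<partial>N)"
    by (intro Bochner_Integration.integral_cong) (auto simp: p_def inner_add_right)
  also have "\<dots> = (\<integral>r. p r \<partial>N) \<bullet> a + (\<integral>r. p r \<bullet> P r \<partial>N)"
    using p NN.integrable_fst'[OF q_int] by (subst Bochner_Integration.integral_add) (auto simp: q_inner)
  finally have "2 * (\<integral>r. (if r < t then u r \<bullet> (a + (\<integral>s. (if s < r then u s else 0) \<partial>N)) else 0) \<partial>N)
      = 2 * (a \<bullet> (\<integral>r. p r \<partial>N)) + (\<integral>r. p r \<partial>N) \<bullet> (\<integral>r. p r \<partial>N)"
    by (simp add: sq inner_commute)
  then show ?thesis
    by (simp add: power2_norm_eq_inner inner_add_left inner_add_right inner_commute p_def)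
qed

text \<open>
  The primitive in time of \<open>h\<close> with initial value \<open>a\<close>. The bound \<open>r < t\<close> sits in the integrand and
  not in the domain of integration, which gives joint measurability in \<open>t\<close> and \<open>x\<close> at once.
\<close>

definition evolve :: "real \<Rightarrow> ('x \<Rightarrow> 'b::euclidean_space) \<Rightarrow> (real \<Rightarrow> 'x \<Rightarrow> 'b) \<Rightarrow> real \<Rightarrow> 'x \<Rightarrow> 'b" where
  "evolve T a h t x = a x + (\<integral>r. (if r < t then h r x else 0) \<partial>vol {0<..<T})"

lemma evolve_0 [simp]: "evolve T a h 0 = a"
proof
  fix x
  have "(\<integral>r. (if r < 0 then h r x else 0) \<partial>vol {0<..<T}) = (\<integral>r. 0 \<partial>vol {0<..<T})"
    by (intro Bochner_Integration.integral_cong) (auto simp: space_restrict_space)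
  then show "evolve T a h 0 x = a x" by (simp add: evolve_def)
qed

lemma evolve_zero_add: "evolve T a h t x = a x + evolve T (\<lambda>_. 0) h t x"
  by (simp add: evolve_def)

lemma evolve_measurable:
  fixes h :: "real \<Rightarrow> 'x \<Rightarrow> 'b::euclidean_space"
  assumes [measurable]: "(\<lambda>(x, r). h r x) \<in> borel_measurable (V \<Otimes>\<^sub>M vol {0<..<T::real})" "a \<in> borel_measurable V"
  shows "(\<lambda>(x, t). evolve T a h t x) \<in> borel_measurable (V \<Otimes>\<^sub>M borel)"
proof -
  interpret N: finite_measure "vol {0<..<T::real}"
    by (rule finite_measure_vol) auto
  have [measurable]: "(\<lambda>x. x) \<in> borel_measurable (vol {0<..<T::real})"
    by (rule measurable_restrict_space1) simp
  show ?thesis unfolding evolve_def by measurable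
qed

lemma evolve_section_measurable:
  fixes h :: "real \<Rightarrow> 'x \<Rightarrow> 'b::euclidean_space"
  assumes "(\<lambda>(x, r). h r x) \<in> borel_measurable (V \<Otimes>\<^sub>M vol {0<..<T::real})" "a \<in> borel_measurable V"
  shows "evolve T a h t \<in> borel_measurable V"
  using measurable_Pair1[OF evolve_measurable[OF assms], of t] by simp

lemma evolve_bound:
  assumes "integrable (vol {0<..<T::real}) (\<lambda>r. h r x)"
  shows "norm (evolve T a h t x) \<le> norm (a x) + (\<integral>r. norm (h r x) \<partial>vol {0<..<T})"
proof -
  have [measurable]: "(\<lambda>x. x) \<in> borel_measurable (vol {0<..<T::real})"
    by (rule measurable_restrict_space1) simp
  note [measurable] = borel_measurable_integrable[OF assms]
  have "norm (\<integral>r. (if r < t then h r x else 0) \<partial>vol {0<..<T}) \<le> (\<integral>r. norm (h r x) \<partial>vol {0<..<T})"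
    by (rule Bochner_Integration.integral_norm_bound_integral)
       (use assms in \<open>auto intro!: Bochner_Integration.integrable_bound[OF assms]\<close>)
  then show ?thesis
    unfolding evolve_def by (intro norm_triangle_le) simp
qed

lemma Lp_2_iff: "u \<in> Lp 2 S \<longleftrightarrow> L2_on (vol S) u"
  by (simp add: Lp_def L2_on_def)

lemma Lp_norm_2: "Lp_norm 2 S u = sqrt (\<integral>x. (norm (u x))\<^sup>2 \<partial>vol S)"
  by (simp add: Lp_norm_def powr_half_sqrt)

text \<open>
  At every time the primitive is dominated by the one function \<open>|a| + \<integral>|h(r)| dr\<close>, which is
  square integrable by Minkowski's inequality.
\<close>

lemma evolve_integrable:
  fixes h :: "real \<Rightarrow> 'x \<Rightarrow> 'b::euclidean_space"
  assumes V: "sigma_finite_measure V" and h: "L1_L2 (vol {0<..<T}) V h" and a: "L2_on V a"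
  shows "L2_on V (evolve T a h t)"
    and "integrable (V \<Otimes>\<^sub>M vol {0<..<T}) (\<lambda>(x, r). h r x \<bullet> evolve T a h r x)"
proof -
  let ?N = "vol {0<..<T}"
  interpret N: finite_measure ?N by (rule finite_measure_vol) auto
  interpret V: sigma_finite_measure V by fact
  interpret VN: pair_sigma_finite V ?N ..
  have [measurable]: "(\<lambda>x. x) \<in> borel_measurable ?N"
    by (rule measurable_restrict_space1) simp
  have [measurable]: "(\<lambda>(x, r). h r x) \<in> borel_measurable (V \<Otimes>\<^sub>M ?N)"
    using h by (simp add: L1_L2_def)
  note [measurable] = L2_onD[OF a] evolve_measurable evolve_section_measurable
  note B = L1_L2_time_integral[OF N.sigma_finite_measure_axioms V h]
  define D where "D x = norm (a x) + (\<integral>r. norm (h r x) \<partial>?N)" for x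
  have D: "L2_on V D"
    unfolding D_def by (intro L2_on_add L2_on_norm a B(2))
  have bound: "AE x in V. \<forall>r. norm (evolve T a h r x) \<le> norm (D x)"
    using B(1)
  proof eventually_elim
    case (elim x)
    then show ?case using evolve_bound[where h = h and x = x and a = a, OF elim] by (auto simp: D_def intro: order_trans[OF _ abs_ge_self])
  qed
  show "L2_on V (evolve T a h t)"
    by (rule L2_on_bound[OF D]) (use bound in \<open>auto elim: eventually_mono\<close>)
  have m: "(\<lambda>(x, r). h r x \<bullet> evolve T a h r x) \<in> borel_measurable (V \<Otimes>\<^sub>M ?N)"
  proof -
    have [measurable]: "(\<lambda>(x, r). evolve T a h r x) \<in> borel_measurable (V \<Otimes>\<^sub>M borel)"
      by measurable
    have "(\<lambda>p. case (fst p, snd p) of (x, r) \<Rightarrow> evolve T a h r x) \<in> borel_measurable (V \<Otimes>\<^sub>M ?N)"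
      by measurable
    then have [measurable]: "(\<lambda>(x, r). evolve T a h r x) \<in> borel_measurable (V \<Otimes>\<^sub>M ?N)"
      by (simp add: case_prod_unfold)
    show ?thesis by measurable
  qed
  note [measurable] = this
  have hD: "integrable (V \<Otimes>\<^sub>M ?N) (\<lambda>(x, r). norm (h r x) * norm (D x))"
    by (rule L1_L2_integrable_product[OF N.sigma_finite_measure_axioms V h D])
  show "integrable (V \<Otimes>\<^sub>M ?N) (\<lambda>(x, r). h r x \<bullet> evolve T a h r x)"
  proof (rule VN.Fubini_integrable[OF m])
    have sec: "AE x in V. integrable ?N (\<lambda>r. h r x \<bullet> evolve T a h r x) \<and>
       (\<integral>r. \<bar>h r x \<bullet> evolve T a h r x\<bar> \<partial>?N) \<le> (\<integral>r. norm (h r x) \<partial>?N) * norm (D x)"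
      using bound B(1) AE_space
    proof eventually_elim
      case (elim x)
      have le: "\<bar>h r x \<bullet> evolve T a h r x\<bar> \<le> norm (h r x) * norm (D x)" for r
        using elim(1) by (intro order_trans[OF Cauchy_Schwarz_ineq2] mult_left_mono) auto
      have int: "integrable ?N (\<lambda>r. norm (h r x) * norm (D x))" using elim(2) by simp
      have "(\<lambda>r. h r x \<bullet> evolve T a h r x) \<in> borel_measurable ?N"
        using measurable_Pair2[OF m, of x] elim(3) by simp
      then have i: "integrable ?N (\<lambda>r. h r x \<bullet> evolve T a h r x)"
        by (rule Bochner_Integration.integrable_bound[OF int]) (use le in auto)
      moreover have "(\<integral>r. \<bar>h r x \<bullet> evolve T a h r x\<bar> \<partial>?N) \<le> (\<integral>r. norm (h r x) * norm (D x) \<partial>?N)"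
        by (rule integral_mono) (use i int le in auto)
      ultimately show ?case by simp
    qed
    then show "AE x in V. integrable ?N (\<lambda>r. case (x, r) of (x, r) \<Rightarrow> h r x \<bullet> evolve T a h r x)"
      by eventually_elim simp
    show "integrable V (\<lambda>x. \<integral>r. norm (case (x, r) of (x, r) \<Rightarrow> h r x \<bullet> evolve T a h r x) \<partial>?N)"
    proof (rule Bochner_Integration.integrable_bound)
      show "integrable V (\<lambda>x. norm (\<integral>r. norm (h r x) \<partial>?N) * norm (D x))"
        by (rule Cauchy_Schwarz_norm(1)[OF B(2) D])
      show "(\<lambda>x. \<integral>r. norm (case (x, r) of (x, r) \<Rightarrow> h r x \<bullet> evolve T a h r x) \<partial>?N) \<in> borel_measurable V"
        by measurable
      show "AE x in V. norm (\<integral>r. norm (case (x, r) of (x, r) \<Rightarrow> h r x \<bullet> evolve T a h r x) \<partial>?N)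
          \<le> norm (norm (\<integral>r. norm (h r x) \<partial>?N) * norm (D x))"
        using sec by eventually_elim (simp add: abs_mult)
    qed
  qed
qed

text \<open>
  The pointwise identity \<open>norm_square_primitive\<close> integrated over space.
\<close>

lemma evolve_energy:
  fixes h :: "real \<Rightarrow> 'x \<Rightarrow> 'b::euclidean_space"
  assumes V: "sigma_finite_measure V" and h: "L1_L2 (vol {0<..<T}) V h" and a: "L2_on V a"
  shows "integrable (vol {0<..<T}) (\<lambda>r. \<integral>x. h r x \<bullet> evolve T a h r x \<partial>V)"
    and "(\<integral>x. (norm (evolve T a h t x))\<^sup>2 \<partial>V) = (\<integral>x. (norm (a x))\<^sup>2 \<partial>V)
      + 2 * (\<integral>r. (if r < t then \<integral>x. h r x \<bullet> evolve T a h r x \<partial>V else 0) \<partial>vol {0<..<T})"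
proof -
  let ?N = "vol {0<..<T}"
  interpret N: finite_measure ?N by (rule finite_measure_vol) auto
  interpret V: sigma_finite_measure V by fact
  interpret VN: pair_sigma_finite V ?N ..
  have [measurable]: "(\<lambda>x. x) \<in> borel_measurable ?N"
    by (rule measurable_restrict_space1) simp
  note I = evolve_integrable[OF assms]
  note B = L1_L2_time_integral[OF N.sigma_finite_measure_axioms V h]
  show "integrable ?N (\<lambda>r. \<integral>x. h r x \<bullet> evolve T a h r x \<partial>V)"
    using VN.integrable_snd[OF I(2)] by simp
  define q where "q x r = (if r < t then h r x \<bullet> evolve T a h r x else 0)" for x r
  have q: "integrable (V \<Otimes>\<^sub>M ?N) (\<lambda>(x, r). q x r)"
  proof (rule Bochner_Integration.integrable_bound[OF I(2)])
    note [measurable] = borel_measurable_integrable[OF I(2)]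
    show "(\<lambda>(x, r). q x r) \<in> borel_measurable (V \<Otimes>\<^sub>M ?N)"
      unfolding q_def by measurable
  qed (auto simp: q_def)
  have "AE x in V. (norm (evolve T a h t x))\<^sup>2 = (norm (a x))\<^sup>2 + 2 * (\<integral>r. q x r \<partial>?N)"
    using B(1) unfolding evolve_def q_def by eventually_elim (rule norm_square_primitive)
  moreover have qx: "integrable V (\<lambda>x. \<integral>r. q x r \<partial>?N)"
    using VN.integrable_fst'[OF q] by simp
  ultimately have "(\<integral>x. (norm (evolve T a h t x))\<^sup>2 \<partial>V) = (\<integral>x. (norm (a x))\<^sup>2 + 2 * (\<integral>r. q x r \<partial>?N) \<partial>V)"
    using L2_on_integrable[OF I(1)[of t]] L2_on_integrable[OF a]
    by (intro integral_cong_AE) auto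
  also have "\<dots> = (\<integral>x. (norm (a x))\<^sup>2 \<partial>V) + 2 * (\<integral>x. (\<integral>r. q x r \<partial>?N) \<partial>V)"
    using qx L2_on_integrable[OF a] by simp
  also have "(\<integral>x. (\<integral>r. q x r \<partial>?N) \<partial>V) = (\<integral>r. (\<integral>x. q x r \<partial>V) \<partial>?N)"
    by (rule VN.Fubini_integral[symmetric]) (rule q)
  also have "\<dots> = (\<integral>r. (if r < t then \<integral>x. h r x \<bullet> evolve T a h r x \<partial>V else 0) \<partial>?N)"
    by (intro Bochner_Integration.integral_cong) (auto simp: q_def)
  finally show "(\<integral>x. (norm (evolve T a h t x))\<^sup>2 \<partial>V) = (\<integral>x. (norm (a x))\<^sup>2 \<partial>V)
      + 2 * (\<integral>r. (if r < t then \<integral>x. h r x \<bullet> evolve T a h r x \<partial>V else 0) \<partial>?N)" .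
qed

lemma L1_L2_integrable_inner:
  fixes h :: "'t \<Rightarrow> 'x \<Rightarrow> 'b::euclidean_space"
  assumes N: "sigma_finite_measure N" and V: "sigma_finite_measure V"
    and h: "L1_L2 N V h" and \<eta>: "L2_on V \<eta>"
  shows "integrable N (\<lambda>r. \<integral>x. h r x \<bullet> \<eta> x \<partial>V)"
proof -
  interpret N: sigma_finite_measure N by fact
  interpret V: sigma_finite_measure V by fact
  interpret VN: pair_sigma_finite V N ..
  have [measurable]: "(\<lambda>(x, r). h r x) \<in> borel_measurable (V \<Otimes>\<^sub>M N)"
    using h by (simp add: L1_L2_def)
  note [measurable] = L2_onD[OF \<eta>]
  have "integrable (V \<Otimes>\<^sub>M N) (\<lambda>(x, r). h r x \<bullet> \<eta> x)"
    by (rule Bochner_Integration.integrable_bound[OF L1_L2_integrable_product[OF N V h \<eta>]])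
       (auto simp: Cauchy_Schwarz_ineq2)
  from VN.integrable_snd[OF this] show ?thesis by simp
qed

text \<open>
  Fubini's theorem in the form in which it is used below: pairing with a fixed \<open>\<eta>\<close> commutes with
  a bounded weight in time.
\<close>

lemma L1_L2_swap:
  fixes h :: "'t \<Rightarrow> 'x \<Rightarrow> 'b::euclidean_space" and \<psi> :: "'t \<Rightarrow> real"
  assumes N: "sigma_finite_measure N" and V: "sigma_finite_measure V"
    and h: "L1_L2 N V h" and \<eta>: "L2_on V \<eta>"
    and \<psi>: "\<psi> \<in> borel_measurable N" "\<And>r. \<bar>\<psi> r\<bar> \<le> C"
  shows "(\<integral>r. \<psi> r * (\<integral>x. h r x \<bullet> \<eta> x \<partial>V) \<partial>N) = (\<integral>x. (\<integral>r. \<psi> r *\<^sub>R h r x \<partial>N) \<bullet> \<eta> x \<partial>V)"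
proof -
  interpret N: sigma_finite_measure N by fact
  interpret V: sigma_finite_measure V by fact
  interpret VN: pair_sigma_finite V N ..
  have [measurable]: "(\<lambda>(x, r). h r x) \<in> borel_measurable (V \<Otimes>\<^sub>M N)"
    using h by (simp add: L1_L2_def)
  note [measurable] = L2_onD[OF \<eta>] \<psi>(1)
  note P = L1_L2_integrable_product[OF N V h \<eta>]
  have "0 \<le> C" using \<psi>(2) abs_ge_zero order_trans by blast
  have i: "integrable (V \<Otimes>\<^sub>M N) (\<lambda>(x, r). \<psi> r * (h r x \<bullet> \<eta> x))"
  proof (rule Bochner_Integration.integrable_bound[OF integrable_mult_right[OF P, of C]])
    have "\<bar>\<psi> r * (h r x \<bullet> \<eta> x)\<bar> \<le> \<bar>C * (norm (h r x) * norm (\<eta> x))\<bar>" for r x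
      using \<psi>(2)[of r] \<open>0 \<le> C\<close> Cauchy_Schwarz_ineq2[of "h r x" "\<eta> x"]
      by (auto simp: abs_mult intro!: mult_mono)
    then show "AE p in V \<Otimes>\<^sub>M N. norm (case p of (x, r) \<Rightarrow> \<psi> r * (h r x \<bullet> \<eta> x))
      \<le> norm (C * (case p of (x, r) \<Rightarrow> norm (h r x) * norm (\<eta> x)))"
      by (intro AE_I2) (auto split: prod.split)
  qed measurable
  have "(\<integral>r. \<psi> r * (\<integral>x. h r x \<bullet> \<eta> x \<partial>V) \<partial>N) = (\<integral>r. \<integral>x. \<psi> r * (h r x \<bullet> \<eta> x) \<partial>V \<partial>N)"
    by simp
  also have "\<dots> = (\<integral>x. \<integral>r. \<psi> r * (h r x \<bullet> \<eta> x) \<partial>N \<partial>V)"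
    by (rule VN.Fubini_integral) (rule i)
  also have "\<dots> = (\<integral>x. (\<integral>r. \<psi> r *\<^sub>R h r x \<partial>N) \<bullet> \<eta> x \<partial>V)"
  proof (rule integral_cong_AE)
    show "AE x in V. (\<integral>r. \<psi> r * (h r x \<bullet> \<eta> x) \<partial>N) = (\<integral>r. \<psi> r *\<^sub>R h r x \<partial>N) \<bullet> \<eta> x"
      using L1_L2_time_integral(1)[OF N V h]
    proof eventually_elim
      case (elim x)
      note [measurable] = borel_measurable_integrable[OF elim]
      have "integrable N (\<lambda>r. \<psi> r *\<^sub>R h r x)"
        by (rule Bochner_Integration.integrable_bound[OF integrable_scaleR_right[OF elim, of C]])
           (use \<psi>(2) \<open>0 \<le> C\<close> in \<open>auto intro!: mult_right_mono AE_I2\<close>)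
      then have "(\<integral>r. (\<psi> r *\<^sub>R h r x) \<bullet> \<eta> x \<partial>N) = (\<integral>r. \<psi> r *\<^sub>R h r x \<partial>N) \<bullet> \<eta> x"
        by (rule integral_inner_left)
      then show ?case by simp
    qed
  qed measurable
  finally show "(\<integral>r. \<psi> r * (\<integral>x. h r x \<bullet> \<eta> x \<partial>V) \<partial>N) = (\<integral>x. (\<integral>r. \<psi> r *\<^sub>R h r x \<partial>N) \<bullet> \<eta> x \<partial>V)" .
qed

section \<open>Weak derivatives in time\<close>

text \<open>
  The standard smooth transition from the value 0 on \<open>{..0}\<close> to the value 1 on \<open>{1..}\<close>.
\<close>

definition smooth_step :: "real \<Rightarrow> real" where
  "smooth_step y = flat 0 y * inverse (flat 0 y + flat 0 (1 - y))"

lemma flat_sum_pos: "flat 0 y + flat 0 (1 - y) > 0"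
  using flat_pos[of y 0] flat_pos[of "1 - y" 0] flat_nonneg[of 0 y] flat_nonneg[of 0 "1 - y"]
  by (cases "y > 0") auto

lemma smooth_step_simps: "y \<le> 0 \<Longrightarrow> smooth_step y = 0" "y \<ge> 1 \<Longrightarrow> smooth_step y = 1"
  using flat_sum_pos[of y] by (auto simp: smooth_step_def)

lemma smooth_step_bounds: "0 \<le> smooth_step y" "smooth_step y \<le> 1"
  using flat_sum_pos[of y] flat_nonneg[of 0 y] flat_nonneg[of 0 "1 - y"]
  by (auto simp: smooth_step_def divide_simps simp flip: divide_inverse)

lemma C_k_smooth_step: "C_k k smooth_step"
proof -
  have "C_k k (\<lambda>y. flat 0 ((-1) * y + 1))"
    by (rule C_k_compose_affine[OF bounded_linear_mult_right C_k_flat])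
  then have "C_k k (\<lambda>y. flat 0 (1 - y))" by simp
  then have "C_k k (\<lambda>y. inverse (flat 0 y + flat 0 (1 - y)))"
    by (intro C_k_inverse C_k_add C_k_flat) (auto simp: less_imp_neq[OF flat_sum_pos, symmetric])
  then show ?thesis
    unfolding smooth_step_def[abs_def] by (intro C_k_mult C_k_flat)
qed

lemma smooth_step_derivative:
  obtains \<rho> K where "\<And>y. (smooth_step has_real_derivative \<rho> y) (at y)" "continuous_on UNIV \<rho>"
    "\<And>y. y < 0 \<or> y > 1 \<Longrightarrow> \<rho> y = 0" "\<And>y. \<bar>\<rho> y\<bar> \<le> K"
proof -
  define \<rho> where "\<rho> y = frechet_derivative smooth_step (at y) 1" for y
  have hd: "(smooth_step has_derivative frechet_derivative smooth_step (at y)) (at y)" for y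
    by (rule C_k_SucD(1)[OF C_k_smooth_step])
  have "frechet_derivative smooth_step (at y) = (\<lambda>h. \<rho> y * h)" for y
  proof
    show "frechet_derivative smooth_step (at y) h = \<rho> y * h" for h
      using linear_cmul[OF has_derivative_linear[OF hd], of y h 1] by (simp add: \<rho>_def)
  qed
  with hd have d: "(smooth_step has_real_derivative \<rho> y) (at y)" for y
    by (simp add: has_field_derivative_def)
  have cont: "continuous_on UNIV \<rho>"
    using C_k_SucD(2)[OF C_k_smooth_step, of 1 0] by (simp add: \<rho>_def[abs_def])
  have zero: "\<rho> y = 0" if "y < 0 \<or> y > 1" for y
  proof -
    consider "y < 0" | "y > 1" using \<open>y < 0 \<or> y > 1\<close> by blast
    then have "(smooth_step has_real_derivative 0) (at y)"
    proof cases
      case 1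
      show ?thesis
        by (rule has_field_derivative_transform_within_open[where f = "\<lambda>_. 0" and S = "{..<0}"])
           (use 1 in \<open>auto simp: smooth_step_simps\<close>)
    next
      case 2
      show ?thesis
        by (rule has_field_derivative_transform_within_open[where f = "\<lambda>_. 1" and S = "{1<..}"])
           (use 2 in \<open>auto simp: smooth_step_simps\<close>)
    qed
    with d show ?thesis by (blast intro: DERIV_unique)
  qed
  have "compact (\<rho> ` {0..1})"
    using cont by (intro compact_continuous_image compact_Icc) (rule continuous_on_subset, auto)
  then obtain K where K: "\<forall>y\<in>{0..1}. \<bar>\<rho> y\<bar> \<le> K"
    by (auto dest!: compact_imp_bounded simp: bounded_iff)
  have "\<bar>\<rho> y\<bar> \<le> max K 0" for y
    using K zero[of y] by (cases "y \<in> {0..1}") (auto simp: not_le intro: order_trans[OF _ max.cobounded1])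
  with d cont zero show ?thesis by (rule that)
qed

lemma integrable_vol_continuous:
  fixes F :: "real \<Rightarrow> real"
  assumes "continuous_on {0..T} F"
  shows "integrable (vol {0<..<T}) F"
proof -
  have "set_integrable lborel {0<..<T} F"
    by (rule set_integrable_subset[OF borel_integrable_atLeastAtMost'[OF assms]]) auto
  then show ?thesis by (simp add: integrable_restrict_space set_integrable_def)
qed

lemma integral_vol_FTC:
  fixes y c :: "real \<Rightarrow> real"
  assumes y: "\<And>r. (y has_real_derivative c r) (at r)" and c: "continuous_on UNIV c" and s: "0 \<le> s" "s \<le> T"
  shows "(\<integral>r. (if s \<le> r then c r else 0) \<partial>vol {0<..<T}) = y T - y s"
proof -
  have [measurable]: "c \<in> borel_measurable borel" by (rule borel_measurable_continuous_onI[OF c])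
  have "(\<integral>r. (if s \<le> r then c r else 0) \<partial>vol {0<..<T})
      = (\<integral>r. indicator {0<..<T} r *\<^sub>R (if s \<le> r then c r else 0) \<partial>lborel)"
    by (rule integral_restrict_space) simp
  also have "\<dots> = (\<integral>r. indicator {s..T} r *\<^sub>R c r \<partial>lborel)"
  proof (rule integral_cong_AE)
    show "(\<lambda>r. indicator {0<..<T} r *\<^sub>R (if s \<le> r then c r else 0)) \<in> borel_measurable lborel"
      "(\<lambda>r. indicator {s..T} r *\<^sub>R c r) \<in> borel_measurable lborel" by measurable
    have "AE r in lborel. r \<noteq> 0" "AE r in lborel. r \<noteq> T" by (rule AE_lborel_singleton)+
    then show "AE r in lborel. indicator {0<..<T} r *\<^sub>R (if s \<le> r then c r else 0) = indicator {s..T} r *\<^sub>R c r"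
      by eventually_elim (use s in \<open>auto split: split_indicator\<close>)
  qed
  also have "\<dots> = y T - y s"
  proof (rule integral_FTC_atLeastAtMost)
    show "(y has_vector_derivative c r) (at r within {s..T})" for r
      unfolding has_real_derivative_iff_has_vector_derivative[symmetric]
      using y by (rule has_field_derivative_at_within)
  qed (use s c in \<open>auto intro: continuous_on_subset\<close>)
  finally show ?thesis .
qed

text \<open>
  The rescaled derivative of the step is an approximate identity: its mass is one by the fundamental
  theorem of calculus, it is bounded by \<open>n K\<close>, and it lives on an interval of length \<open>1 / n\<close> that
  shrinks to \<open>c\<close>.
\<close>

lemma smooth_step_approximate_identity:
  fixes g :: "real \<Rightarrow> real"
  assumes \<rho>: "\<And>y. (smooth_step has_real_derivative \<rho> y) (at y)" "continuous_on UNIV \<rho>"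
      "\<And>y. y < 0 \<or> y > 1 \<Longrightarrow> \<rho> y = 0" "\<And>y. \<bar>\<rho> y\<bar> \<le> K"
    and g: "continuous_on {0..T} g" and c: "c \<in> {0..T}"
    and cn: "cn \<longlonglongrightarrow> c" "\<forall>\<^sub>F n in sequentially. 0 \<le> cn n \<and> cn n + 1 / real n \<le> T"
  shows "(\<lambda>n. \<integral>s. real n * \<rho> (real n * (s - cn n)) * g s \<partial>vol {0<..<T}) \<longlonglongrightarrow> g c"
proof (rule LIMSEQ_I)
  let ?N = "vol {0<..<T}"
  interpret N: finite_measure ?N by (rule finite_measure_vol) auto
  fix e :: real assume "e > 0"
  have "0 \<le> K" using \<rho>(4) abs_ge_zero order_trans by blast
  \<comment> \<open>The shift by one covers the case \<open>K = 0\<close>.\<close>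
  define e' where "e' = e / 2 / (K + 1)"
  have e': "e' > 0" "K * e' < e"
  proof -
    show "e' > 0" using \<open>e > 0\<close> \<open>0 \<le> K\<close> by (simp add: e'_def)
    then have "K * e' \<le> (K + 1) * e'" by simp
    also have "(K + 1) * (x / (K + 1)) = x" for x :: real using \<open>0 \<le> K\<close> by simp
    then have "(K + 1) * e' = e / 2" unfolding e'_def .
    finally show "K * e' < e" using \<open>e > 0\<close> by simp
  qed
  obtain d where d: "d > 0" "\<And>s. s \<in> {0..T} \<Longrightarrow> dist s c < d \<Longrightarrow> dist (g s) (g c) < e'"
    using g c e'(1) unfolding continuous_on_iff by blast
  have "\<forall>\<^sub>F n in sequentially. dist (cn n) c < d / 2"
    by (rule tendstoD[OF cn(1)]) (use d(1) in simp)
  moreover have "\<forall>\<^sub>F n in sequentially. 1 / real n < d / 2"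
    using lim_inverse_n' d(1) by (intro order_tendstoD(2)[of _ 0]) auto
  moreover note cn(2) eventually_gt_at_top[of "0::nat"]
  ultimately have "\<forall>\<^sub>F n in sequentially. norm ((\<integral>s. real n * \<rho> (real n * (s - cn n)) * g s \<partial>?N) - g c) < e"
  proof eventually_elim
    case (elim n)
    define k where "k s = real n * \<rho> (real n * (s - cn n))" for s
    have k_cont: "continuous_on UNIV k"
      unfolding k_def by (intro continuous_intros continuous_on_compose2[OF \<rho>(2)]) auto
    have T: "0 < T" using elim(3,4) by (smt (verit) divide_pos_pos of_nat_0_less_iff)
    have k0: "k s = 0" if "s \<notin> {cn n..cn n + 1 / real n}" for s
    proof -
      have "real n * (s - cn n) < 0 \<or> real n * (s - cn n) > 1"
        using that elim(4) by (auto simp: mult_less_0_iff field_simps not_le)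
      then show ?thesis using \<rho>(3) by (auto simp: k_def)
    qed
    have k_bound: "\<bar>k s\<bar> \<le> real n * K" for s
      using \<rho>(4) by (auto simp: k_def abs_mult intro!: mult_left_mono)
    note int = integrable_vol_continuous
    have k_on: "continuous_on {0..T} k" using k_cont by (rule continuous_on_subset) simp
    have "(\<integral>s. k s \<partial>?N) = (\<integral>s. (if 0 \<le> s then k s else 0) \<partial>?N)"
      by (intro Bochner_Integration.integral_cong) (auto simp: space_restrict_space)
    also have "\<dots> = smooth_step (real n * (T - cn n)) - smooth_step (real n * (0 - cn n))"
    proof (rule integral_vol_FTC[OF _ k_cont])
      fix s
      have "((\<lambda>s. smooth_step (real n * (s - cn n))) has_real_derivative \<rho> (real n * (s - cn n)) * real n) (at s)"
        by (rule DERIV_chain2[OF \<rho>(1)]) (auto intro!: derivative_eq_intros)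
      then show "((\<lambda>s. smooth_step (real n * (s - cn n))) has_real_derivative k s) (at s)"
        by (simp only: k_def mult.commute)
    qed (use T in auto)
    also have "\<dots> = 1"
      using elim(3,4) by (subst smooth_step_simps(2), simp add: field_simps, subst smooth_step_simps(1))
        (auto simp: mult_nonneg_nonpos)
    finally have k1: "(\<integral>s. k s \<partial>?N) = 1" .
    have kg: "continuous_on {0..T} (\<lambda>s. k s * g s)" "continuous_on {0..T} (\<lambda>s. k s * (g s - g c))"
      using k_on g by (auto intro!: continuous_intros)
    have "(\<integral>s. k s * g s \<partial>?N) - g c = (\<integral>s. k s * g s \<partial>?N) - (\<integral>s. k s * g c \<partial>?N)"
      by (simp add: k1)
    also have "\<dots> = (\<integral>s. k s * (g s - g c) \<partial>?N)"
      using int[OF kg(1)] int[OF k_on] by (simp add: right_diff_distrib)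
    finally have "\<bar>(\<integral>s. k s * g s \<partial>?N) - g c\<bar> \<le> (\<integral>s. \<bar>k s * (g s - g c)\<bar> \<partial>?N)"
      by simp
    also have "\<dots> \<le> (\<integral>s. real n * K * e' * indicator {cn n..cn n + 1 / real n} s \<partial>?N)"
    proof (rule integral_mono)
      show "integrable ?N (\<lambda>s. \<bar>k s * (g s - g c)\<bar>)" using int[OF kg(2)] by simp
      have "integrable ?N (indicator {cn n..cn n + 1 / real n} :: real \<Rightarrow> real)"
        by (rule N.integrable_const_bound[where B = 1])
           (auto intro!: measurable_restrict_space1)
      then show "integrable ?N (\<lambda>s. real n * K * e' * indicator {cn n..cn n + 1 / real n} s)" by simp
      show "\<bar>k s * (g s - g c)\<bar> \<le> real n * K * e' * indicator {cn n..cn n + 1 / real n} s"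
        if "s \<in> space ?N" for s
      proof (cases "s \<in> {cn n..cn n + 1 / real n}")
        case True
        then have "dist s c < d"
          using elim(1,2) unfolding dist_real_def atLeastAtMost_iff by linarith
        then have "\<bar>g s - g c\<bar> \<le> e'"
          using d(2)[of s] that by (auto simp: space_restrict_space dist_real_def)
        then have "\<bar>k s\<bar> * \<bar>g s - g c\<bar> \<le> (real n * K) * e'"
          using k_bound \<open>0 \<le> K\<close> by (intro mult_mono) auto
        with True show ?thesis by (simp add: abs_mult)
      qed (simp add: k0)
    qed
    also have "\<dots> = real n * K * e' * measure ?N ({cn n..cn n + 1 / real n} \<inter> {0<..<T})"
    proof -
      have "(\<integral>s. indicator {cn n..cn n + 1 / real n} s \<partial>?N)
          = (\<integral>s. indicator ({cn n..cn n + 1 / real n} \<inter> {0<..<T}) s \<partial>?N)"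
        by (intro Bochner_Integration.integral_cong) (auto simp: space_restrict_space split: split_indicator)
      also have "\<dots> = measure ?N ({cn n..cn n + 1 / real n} \<inter> {0<..<T})"
        by (subst Bochner_Integration.integral_indicator) (auto simp: space_restrict_space Int_assoc)
      finally show ?thesis by simp
    qed
    also have "\<dots> \<le> real n * K * e' * (1 / real n)"
    proof (rule mult_left_mono)
      have "measure ?N ({cn n..cn n + 1 / real n} \<inter> {0<..<T})
          = measure lborel ({cn n..cn n + 1 / real n} \<inter> {0<..<T})"
        by (rule measure_restrict_space) auto
      also have "\<dots> \<le> measure lborel {cn n..cn n + 1 / real n}"
        by (rule measure_mono_fmeasurable) (auto simp: fmeasurable_def)
      finally show "measure ?N ({cn n..cn n + 1 / real n} \<inter> {0<..<T}) \<le> 1 / real n" by simp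
    qed (use \<open>0 \<le> K\<close> e' in auto)
    also have "\<dots> < e" using e'(2) elim(4) by simp
    finally show ?case by (simp add: k_def mult.assoc)
  qed
  then show "\<exists>no. \<forall>n\<ge>no. norm ((\<integral>s. real n * \<rho> (real n * (s - cn n)) * g s \<partial>?N) - g c) < e"
    by (simp add: eventually_sequentially)
qed

text \<open>
  The test functions are smooth versions of the indicator of \<open>(0,t)\<close>. Their derivatives tend to
  a unit mass at \<open>0\<close> minus a unit mass at \<open>t\<close>, and the functions themselves converge boundedly.
\<close>

lemma weak_derivative_imp_increment:
  fixes g h :: "real \<Rightarrow> real"
  assumes g: "continuous_on {0..T} g" and h: "integrable (vol {0<..<T}) h"
    and weak: "\<And>\<psi>. \<psi> \<in> test_functions {0<..<T} \<Longrightarrow>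
      (\<integral>s. deriv \<psi> s * g s \<partial>vol {0<..<T}) = - (\<integral>s. \<psi> s * h s \<partial>vol {0<..<T})"
    and t: "0 < t" "t \<le> T"
  shows "g t - g 0 = (\<integral>s. (if s < t then h s else 0) \<partial>vol {0<..<T})"
proof -
  let ?N = "vol {0<..<T}"
  obtain \<rho> K where \<rho>: "\<And>y. (smooth_step has_real_derivative \<rho> y) (at y)" "continuous_on UNIV \<rho>"
    "\<And>y. y < 0 \<or> y > 1 \<Longrightarrow> \<rho> y = 0" "\<And>y. \<bar>\<rho> y\<bar> \<le> K"
    using smooth_step_derivative by blast
  \<comment> \<open>The transitions take place on \<open>[1/n, 2/n]\<close> and \<open>[t - 2/n, t - 1/n]\<close>: the support is compact in
    \<open>(0,T)\<close> even for \<open>t = T\<close>.\<close>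
  define \<psi> where "\<psi> n s = smooth_step (real n * (s - 1 / real n)) - smooth_step (real n * (s - (t - 2 / real n)))" for n s
  have large: "\<forall>\<^sub>F n in sequentially. 3 / real n < t"
    using tendsto_mult_right_zero[OF lim_inverse_n', of 3] t(1)
    by (intro order_tendstoD(2)[of _ 0]) auto
  note pos = eventually_gt_at_top[of "0::nat"]
  have ge1: "1 \<le> real n * y" if "1 / real n \<le> y" "0 < n" for n y
    using that by (simp add: field_simps)
  have le0: "real n * y \<le> 0" if "y \<le> 0" for n y
    using that by (simp add: mult_nonneg_nonpos)
  have frac: "2 / real n = 2 * (1 / real n)" "3 / real n = 3 * (1 / real n)" for n by auto
  have test: "\<forall>\<^sub>F n in sequentially. \<psi> n \<in> test_functions {0<..<T}"
    using large pos
  proof eventually_elim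
    case (elim n)
    have C: "C_k k (\<lambda>s. smooth_step (real n * (s - c)))" for k c
      using C_k_compose_affine[OF bounded_linear_mult_right C_k_smooth_step, of k "real n" "- real n * c"]
      by (simp add: algebra_simps)
    show ?case
    proof (rule test_functionsI[where K = "{1 / real n .. t - 1 / real n}"])
      show "C_k k (\<psi> n)" for k
        using C_k_add[OF C[of k "1 / real n"] C_k_mult[OF C_k_const[of k "-1"] C[of k "t - 2 / real n"]]]
        by (simp add: \<psi>_def[abs_def])
      show "{1 / real n..t - 1 / real n} \<subseteq> {0<..<T}"
      proof -
        have n: "0 < 1 / real n" using elim by simp
        show ?thesis
        proof
          fix s assume "s \<in> {1 / real n..t - 1 / real n}"
          then have "1 / real n \<le> s" "s \<le> t - 1 / real n" by auto
          with n t have "0 < s" "s < T" by linarith+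
          then show "s \<in> {0<..<T}" by simp
        qed
      qed
      show "\<psi> n s = 0" if "s \<notin> {1 / real n..t - 1 / real n}" for s
      proof -
        consider "s < 1 / real n" | "s > t - 1 / real n"
          using \<open>s \<notin> {1 / real n..t - 1 / real n}\<close> by (auto simp: not_le)
        then show ?thesis
        proof cases
          case 1
          from 1 elim frac[of n] have "s - 1 / real n \<le> 0" "s - (t - 2 / real n) \<le> 0" by linarith+
          then have "real n * (s - 1 / real n) \<le> 0" "real n * (s - (t - 2 / real n)) \<le> 0"
            using le0 by blast+
          then show ?thesis by (simp add: \<psi>_def smooth_step_simps)
        next
          case 2
          from 2 elim frac[of n] have "s - 1 / real n \<ge> 1 / real n" "s - (t - 2 / real n) \<ge> 1 / real n"
            by linarith+
          then have "real n * (s - 1 / real n) \<ge> 1" "real n * (s - (t - 2 / real n)) \<ge> 1"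
            using elim ge1 by blast+
          then show ?thesis by (simp add: \<psi>_def smooth_step_simps)
        qed
      qed
    qed auto
  qed
  have deriv: "deriv (\<psi> n) s = real n * \<rho> (real n * (s - 1 / real n)) - real n * \<rho> (real n * (s - (t - 2 / real n)))" for n s
  proof (rule DERIV_imp_deriv)
    have D: "((\<lambda>s. smooth_step (real n * (s - c))) has_real_derivative \<rho> (real n * (s - c)) * real n) (at s)" for c
      by (rule DERIV_chain2[OF \<rho>(1)]) (auto intro!: derivative_eq_intros)
    from DERIV_diff[OF D[of "1 / real n"] D[of "t - 2 / real n"]]
    show "(\<psi> n has_real_derivative real n * \<rho> (real n * (s - 1 / real n)) - real n * \<rho> (real n * (s - (t - 2 / real n)))) (at s)"
      by (simp add: \<psi>_def[abs_def] mult.commute)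
  qed
  have "(\<lambda>n. (\<integral>s. real n * \<rho> (real n * (s - 1 / real n)) * g s \<partial>?N)
      - (\<integral>s. real n * \<rho> (real n * (s - (t - 2 / real n))) * g s \<partial>?N)) \<longlonglongrightarrow> g 0 - g t"
  proof (intro tendsto_diff smooth_step_approximate_identity[OF \<rho> g])
    show "(\<lambda>n. 1 / real n) \<longlonglongrightarrow> 0" by (rule lim_inverse_n')
    show "(\<lambda>n. t - 2 / real n) \<longlonglongrightarrow> t"
      using tendsto_diff[OF tendsto_const tendsto_mult_right_zero[OF lim_inverse_n', of 2], of t] by simp
    show "\<forall>\<^sub>F n in sequentially. 0 \<le> 1 / real n \<and> 1 / real n + 1 / real n \<le> T"
      using large by eventually_elim (use t in \<open>auto simp: field_simps\<close>)
    show "\<forall>\<^sub>F n in sequentially. 0 \<le> t - 2 / real n \<and> t - 2 / real n + 1 / real n \<le> T"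
      using large pos
    proof eventually_elim
      case (elim n)
      then have "0 < 1 / real n" by simp
      with elim t frac[of n] show ?case by linarith
    qed
  qed (use t in auto)
  moreover have "\<forall>\<^sub>F n in sequentially. (\<integral>s. real n * \<rho> (real n * (s - 1 / real n)) * g s \<partial>?N)
      - (\<integral>s. real n * \<rho> (real n * (s - (t - 2 / real n))) * g s \<partial>?N) = - (\<integral>s. \<psi> n s * h s \<partial>?N)"
    using test
  proof eventually_elim
    case (elim n)
    have "continuous_on {0..T} (\<lambda>s. real n * \<rho> (real n * (s - c)) * g s)" for c
      using g by (intro continuous_intros continuous_on_compose2[OF \<rho>(2)]) auto
    then have "integrable ?N (\<lambda>s. real n * \<rho> (real n * (s - c)) * g s)" for c
      by (rule integrable_vol_continuous)
    then have "(\<integral>s. real n * \<rho> (real n * (s - 1 / real n)) * g s \<partial>?N)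
      - (\<integral>s. real n * \<rho> (real n * (s - (t - 2 / real n))) * g s \<partial>?N) = (\<integral>s. deriv (\<psi> n) s * g s \<partial>?N)"
      by (simp add: deriv left_diff_distrib)
    with weak[OF elim] show ?case by simp
  qed
  ultimately have "(\<lambda>n. - (\<integral>s. \<psi> n s * h s \<partial>?N)) \<longlonglongrightarrow> g 0 - g t"
    by (rule Lim_transform_eventually)
  moreover have "(\<lambda>n. \<integral>s. \<psi> n s * h s \<partial>?N) \<longlonglongrightarrow> (\<integral>s. (if s < t then h s else 0) \<partial>?N)"
  proof (rule integral_dominated_convergence[where w = "\<lambda>s. \<bar>h s\<bar>"])
    have [measurable]: "(\<lambda>x. x) \<in> borel_measurable ?N"
      by (rule measurable_restrict_space1) simp
    note [measurable] = borel_measurable_integrable[OF h]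
    have "continuous_on UNIV smooth_step" using C_k_smooth_step[of 0] by simp
    then have [measurable]: "smooth_step \<in> borel_measurable borel"
      by (rule borel_measurable_continuous_onI)
    show "(\<lambda>s. if s < t then h s else 0) \<in> borel_measurable ?N" by measurable
    show "(\<lambda>s. \<psi> n s * h s) \<in> borel_measurable ?N" for n
      unfolding \<psi>_def by measurable
    show "integrable ?N (\<lambda>s. \<bar>h s\<bar>)" using h by simp
    have "\<bar>\<psi> n s\<bar> \<le> 1" for n s
      using smooth_step_bounds by (auto simp: \<psi>_def abs_le_iff intro: diff_mono[of _ 1 0, simplified] order_trans)
    then show "AE s in ?N. norm (\<psi> n s * h s) \<le> \<bar>h s\<bar>" for n
      by (intro AE_I2) (simp add: abs_mult mult_left_le_one_le)
    show "AE s in ?N. (\<lambda>n. \<psi> n s * h s) \<longlonglongrightarrow> (if s < t then h s else 0)"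
    proof (intro AE_I2 tendsto_eventually)
      fix s assume "s \<in> space ?N"
      then have s: "0 < s" by (simp add: space_restrict_space)
      have first: "\<forall>\<^sub>F n in sequentially. 2 / real n < s"
        using tendsto_mult_right_zero[OF lim_inverse_n', of 2] s
        by (intro order_tendstoD(2)[of _ 0]) auto
      show "\<forall>\<^sub>F n in sequentially. \<psi> n s * h s = (if s < t then h s else 0)"
      proof (cases "s < t")
        case True
        have "\<forall>\<^sub>F n in sequentially. 2 / real n < t - s"
          using tendsto_mult_right_zero[OF lim_inverse_n', of 2] True
          by (intro order_tendstoD(2)[of _ 0]) auto
        with first pos show ?thesis
        proof eventually_elim
          case (elim n)
          with frac[of n] have "s - 1 / real n \<ge> 1 / real n" "s - (t - 2 / real n) \<le> 0"
            by linarith+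
          then have "real n * (s - 1 / real n) \<ge> 1" "real n * (s - (t - 2 / real n)) \<le> 0"
            using elim ge1 le0 by blast+
          with True show ?case by (simp add: \<psi>_def smooth_step_simps)
        qed
      next
        case False
        from first pos show ?thesis
        proof eventually_elim
          case (elim n)
          then have "0 < 1 / real n" by simp
          with elim False frac[of n] have "s - 1 / real n \<ge> 1 / real n" "s - (t - 2 / real n) \<ge> 1 / real n"
            by linarith+
          then have "real n * (s - 1 / real n) \<ge> 1" "real n * (s - (t - 2 / real n)) \<ge> 1"
            using elim ge1 by blast+
          with False show ?case by (simp add: \<psi>_def smooth_step_simps)
        qed
      qed
    qed
  qed
  ultimately have "- (\<integral>s. (if s < t then h s else 0) \<partial>?N) = g 0 - g t"
    by (blast intro: LIMSEQ_unique tendsto_minus)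
  then show ?thesis by simp
qed

lemma vol_product_measurable:
  assumes f: "f \<in> borel_measurable (vol (S \<times> \<Omega>))"
  shows "(\<lambda>(x, r). f (r, x)) \<in> borel_measurable (vol \<Omega> \<Otimes>\<^sub>M vol S)"
proof -
  have [measurable]: "(\<lambda>x. x) \<in> borel_measurable (vol S)" "(\<lambda>x. x) \<in> borel_measurable (vol \<Omega>)"
    by (rule measurable_restrict_space1, simp)+
  have "(\<lambda>p. (snd p, fst p)) \<in> measurable (vol \<Omega> \<Otimes>\<^sub>M vol S) (vol (S \<times> \<Omega>))"
  proof (rule measurable_restrict_space2)
    show "(\<lambda>p. (snd p, fst p)) \<in> space (vol \<Omega> \<Otimes>\<^sub>M vol S) \<rightarrow> S \<times> \<Omega>"
      by (auto simp: space_pair_measure space_restrict_space)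
    have "(\<lambda>p. (snd p, fst p)) \<in> borel_measurable (vol \<Omega> \<Otimes>\<^sub>M vol S)"
      by measurable
    then show "(\<lambda>p. (snd p, fst p)) \<in> measurable (vol \<Omega> \<Otimes>\<^sub>M vol S) lborel"
      by simp
  qed
  from measurable_compose[OF this f] show ?thesis
    by (simp add: case_prod_unfold)
qed

lemma Bochner_Lp_L1_L2:
  assumes "u \<in> Bochner_Lp Y 2 T \<Omega>" and "Y = Lp 1 {0<..<T} \<or> Y = Linf {0<..<T}"
  shows "L1_L2 (vol {0<..<T}) (vol \<Omega>) u"
proof -
  let ?N = "vol {0<..<T}"
  interpret N: finite_measure ?N by (rule finite_measure_vol) auto
  have "(\<lambda>(t, x). u t x) \<in> borel_measurable (vol ({0<..<T} \<times> \<Omega>))"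
    using assms(1) by (simp add: Bochner_Lp_def)
  from vol_product_measurable[OF this]
  have "(\<lambda>(x, r). u r x) \<in> borel_measurable (vol \<Omega> \<Otimes>\<^sub>M ?N)" by simp
  moreover have "AE r in ?N. integrable (vol \<Omega>) (\<lambda>x. (norm (u r x))\<^sup>2)"
    using assms(1) by (auto simp: Bochner_Lp_def AE_restrict_space_iff Lp_2_iff L2_on_def elim!: eventually_mono)
  moreover have "integrable ?N (\<lambda>r. sqrt (\<integral>x. (norm (u r x))\<^sup>2 \<partial>vol \<Omega>))"
    using assms(2)
  proof
    assume "Y = Lp 1 {0<..<T}"
    with assms(1) show ?thesis
      by (simp add: Bochner_Lp_def Lp_norm_2 Lp_def)
  next
    assume "Y = Linf {0<..<T}"
    with assms(1) obtain M where "(\<lambda>r. sqrt (\<integral>x. (norm (u r x))\<^sup>2 \<partial>vol \<Omega>)) \<in> borel_measurable ?N"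
      "AE r in ?N. norm (sqrt (\<integral>x. (norm (u r x))\<^sup>2 \<partial>vol \<Omega>)) \<le> M"
      by (auto simp: Bochner_Lp_def Lp_norm_2 Linf_def)
    then show ?thesis by (intro N.integrable_const_bound)
  qed
  ultimately show ?thesis by (simp add: L1_L2_def)
qed

lemma real_frechet_derivative_eq_deriv:
  fixes \<psi> :: "real \<Rightarrow> real"
  assumes "\<psi> differentiable at s"
  shows "frechet_derivative \<psi> (at s) 1 = deriv \<psi> s"
proof -
  have hd: "(\<psi> has_derivative frechet_derivative \<psi> (at s)) (at s)"
    using assms by (simp add: frechet_derivative_works)
  define D where "D = frechet_derivative \<psi> (at s) 1"
  have "frechet_derivative \<psi> (at s) = (\<lambda>h. D * h)"
  proof
    show "frechet_derivative \<psi> (at s) h = D * h" for h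
      using linear_cmul[OF has_derivative_linear[OF hd], of h 1] by (simp add: D_def)
  qed
  with hd have "(\<psi> has_real_derivative D) (at s)"
    by (simp add: has_field_derivative_def)
  then show ?thesis by (simp add: DERIV_imp_deriv D_def)
qed

lemma test_functions_deriv:
  fixes \<psi> :: "real \<Rightarrow> real"
  assumes "\<psi> \<in> test_functions S"
  shows "deriv \<psi> \<in> test_functions S"
proof -
  have "frechet_derivative \<psi> (at s) 1 = deriv \<psi> s" for s
    using test_functions_has_derivative[OF assms] by (intro real_frechet_derivative_eq_deriv differentiableI)
  then show ?thesis using test_functions_partial[OF assms, of 1] by simp
qed

text \<open>
  Let \<open>\<eta>\<close> be the difference of the two sides. For every \<open>\<eta>\<close> in \<open>L\<^sup>2\<close> the continuous function
  \<open>s \<mapsto> (w(s), \<eta>)\<close> has the weak derivative \<open>(w\<^sub>t(s), \<eta>)\<close>, so its increment over \<open>[0,t]\<close> is the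
  integral of the latter. For the present \<open>\<eta>\<close> this reads \<open>\<parallel>\<eta>\<parallel>\<^sup>2 = 0\<close>.
\<close>

lemma weak_time_derivative_evolve:
  fixes w wt :: "real \<Rightarrow> real ^ 'd \<Rightarrow> real ^ 'd"
  assumes \<Omega>: "\<Omega> \<in> sets borel" "bounded \<Omega>"
    and w: "L1_L2 (vol {0<..<T}) (vol \<Omega>) w" and wt: "L1_L2 (vol {0<..<T}) (vol \<Omega>) wt"
    and weak: "has_weak_time_derivative T \<Omega> w wt" and cont: "continuous_into_L2 T \<Omega> w"
    and t: "t \<in> {0..T}"
  shows "AE x in vol \<Omega>. w t x = evolve T (w 0) wt t x"
proof (cases "t = 0")
  case True
  then show ?thesis by simp
next
  case False
  let ?N = "vol {0<..<T}" and ?V = "vol \<Omega>"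
  interpret N: finite_measure ?N by (rule finite_measure_vol) auto
  interpret V: finite_measure ?V by (rule finite_measure_vol[OF \<Omega>])
  note sf = N.sigma_finite_measure_axioms V.sigma_finite_measure_axioms
  have t': "0 < t" "t \<le> T" using t False by auto
  have wL2: "L2_on ?V (w s)" if "s \<in> {0..T}" for s
    using cont that by (simp add: continuous_into_L2_def Lp_2_iff)
  define \<eta> where "\<eta> x = w t x - evolve T (w 0) wt t x" for x
  have e: "L2_on ?V (evolve T (w 0) wt t)"
    using t by (intro evolve_integrable(1) sf wt wL2) auto
  have \<eta>: "L2_on ?V \<eta>"
    unfolding \<eta>_def by (intro L2_on_diff wL2 t e)
  define g where "g s = (\<integral>x. w s x \<bullet> \<eta> x \<partial>?V)" for s
  define h where "h s = (\<integral>x. wt s x \<bullet> \<eta> x \<partial>?V)" for s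
  have "continuous_on {0..T} g"
    unfolding continuous_on_def
  proof
    fix s assume s: "s \<in> {0..T}"
    have lim: "((\<lambda>r. Lp_norm 2 \<Omega> (\<lambda>x. w r x - w s x) * sqrt (\<integral>x. (norm (\<eta> x))\<^sup>2 \<partial>?V)) \<longlongrightarrow> 0) (at s within {0..T})"
      using cont s by (auto simp: continuous_into_L2_def intro!: tendsto_mult_left_zero)
    have "((\<lambda>r. g r - g s) \<longlongrightarrow> 0) (at s within {0..T})"
    proof (rule Lim_null_comparison[OF _ lim])
      show "\<forall>\<^sub>F r in at s within {0..T}. norm (g r - g s) \<le> Lp_norm 2 \<Omega> (\<lambda>x. w r x - w s x) * sqrt (\<integral>x. (norm (\<eta> x))\<^sup>2 \<partial>?V)"
      proof (rule eventually_at_topological[THEN iffD2], intro exI[of _ UNIV] conjI ballI impI)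
        fix r assume r: "r \<in> {0..T}"
        have "g r - g s = (\<integral>x. (w r x - w s x) \<bullet> \<eta> x \<partial>?V)"
          unfolding g_def using L2_on_inner(1)[OF wL2[OF r] \<eta>] L2_on_inner(1)[OF wL2[OF s] \<eta>]
          by (simp add: inner_diff_left)
        then show "norm (g r - g s) \<le> Lp_norm 2 \<Omega> (\<lambda>x. w r x - w s x) * sqrt (\<integral>x. (norm (\<eta> x))\<^sup>2 \<partial>?V)"
          using L2_on_inner(2)[OF L2_on_diff[OF wL2[OF r] wL2[OF s]] \<eta>] by (simp add: Lp_norm_2)
      qed auto
    qed
    then show "(g \<longlongrightarrow> g s) (at s within {0..T})" by (rule LIM_zero_cancel)
  qed
  moreover have "integrable ?N h"
    unfolding h_def by (rule L1_L2_integrable_inner[OF sf wt \<eta>])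
  moreover have "(\<integral>s. deriv \<psi> s * g s \<partial>?N) = - (\<integral>s. \<psi> s * h s \<partial>?N)"
    if \<psi>: "\<psi> \<in> test_functions {0<..<T}" for \<psi>
  proof -
    note d = test_functions_deriv[OF \<psi>]
    obtain B where B: "\<And>s. \<bar>\<psi> s\<bar> \<le> B" using test_functions_bounded[OF \<psi>] by blast
    obtain B' where B': "\<And>s. \<bar>deriv \<psi> s\<bar> \<le> B'" using test_functions_bounded[OF d] by blast
    have m: "\<psi> \<in> borel_measurable ?N" "deriv \<psi> \<in> borel_measurable ?N"
      using test_functions_borel[OF \<psi>] test_functions_borel[OF d] by (auto intro: measurable_vol)
    have wtm: "(\<lambda>(x, r). wt r x) \<in> borel_measurable (?V \<Otimes>\<^sub>M ?N)" "(\<lambda>(x, r). w r x) \<in> borel_measurable (?V \<Otimes>\<^sub>M ?N)"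
      using wt w by (simp_all add: L1_L2_def)
    have "AE x in lborel. x \<in> \<Omega> \<longrightarrow> (\<integral>s. deriv \<psi> s *\<^sub>R w s x \<partial>?N) = - (\<integral>s. \<psi> s *\<^sub>R wt s x \<partial>?N)"
      using weak \<psi> by (simp add: has_weak_time_derivative_def)
    then have ae: "AE x in ?V. (\<integral>s. deriv \<psi> s *\<^sub>R w s x \<partial>?N) = - (\<integral>s. \<psi> s *\<^sub>R wt s x \<partial>?N)"
      using \<Omega>(1) by (simp add: AE_restrict_space_iff)
    have "(\<integral>s. deriv \<psi> s * g s \<partial>?N) = (\<integral>x. (\<integral>s. deriv \<psi> s *\<^sub>R w s x \<partial>?N) \<bullet> \<eta> x \<partial>?V)"
      unfolding g_def by (rule L1_L2_swap[OF sf w \<eta> m(2) B'])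
    also have "\<dots> = (\<integral>x. - ((\<integral>s. \<psi> s *\<^sub>R wt s x \<partial>?N) \<bullet> \<eta> x) \<partial>?V)"
    proof (rule integral_cong_AE)
      note [measurable] = m wtm L2_onD[OF \<eta>]
      show "(\<lambda>x. (\<integral>s. deriv \<psi> s *\<^sub>R w s x \<partial>?N) \<bullet> \<eta> x) \<in> borel_measurable ?V" by measurable
      show "(\<lambda>x. - ((\<integral>s. \<psi> s *\<^sub>R wt s x \<partial>?N) \<bullet> \<eta> x)) \<in> borel_measurable ?V" by measurable
      show "AE x in ?V. (\<integral>s. deriv \<psi> s *\<^sub>R w s x \<partial>?N) \<bullet> \<eta> x = - ((\<integral>s. \<psi> s *\<^sub>R wt s x \<partial>?N) \<bullet> \<eta> x)"
        using ae by eventually_elim simp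
    qed
    also have "\<dots> = - (\<integral>x. (\<integral>s. \<psi> s *\<^sub>R wt s x \<partial>?N) \<bullet> \<eta> x \<partial>?V)" by simp
    also have "(\<integral>x. (\<integral>s. \<psi> s *\<^sub>R wt s x \<partial>?N) \<bullet> \<eta> x \<partial>?V) = (\<integral>s. \<psi> s * h s \<partial>?N)"
      unfolding h_def by (rule L1_L2_swap[OF sf wt \<eta> m(1) B, symmetric])
    finally show ?thesis .
  qed
  ultimately have "g t - g 0 = (\<integral>s. (if s < t then h s else 0) \<partial>?N)"
    using t' by (rule weak_derivative_imp_increment)
  also have "\<dots> = (\<integral>s. (if s < t then 1 else 0) * h s \<partial>?N)"
    by (intro Bochner_Integration.integral_cong) auto
  also have "\<dots> = (\<integral>x. (\<integral>s. (if s < t then 1 else 0) *\<^sub>R wt s x \<partial>?N) \<bullet> \<eta> x \<partial>?V)"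
    unfolding h_def by (rule L1_L2_swap[OF sf wt \<eta>, of _ 1]) (auto intro!: measurable_vol)
  also have "\<dots> = (\<integral>x. (evolve T (w 0) wt t x - w 0 x) \<bullet> \<eta> x \<partial>?V)"
    unfolding evolve_def by (intro Bochner_Integration.integral_cong refl arg_cong2[where f = inner]) 
      (auto intro!: Bochner_Integration.integral_cong)
  also have "\<dots> = (\<integral>x. evolve T (w 0) wt t x \<bullet> \<eta> x \<partial>?V) - g 0"
    unfolding g_def inner_diff_left using t
    by (intro Bochner_Integration.integral_diff L2_on_inner(1) e \<eta> wL2) auto
  finally have "g t = (\<integral>x. evolve T (w 0) wt t x \<bullet> \<eta> x \<partial>?V)" by simp
  then have "(\<integral>x. \<eta> x \<bullet> \<eta> x \<partial>?V) = 0"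
    unfolding g_def using L2_on_inner(1)[OF wL2[OF t] \<eta>] L2_on_inner(1)[OF e \<eta>]
    by (subst (1) \<eta>_def) (simp add: inner_diff_left)
  then have "AE x in ?V. \<eta> x \<bullet> \<eta> x = 0"
    using L2_on_inner(1)[OF \<eta> \<eta>] by (subst (asm) integral_nonneg_eq_0_iff_AE) auto
  then show ?thesis by eventually_elim (simp add: \<eta>_def)
qed

section \<open>Weak gradients of primitives in time\<close>

lemma L2_on_bounded:
  assumes "finite_measure V" "f \<in> borel_measurable V" "\<And>x. norm (f x) \<le> B"
  shows "L2_on V f"
proof -
  interpret finite_measure V by fact
  show ?thesis
    unfolding L2_on_def
  proof (intro conjI integrable_const_bound[where B = "B\<^sup>2"])
    show "AE x in V. norm ((norm (f x))\<^sup>2) \<le> B\<^sup>2"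
      using assms(3) by (intro AE_I2) (auto intro!: power_mono)
  qed (use assms(2) in measurable)
qed

lemma L2_on_imp_integrable:
  assumes "finite_measure V" "L2_on V f"
  shows "integrable V f"
proof -
  interpret finite_measure V by fact
  have "integrable V (\<lambda>x. norm (f x))"
    by (rule square_integrable_imp_integrable) (use assms(2) in \<open>auto simp: L2_on_def\<close>)
  then show ?thesis
    using L2_onD[OF assms(2)] by (simp add: integrable_norm_iff)
qed

lemma L2_on_set_integrable:
  assumes \<Omega>: "\<Omega> \<in> sets borel" "bounded \<Omega>" and F: "L2_on (vol \<Omega>) F" and K: "compact K" "K \<subseteq> \<Omega>"
  shows "set_integrable lborel K F"
proof -
  have "set_integrable lborel \<Omega> F"
    using L2_on_imp_integrable[OF finite_measure_vol[OF \<Omega>] F] \<Omega>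
    by (simp add: integrable_restrict_space set_integrable_def)
  then show ?thesis
    by (rule set_integrable_subset) (use K in \<open>auto simp: compact_imp_closed\<close>)
qed

lemma L2_on_test_function_scaleR:
  fixes b :: "'b::euclidean_space"
  assumes \<Omega>: "\<Omega> \<in> sets borel" "bounded \<Omega>" and f: "f \<in> test_functions \<Omega>"
  shows "L2_on (vol \<Omega>) (\<lambda>x. f x *\<^sub>R b)"
proof -
  obtain B where "\<And>x. \<bar>f x\<bar> \<le> B" using test_functions_bounded[OF f] by blast
  moreover have "f \<in> borel_measurable (vol \<Omega>)"
    using test_functions_borel[OF f] by (rule measurable_vol)
  ultimately show ?thesis
    by (intro L2_on_bounded[OF finite_measure_vol[OF \<Omega>], where B = "B * norm b"])
       (auto intro!: mult_right_mono)
qed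

text \<open>
  In terms of vector and matrix valued test fields the defining identity is bilinear in \<open>L\<^sup>2\<close>, which
  is the form to which \<open>evolve_pairing\<close> applies.
\<close>

lemma has_weak_gradient_iff_pairing:
  fixes u :: "real ^ 'd \<Rightarrow> real ^ 'd"
  assumes \<Omega>: "\<Omega> \<in> sets borel" "bounded \<Omega>" and u: "L2_on (vol \<Omega>) u" "L2_on (vol \<Omega>) G"
  shows "has_weak_gradient \<Omega> u G \<longleftrightarrow> (\<forall>\<phi>\<in>test_functions \<Omega>. \<forall>i j.
     (\<integral>x. u x \<bullet> axis i (frechet_derivative \<phi> (at x) (axis j 1)) \<partial>vol \<Omega>)
      = - (\<integral>x. G x \<bullet> axis i (axis j (\<phi> x)) \<partial>vol \<Omega>))"
proof -
  have "set_integrable lborel K u \<and> set_integrable lborel K G" if "compact K" "K \<subseteq> \<Omega>" for K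
    using L2_on_set_integrable[OF \<Omega> u(1) that] L2_on_set_integrable[OF \<Omega> u(2) that] by simp
  then show ?thesis
    using u by (auto simp: has_weak_gradient_def inner_axis)
qed

lemma gradient_test_fields:
  fixes \<phi> :: "real ^ 'd \<Rightarrow> real"
  assumes \<Omega>: "\<Omega> \<in> sets borel" "bounded \<Omega>" and \<phi>: "\<phi> \<in> test_functions \<Omega>"
  shows "L2_on (vol \<Omega>) (\<lambda>x. axis i (frechet_derivative \<phi> (at x) (axis j 1)) :: real ^ 'd)"
    and "L2_on (vol \<Omega>) (\<lambda>x. axis i (axis j (\<phi> x)) :: real ^ 'd ^ 'd)"
proof -
  have basis: "(axis j 1 :: real ^ 'd) \<in> Basis" by (simp add: axis_in_Basis_iff)
  have axis: "axis i r = r *\<^sub>R (axis i 1 :: real ^ 'd)" for r i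
    by (simp add: vec_eq_iff axis_def)
  have axis2: "axis i (axis j r) = r *\<^sub>R (axis i (axis j 1) :: real ^ 'd ^ 'd)" for r
    by (simp add: vec_eq_iff axis_def)
  show "L2_on (vol \<Omega>) (\<lambda>x. axis i (frechet_derivative \<phi> (at x) (axis j 1)) :: real ^ 'd)"
    by (subst axis) (rule L2_on_test_function_scaleR[OF \<Omega> test_functions_partial[OF \<phi> basis]])
  show "L2_on (vol \<Omega>) (\<lambda>x. axis i (axis j (\<phi> x)) :: real ^ 'd ^ 'd)"
    by (subst axis2) (rule L2_on_test_function_scaleR[OF \<Omega> \<phi>])
qed

lemma has_weak_gradient_add:
  fixes u :: "real ^ 'd \<Rightarrow> real ^ 'd"
  assumes \<Omega>: "\<Omega> \<in> sets borel" "bounded \<Omega>"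
    and u: "L2_on (vol \<Omega>) u" "L2_on (vol \<Omega>) G" "has_weak_gradient \<Omega> u G"
    and v: "L2_on (vol \<Omega>) v" "L2_on (vol \<Omega>) H" "has_weak_gradient \<Omega> v H"
  shows "has_weak_gradient \<Omega> (\<lambda>x. u x + v x) (\<lambda>x. G x + H x)"
  using u(3) v(3) gradient_test_fields[OF \<Omega>]
  unfolding has_weak_gradient_iff_pairing[OF \<Omega> u(1,2)] has_weak_gradient_iff_pairing[OF \<Omega> v(1,2)]
    has_weak_gradient_iff_pairing[OF \<Omega> L2_on_add[OF u(1) v(1)] L2_on_add[OF u(2) v(2)]]
  by (simp add: inner_add_left L2_on_inner(1) u v)

lemma has_weak_gradient_uminus:
  fixes u :: "real ^ 'd \<Rightarrow> real ^ 'd"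
  assumes "has_weak_gradient \<Omega> u G"
  shows "has_weak_gradient \<Omega> (\<lambda>x. - u x) (\<lambda>x. - G x)"
  using assms by (auto simp: has_weak_gradient_def set_integrable_def)

lemma has_weak_gradient_cong_AE:
  fixes u :: "real ^ 'd \<Rightarrow> real ^ 'd"
  assumes \<Omega>: "\<Omega> \<in> sets borel" "bounded \<Omega>" and u: "L2_on (vol \<Omega>) u" "L2_on (vol \<Omega>) G"
    and v: "L2_on (vol \<Omega>) v" "AE x in vol \<Omega>. v x = u x" and uG: "has_weak_gradient \<Omega> u G"
  shows "has_weak_gradient \<Omega> v G"
proof -
  have "(\<integral>x. v x \<bullet> axis i (frechet_derivative \<phi> (at x) (axis j 1)) \<partial>vol \<Omega>)
      = (\<integral>x. u x \<bullet> axis i (frechet_derivative \<phi> (at x) (axis j 1)) \<partial>vol \<Omega>)"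
    if "\<phi> \<in> test_functions \<Omega>" for \<phi> i j
  proof -
    note [measurable] = L2_onD[OF gradient_test_fields(1)[OF \<Omega> that, of i j]] L2_onD[OF u(1)] L2_onD[OF v(1)]
    show ?thesis
    proof (rule integral_cong_AE)
      show "AE x in vol \<Omega>. v x \<bullet> axis i (frechet_derivative \<phi> (at x) (axis j 1))
        = u x \<bullet> axis i (frechet_derivative \<phi> (at x) (axis j 1))"
        using v(2) by eventually_elim simp
    qed measurable
  qed
  with uG show ?thesis
    unfolding has_weak_gradient_iff_pairing[OF \<Omega> u] has_weak_gradient_iff_pairing[OF \<Omega> v(1) u(2)]
    by simp
qed

lemma evolve_pairing:
  fixes h :: "real \<Rightarrow> 'x \<Rightarrow> 'b::euclidean_space"
  assumes V: "sigma_finite_measure V" and h: "L1_L2 (vol {0<..<T}) V h" and \<eta>: "L2_on V \<eta>"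
  shows "(\<integral>x. evolve T (\<lambda>_. 0) h t x \<bullet> \<eta> x \<partial>V)
    = (\<integral>r. (if r < t then 1 else 0) * (\<integral>x. h r x \<bullet> \<eta> x \<partial>V) \<partial>vol {0<..<T})"
proof -
  let ?N = "vol {0<..<T}"
  interpret N: finite_measure ?N by (rule finite_measure_vol) auto
  have "(\<integral>r. (if r < t then 1 else 0) * (\<integral>x. h r x \<bullet> \<eta> x \<partial>V) \<partial>?N)
      = (\<integral>x. (\<integral>r. (if r < t then 1 else 0) *\<^sub>R h r x \<partial>?N) \<bullet> \<eta> x \<partial>V)"
    by (rule L1_L2_swap[OF N.sigma_finite_measure_axioms V h \<eta>, of _ 1]) (auto intro!: measurable_vol)
  also have "(\<lambda>x. \<integral>r. (if r < t then 1 else 0) *\<^sub>R h r x \<partial>?N) = evolve T (\<lambda>_. 0) h t"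
    by (auto simp: evolve_def fun_eq_iff intro!: Bochner_Integration.integral_cong)
  finally show ?thesis by simp
qed

lemma L1_L2_section:
  assumes h: "L1_L2 N V h"
  shows "AE r in N. L2_on V (h r)"
proof -
  have m: "(\<lambda>(x, r). h r x) \<in> borel_measurable (V \<Otimes>\<^sub>M N)" and
    i: "AE r in N. integrable V (\<lambda>x. (norm (h r x))\<^sup>2)"
    using h by (simp_all add: L1_L2_def)
  show ?thesis
    using i AE_space
  proof eventually_elim
    case (elim r)
    with measurable_Pair1[OF m, of r] show ?case by (simp add: L2_on_def)
  qed
qed

text \<open>
  The pairings with test fields commute with the integral over time, and at almost every time they
  are related by the weak gradient.
\<close>

lemma has_weak_gradient_time_integral:
  fixes u :: "real \<Rightarrow> real ^ 'd \<Rightarrow> real ^ 'd"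
  assumes \<Omega>: "\<Omega> \<in> sets borel" "bounded \<Omega>"
    and u: "L1_L2 (vol {0<..<T}) (vol \<Omega>) u" and G: "L1_L2 (vol {0<..<T}) (vol \<Omega>) G"
    and uG: "AE r in vol {0<..<T}. has_weak_gradient \<Omega> (u r) (G r)"
  shows "has_weak_gradient \<Omega> (evolve T (\<lambda>_. 0) u t) (evolve T (\<lambda>_. 0) G t)"
proof -
  let ?N = "vol {0<..<T}" and ?V = "vol \<Omega>"
  interpret N: finite_measure ?N by (rule finite_measure_vol) auto
  interpret V: finite_measure ?V by (rule finite_measure_vol[OF \<Omega>])
  note sf = N.sigma_finite_measure_axioms V.sigma_finite_measure_axioms
  have zero: "L2_on ?V (\<lambda>_. 0)" by (simp add: L2_on_def)
  note L2 = evolve_integrable(1)[OF sf(2) u zero] evolve_integrable(1)[OF sf(2) G zero]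
  show ?thesis
    unfolding has_weak_gradient_iff_pairing[OF \<Omega> L2]
  proof (intro ballI allI)
    fix \<phi> :: "real ^ 'd \<Rightarrow> real" and i j
    assume \<phi>: "\<phi> \<in> test_functions \<Omega>"
    let ?U = "\<lambda>r. \<integral>x. u r x \<bullet> axis i (frechet_derivative \<phi> (at x) (axis j 1)) \<partial>?V"
    let ?G = "\<lambda>r. \<integral>x. G r x \<bullet> axis i (axis j (\<phi> x)) \<partial>?V"
    have sl: "AE r in ?N. L2_on ?V (u r) \<and> L2_on ?V (G r)"
      using L1_L2_section[OF u] L1_L2_section[OF G] by eventually_elim simp
    have eq: "AE r in ?N. ?U r = - ?G r"
      using uG sl
    proof eventually_elim
      case (elim r)
      then show ?case using has_weak_gradient_iff_pairing[OF \<Omega>, of "u r" "G r"] \<phi> by simp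
    qed
    note tf = gradient_test_fields[OF \<Omega> \<phi>]
    have mU: "?U \<in> borel_measurable ?N" and mG: "?G \<in> borel_measurable ?N"
      using L1_L2_integrable_inner[OF sf u tf(1)] L1_L2_integrable_inner[OF sf G tf(2)]
      by (auto dest!: borel_measurable_integrable)
    have [measurable]: "(\<lambda>r. r) \<in> borel_measurable ?N" by (simp add: measurable_vol)
    have "(\<integral>x. evolve T (\<lambda>_. 0) u t x \<bullet> axis i (frechet_derivative \<phi> (at x) (axis j 1)) \<partial>?V)
        = (\<integral>r. (if r < t then 1 else 0) * ?U r \<partial>?N)"
      by (rule evolve_pairing[OF sf(2) u tf(1)])
    also have "\<dots> = (\<integral>r. - ((if r < t then 1 else 0) * ?G r) \<partial>?N)"
    proof (rule integral_cong_AE)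
      show "(\<lambda>r. (if r < t then 1 else 0) * ?U r) \<in> borel_measurable ?N"
        by (rule borel_measurable_times[OF _ mU]) measurable
      show "(\<lambda>r. - ((if r < t then 1 else 0) * ?G r)) \<in> borel_measurable ?N"
        by (rule borel_measurable_uminus[OF borel_measurable_times[OF _ mG]]) measurable
      show "AE r in ?N. (if r < t then 1 else 0) * ?U r = - ((if r < t then 1 else 0) * ?G r)"
        using eq by eventually_elim simp
    qed
    also have "\<dots> = - (\<integral>x. evolve T (\<lambda>_. 0) G t x \<bullet> axis i (axis j (\<phi> x)) \<partial>?V)"
      by (simp add: evolve_pairing[OF sf(2) G tf(2)])
    finally show "(\<integral>x. evolve T (\<lambda>_. 0) u t x \<bullet> axis i (frechet_derivative \<phi> (at x) (axis j 1)) \<partial>?V)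
        = - (\<integral>x. evolve T (\<lambda>_. 0) G t x \<bullet> axis i (axis j (\<phi> x)) \<partial>?V)" .
  qed
qed

section \<open>Weak gradients of Sobolev fields\<close>

text \<open>
  A weak gradient is by definition measurable on compact subsets, and countably many of them
  cover \<open>\<Omega>\<close>.
\<close>

lemma weak_gradient_measurable:
  fixes u :: "real ^ 'd \<Rightarrow> real ^ 'd"
  assumes "open \<Omega>" "has_weak_gradient \<Omega> u G"
  shows "G \<in> borel_measurable (vol \<Omega>)"
proof -
  obtain D where D: "countable D" "D \<subseteq> Pow \<Omega>" "\<And>X. X \<in> D \<Longrightarrow> \<exists>a b. X = cbox a b" "\<Union>D = \<Omega>"
    using open_countable_Union_open_cbox[OF \<open>open \<Omega>\<close>] by metis
  show ?thesis
  proof (rule measurable_piecewise_restrict[OF D(1)])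
    fix X assume X: "X \<in> D"
    then obtain a b where ab: "X = cbox a b" using D(3) by blast
    have sub: "X \<subseteq> \<Omega>" using D(2) X by auto
    then show "X \<inter> space (vol \<Omega>) \<in> sets (vol \<Omega>)"
      using \<open>open \<Omega>\<close> by (auto simp: ab space_restrict_space sets_restrict_space_iff Int_absorb2)
    have "set_integrable lborel X G"
      using assms(2) sub by (auto simp: has_weak_gradient_def ab)
    then have "(\<lambda>x. indicator X x *\<^sub>R G x) \<in> borel_measurable lborel"
      unfolding set_integrable_def by (rule borel_measurable_integrable)
    then have "G \<in> borel_measurable (vol X)"
      by (subst borel_measurable_restrict_space_iff) (auto simp: ab)
    moreover have "restrict_space (vol \<Omega>) X = vol X"
      using sub \<open>open \<Omega>\<close> by (subst restrict_restrict_space) (auto simp: ab Int_absorb1 Int_absorb2)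
    ultimately show "G \<in> borel_measurable (restrict_space (vol \<Omega>) X)" by simp
  qed (use D(4) in \<open>auto simp: space_restrict_space\<close>)
qed

lemma weak_grad_works: "has_weak_gradient \<Omega> u G \<Longrightarrow> has_weak_gradient \<Omega> u (weak_grad \<Omega> u)"
  unfolding weak_grad_def by (rule someI[of "has_weak_gradient \<Omega> u"])

text \<open>
  Whatever weak gradient is chosen in the definition of \<open>weak_grad\<close>, norms and inner products that
  involve it agree with those of a given \<open>G\<close>.
\<close>

lemma weak_grad_unique:
  fixes u :: "real ^ 'd \<Rightarrow> real ^ 'd"
  assumes "open \<Omega>" "has_weak_gradient \<Omega> u G"
  shows "AE x in vol \<Omega>. weak_grad \<Omega> u x = G x" "weak_grad \<Omega> u \<in> borel_measurable (vol \<Omega>)"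
  using weak_gradient_unique[OF assms(1) weak_grad_works[OF assms(2)] assms(2)]
    weak_gradient_measurable[OF assms(1) weak_grad_works[OF assms(2)]] by auto

lemma W1_weak_grad:
  assumes "open \<Omega>" "u \<in> W1 p \<Omega>"
  shows "u \<in> Lp p \<Omega>" "weak_grad \<Omega> u \<in> Lp p \<Omega>" "has_weak_gradient \<Omega> u (weak_grad \<Omega> u)"
proof -
  obtain G where G: "G \<in> Lp p \<Omega>" "has_weak_gradient \<Omega> u G" and u: "u \<in> Lp p \<Omega>"
    using assms(2) by (auto simp: W1_def)
  show "u \<in> Lp p \<Omega>" by fact
  show "has_weak_gradient \<Omega> u (weak_grad \<Omega> u)" by (rule weak_grad_works[OF G(2)])
  note w = weak_grad_unique[OF assms(1) G(2)]
  have "integrable (vol \<Omega>) (\<lambda>x. norm (weak_grad \<Omega> u x) powr p)"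
  proof (rule integrable_cong_AE_imp)
    show "integrable (vol \<Omega>) (\<lambda>x. norm (G x) powr p)" using G(1) by (simp add: Lp_def)
    show "(\<lambda>x. norm (weak_grad \<Omega> u x) powr p) \<in> borel_measurable (vol \<Omega>)" using w(2) by measurable
    show "AE x in vol \<Omega>. norm (G x) powr p = norm (weak_grad \<Omega> u x) powr p"
      using w(1) by eventually_elim simp
  qed
  with w(2) show "weak_grad \<Omega> u \<in> Lp p \<Omega>" by (simp add: Lp_def)
qed

section \<open>Cubic integrability\<close>

lemma Lp_3_iff: "u \<in> Lp 3 S \<longleftrightarrow> u \<in> borel_measurable (vol S) \<and> integrable (vol S) (\<lambda>x. norm (u x) ^ 3)"
  by (simp add: Lp_def)

lemma Lp_norm_3_cubed: "Lp_norm 3 S u ^ 3 = (\<integral>x. norm (u x) ^ 3 \<partial>vol S)"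
proof -
  have "0 \<le> (\<integral>x. norm (u x) ^ 3 \<partial>vol S)" by simp
  then show ?thesis
    by (simp add: Lp_norm_def powr_powr flip: powr_numeral)
qed

lemma L2_on_of_Lp_3:
  assumes \<Omega>: "\<Omega> \<in> sets borel" "bounded \<Omega>" and u: "u \<in> Lp 3 \<Omega>"
  shows "L2_on (vol \<Omega>) u"
proof -
  interpret finite_measure "vol \<Omega>" by (rule finite_measure_vol[OF \<Omega>])
  have [measurable]: "u \<in> borel_measurable (vol \<Omega>)" using u by (simp add: Lp_3_iff)
  have le: "r\<^sup>2 \<le> 1 + r ^ 3" if "0 \<le> r" for r :: real
  proof (cases "r \<le> 1")
    case True
    then show ?thesis using that power_le_one[of r 2] by (simp add: add_increasing2)
  next
    case False
    then show ?thesis using power_increasing[of 2 3 r] by linarith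
  qed
  have "integrable (vol \<Omega>) (\<lambda>x. (norm (u x))\<^sup>2)"
  proof (rule Bochner_Integration.integrable_bound)
    show "integrable (vol \<Omega>) (\<lambda>x. 1 + norm (u x) ^ 3)" using u by (simp add: Lp_3_iff)
    show "AE x in vol \<Omega>. norm ((norm (u x))\<^sup>2) \<le> norm (1 + norm (u x) ^ 3)"
      by (intro AE_I2) (use le in simp)
  qed measurable
  then show ?thesis by (simp add: L2_on_def)
qed

text \<open>
  Young's inequality for the factors \<open>l\<^sup>2 x\<close>, \<open>y / l\<close> and \<open>z / l\<close>. A large \<open>l\<close> makes the last two
  terms small at the expense of the first.
\<close>

lemma triple_product_le:
  fixes x y z l :: real
  assumes "0 \<le> x" "0 \<le> y" "0 \<le> z" "0 < l"
  shows "x * y * z \<le> l ^ 6 * x ^ 3 + (y ^ 3 + z ^ 3) / l ^ 3"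
proof -
  have young: "a * b * c \<le> a ^ 3 + b ^ 3 + c ^ 3" if "0 \<le> a" "0 \<le> b" "0 \<le> c" for a b c :: real
  proof -
    define m where "m = max a (max b c)"
    have "a * b * c \<le> m * m * m"
      using that by (intro mult_mono) (auto simp: m_def intro: max.coboundedI2)
    also have "\<dots> \<le> a ^ 3 + b ^ 3 + c ^ 3"
      using that by (auto simp: m_def max_def power3_eq_cube)
    finally show ?thesis .
  qed
  have "x * y * z = (l\<^sup>2 * x) * (y / l) * (z / l)"
    using assms by (simp add: field_simps power2_eq_square)
  also have "\<dots> \<le> (l\<^sup>2 * x) ^ 3 + (y / l) ^ 3 + (z / l) ^ 3"
    using assms by (intro young) auto
  also have "\<dots> = l ^ 6 * x ^ 3 + (y ^ 3 + z ^ 3) / l ^ 3"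
    by (simp add: power_mult_distrib power_divide add_divide_distrib flip: power_mult)
  finally show ?thesis .
qed

lemma triple_product_integrable:
  fixes f g h :: "'x \<Rightarrow> real"
  assumes [measurable]: "f \<in> borel_measurable V" "g \<in> borel_measurable V" "h \<in> borel_measurable V"
    and nonneg: "\<And>x. 0 \<le> f x" "\<And>x. 0 \<le> g x" "\<And>x. 0 \<le> h x"
    and int: "integrable V (\<lambda>x. f x ^ 3)" "integrable V (\<lambda>x. g x ^ 3)" "integrable V (\<lambda>x. h x ^ 3)"
  shows "integrable V (\<lambda>x. f x * g x * h x)"
    and "0 < l \<Longrightarrow> (\<integral>x. f x * g x * h x \<partial>V)
      \<le> l ^ 6 * (\<integral>x. f x ^ 3 \<partial>V) + ((\<integral>x. g x ^ 3 \<partial>V) + (\<integral>x. h x ^ 3 \<partial>V)) / l ^ 3"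
proof -
  have dom: "integrable V (\<lambda>x. l ^ 6 * f x ^ 3 + (g x ^ 3 + h x ^ 3) / l ^ 3)" for l
    using int by simp
  show i: "integrable V (\<lambda>x. f x * g x * h x)"
  proof (rule Bochner_Integration.integrable_bound[OF dom[of 1]])
    show "AE x in V. norm (f x * g x * h x) \<le> norm (1 ^ 6 * f x ^ 3 + (g x ^ 3 + h x ^ 3) / 1 ^ 3)"
      using triple_product_le[OF nonneg, of 1] nonneg
      by (intro AE_I2) (auto simp: abs_mult intro: order_trans[OF _ abs_ge_self])
  qed measurable
  assume l: "0 < l"
  have "(\<integral>x. f x * g x * h x \<partial>V) \<le> (\<integral>x. l ^ 6 * f x ^ 3 + (g x ^ 3 + h x ^ 3) / l ^ 3 \<partial>V)"
    by (rule integral_mono[OF i dom triple_product_le[OF nonneg l]])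
  then show "(\<integral>x. f x * g x * h x \<partial>V)
      \<le> l ^ 6 * (\<integral>x. f x ^ 3 \<partial>V) + ((\<integral>x. g x ^ 3 \<partial>V) + (\<integral>x. h x ^ 3 \<partial>V)) / l ^ 3"
    using int by simp
qed

text \<open>
  First \<open>l\<close> is fixed such that the bounded factors contribute less than \<open>e / 2\<close>, then \<open>n\<close> is taken
  large.
\<close>

lemma triple_product_tendsto_0:
  fixes f g h :: "nat \<Rightarrow> 'x \<Rightarrow> real"
  assumes m: "\<And>n. f n \<in> borel_measurable V" "\<And>n. g n \<in> borel_measurable V" "\<And>n. h n \<in> borel_measurable V"
    and nonneg: "\<And>n x. 0 \<le> f n x" "\<And>n x. 0 \<le> g n x" "\<And>n x. 0 \<le> h n x"
    and int: "\<And>n. integrable V (\<lambda>x. f n x ^ 3)" "\<And>n. integrable V (\<lambda>x. g n x ^ 3)" "\<And>n. integrable V (\<lambda>x. h n x ^ 3)"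
    and lim: "(\<lambda>n. \<integral>x. f n x ^ 3 \<partial>V) \<longlonglongrightarrow> 0"
    and bd: "\<And>n. (\<integral>x. g n x ^ 3 \<partial>V) \<le> B" "\<And>n. (\<integral>x. h n x ^ 3 \<partial>V) \<le> B"
  shows "(\<lambda>n. \<integral>x. f n x * g n x * h n x \<partial>V) \<longlonglongrightarrow> 0"
proof (rule LIMSEQ_I)
  fix e :: real assume "e > 0"
  have "((\<lambda>l. 2 * B / l ^ 3) \<longlongrightarrow> 0) at_top"
    by (intro tendsto_divide_0[OF tendsto_const] filterlim_at_top_imp_at_infinity filterlim_pow_at_top filterlim_ident) simp
  then have "\<forall>\<^sub>F l in at_top. 2 * B / l ^ 3 < e / 2"
    using \<open>e > 0\<close> by (intro order_tendstoD(2)) auto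
  then obtain l :: real where l: "2 * B / l ^ 3 < e / 2" "l > 0"
    using eventually_happens[OF eventually_conj[OF _ eventually_gt_at_top[of 0]]] by fastforce
  have "(\<lambda>n. l ^ 6 * (\<integral>x. f n x ^ 3 \<partial>V)) \<longlonglongrightarrow> 0"
    using lim by (rule tendsto_mult_right_zero)
  then have "\<forall>\<^sub>F n in sequentially. l ^ 6 * (\<integral>x. f n x ^ 3 \<partial>V) < e / 2"
    using \<open>e > 0\<close> by (intro order_tendstoD(2)) auto
  then have "\<forall>\<^sub>F n in sequentially. norm ((\<integral>x. f n x * g n x * h n x \<partial>V) - 0) < e"
  proof eventually_elim
    case (elim n)
    have "((\<integral>x. g n x ^ 3 \<partial>V) + (\<integral>x. h n x ^ 3 \<partial>V)) / l ^ 3 \<le> 2 * B / l ^ 3"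
      using bd[of n] l(2) by (intro divide_right_mono) auto
    moreover have "0 \<le> (\<integral>x. f n x * g n x * h n x \<partial>V)"
      using nonneg by (intro Bochner_Integration.integral_nonneg) auto
    ultimately show ?case
      using triple_product_integrable(2)[OF m[of n] nonneg int l(2)] elim l(1) by simp
  qed
  then show "\<exists>no. \<forall>n\<ge>no. norm ((\<integral>x. f n x * g n x * h n x \<partial>V) - 0) < e"
    by (simp add: eventually_sequentially)
qed

lemma norm_matrix_vector_mult_le:
  fixes A :: "real ^ 'n ^ 'm" and x :: "real ^ 'n"
  shows "norm (A *v x) \<le> norm A * norm x"
proof -
  have "(norm (A *v x))\<^sup>2 = (\<Sum>i\<in>UNIV. (A $ i \<bullet> x)\<^sup>2)"
    by (simp add: norm_vec_def L2_set_def sum_nonneg matrix_vector_mul_component)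
  also have "\<dots> \<le> (\<Sum>i\<in>UNIV. (norm (A $ i))\<^sup>2 * (norm x)\<^sup>2)"
    by (intro sum_mono) (metis Cauchy_Schwarz_ineq2 abs_ge_zero power2_abs power_mono power_mult_distrib)
  also have "\<dots> = (norm A * norm x)\<^sup>2"
    by (simp add: norm_vec_def[of A] L2_set_def sum_nonneg power_mult_distrib flip: sum_distrib_right)
  finally show ?thesis by (simp add: power_mono_iff)
qed

section \<open>The convective term\<close>

text \<open>
  By translation invariance every difference quotient has integral zero. The quotients are bounded
  by the mean value theorem and vanish off a fixed ball, so their limit has integral zero too.
\<close>

lemma integral_partial_derivative_eq_0:
  fixes \<phi> :: "'a::euclidean_space \<Rightarrow> real"
  assumes \<phi>: "\<phi> \<in> test_functions \<Omega>" and b: "b \<in> Basis" and \<Omega>: "\<Omega> \<in> sets borel"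
  shows "(\<integral>x. frechet_derivative \<phi> (at x) b \<partial>vol \<Omega>) = 0"
proof -
  note d = test_functions_partial[OF \<phi> b]
  note [measurable] = test_functions_borel[OF \<phi>] test_functions_borel[OF d]
  obtain K where K: "compact K" "K \<subseteq> \<Omega>" "\<And>x. x \<notin> K \<Longrightarrow> \<phi> x = 0"
    using \<phi> by (rule test_functionsE) blast
  obtain L where L: "compact L" "L \<subseteq> \<Omega>" "\<And>x. x \<notin> L \<Longrightarrow> frechet_derivative \<phi> (at x) b = 0"
    using d by (rule test_functionsE) blast
  obtain B where B: "\<And>x. \<bar>frechet_derivative \<phi> (at x) b\<bar> \<le> B" using test_functions_bounded[OF d] by blast
  have "0 \<le> B" using B abs_ge_zero order_trans by blast
  obtain B0 where B0: "\<And>x. \<bar>\<phi> x\<bar> \<le> B0" using test_functions_bounded[OF \<phi>] by blast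
  obtain R where R: "\<And>x. x \<in> K \<Longrightarrow> norm x \<le> R"
    using compact_imp_bounded[OF K(1)] by (auto simp: bounded_iff)
  define q where "q n x = real (Suc n) * (\<phi> (x + inverse (real (Suc n)) *\<^sub>R b) - \<phi> x)" for n x
  have int: "integrable lborel \<phi>"
  proof (rule Bochner_Integration.integrable_bound)
    show "integrable lborel (\<lambda>x. B0 * indicator K x :: real)"
      using emeasure_compact_finite[OF K(1)] K(1) by (simp add: compact_imp_closed)
    show "AE x in lborel. norm (\<phi> x) \<le> norm (B0 * indicator K x :: real)"
      using B0 K(3) by (intro AE_I2) (auto split: split_indicator intro: order_trans[OF _ abs_ge_self])
  qed measurable
  have trans: "integrable lborel (\<lambda>x. \<phi> (x + v))" "(\<integral>x. \<phi> (x + v) \<partial>lborel) = (\<integral>x. \<phi> x \<partial>lborel)" for v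
  proof -
    have "integrable (distr lborel borel ((+) v)) \<phi>"
      using int by (simp add: lborel_distr_plus)
    then show "integrable lborel (\<lambda>x. \<phi> (x + v))"
      by (subst (asm) integrable_distr_eq) (auto simp: add.commute)
    have "(\<integral>x. \<phi> x \<partial>lborel) = (\<integral>x. \<phi> x \<partial>distr lborel borel ((+) v))"
      by (simp add: lborel_distr_plus)
    also have "\<dots> = (\<integral>x. \<phi> (x + v) \<partial>lborel)"
      by (subst integral_distr) (auto simp: add.commute)
    finally show "(\<integral>x. \<phi> (x + v) \<partial>lborel) = (\<integral>x. \<phi> x \<partial>lborel)" by simp
  qed
  have "(\<lambda>n. \<integral>x. q n x \<partial>lborel) \<longlonglongrightarrow> (\<integral>x. frechet_derivative \<phi> (at x) b \<partial>lborel)"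
  proof (rule integral_dominated_convergence[where w = "\<lambda>x. B * indicator (cball 0 (R + 1)) x"])
    show "(\<lambda>x. frechet_derivative \<phi> (at x) b) \<in> borel_measurable lborel" by measurable
    show "q n \<in> borel_measurable lborel" for n unfolding q_def by measurable
    show "integrable lborel (\<lambda>x. B * indicator (cball 0 (R + 1) :: 'a set) x)"
      using emeasure_compact_finite[of "cball 0 (R + 1) :: 'a set"]
      by (intro integrable_mult_right integrable_real_indicator) auto
    have line: "((\<lambda>t. \<phi> (x + t *\<^sub>R b)) has_real_derivative frechet_derivative \<phi> (at (x + t *\<^sub>R b)) b) (at t)" for x t
    proof -
      have "((\<lambda>t. x + t *\<^sub>R b) has_derivative (\<lambda>h. h *\<^sub>R b)) (at t)"
        by (auto intro!: derivative_eq_intros)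
      from has_derivative_compose[OF this test_functions_has_derivative[OF \<phi>]]
      have "((\<lambda>t. \<phi> (x + t *\<^sub>R b)) has_derivative (\<lambda>h. frechet_derivative \<phi> (at (x + t *\<^sub>R b)) (h *\<^sub>R b))) (at t)" .
      moreover have "(\<lambda>h. frechet_derivative \<phi> (at (x + t *\<^sub>R b)) (h *\<^sub>R b)) = (\<lambda>h. frechet_derivative \<phi> (at (x + t *\<^sub>R b)) b * h)"
        using linear_cmul[OF has_derivative_linear[OF test_functions_has_derivative[OF \<phi>]], of "x + t *\<^sub>R b"]
        by (auto simp: fun_eq_iff)
      ultimately show ?thesis by (simp add: has_field_derivative_def)
    qed
    show "AE x in lborel. (\<lambda>n. q n x) \<longlonglongrightarrow> frechet_derivative \<phi> (at x) b"
    proof (rule AE_I2)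
      fix x
      have "((\<lambda>h. (\<phi> (x + (0 + h) *\<^sub>R b) - \<phi> (x + 0 *\<^sub>R b)) / h) \<longlongrightarrow> frechet_derivative \<phi> (at x) b) (at 0)"
        using line[of x 0] unfolding DERIV_def by simp
      moreover have "filterlim (\<lambda>n. inverse (real (Suc n))) (at 0) sequentially"
        using LIMSEQ_inverse_real_of_nat by (auto simp: filterlim_at simp del: of_nat_Suc)
      ultimately have "(\<lambda>n. (\<phi> (x + (0 + inverse (real (Suc n))) *\<^sub>R b) - \<phi> (x + 0 *\<^sub>R b)) / inverse (real (Suc n)))
          \<longlonglongrightarrow> frechet_derivative \<phi> (at x) b"
        by (rule filterlim_compose)
      then show "(\<lambda>n. q n x) \<longlonglongrightarrow> frechet_derivative \<phi> (at x) b"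
        by (simp add: q_def divide_inverse mult.commute del: of_nat_Suc)
    qed
    show "AE x in lborel. norm (q n x) \<le> B * indicator (cball 0 (R + 1)) x" for n
    proof (rule AE_I2)
      fix x
      define h where "h = inverse (real (Suc n))"
      have h: "0 < h" "h \<le> 1" by (auto simp: h_def field_simps)
      obtain z where z: "\<phi> (x + h *\<^sub>R b) - \<phi> (x + 0 *\<^sub>R b) = (h - 0) * frechet_derivative \<phi> (at (x + z *\<^sub>R b)) b"
        using MVT2[of 0 h "\<lambda>t. \<phi> (x + t *\<^sub>R b)" "\<lambda>t. frechet_derivative \<phi> (at (x + t *\<^sub>R b)) b", OF h(1) line] by blast
      then have "q n x = frechet_derivative \<phi> (at (x + z *\<^sub>R b)) b"
        by (simp add: q_def h_def[symmetric]) (simp add: h_def)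
      then have 1: "\<bar>q n x\<bar> \<le> B" using B by simp
      have "q n x = 0" if "x \<notin> cball 0 (R + 1)"
      proof -
        have "norm (h *\<^sub>R b) \<le> 1" using h b by simp
        moreover have nx: "norm x > R + 1" using that by simp
        ultimately have "norm (x + h *\<^sub>R b) > R"
          using norm_diff_ineq[of x "h *\<^sub>R b"] by linarith
        then have "\<phi> (x + h *\<^sub>R b) = 0" using K(3) R by (meson not_le)
        moreover have "\<phi> x = 0" using K(3) R[of x] nx by fastforce
        ultimately show ?thesis by (simp add: q_def h_def)
      qed
      with 1 show "norm (q n x) \<le> B * indicator (cball 0 (R + 1)) x"
        by (auto split: split_indicator)
    qed
  qed
  moreover have "(\<integral>x. q n x \<partial>lborel) = 0" for n
    unfolding q_def using trans int by simp
  ultimately have "(\<integral>x. frechet_derivative \<phi> (at x) b \<partial>lborel) = 0"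
    by (simp add: LIMSEQ_const_iff)
  moreover have "indicator \<Omega> x *\<^sub>R frechet_derivative \<phi> (at x) b = frechet_derivative \<phi> (at x) b" for x
    using L(2,3) by (auto split: split_indicator)
  moreover have "(\<integral>x. frechet_derivative \<phi> (at x) b \<partial>vol \<Omega>)
      = (\<integral>x. indicator \<Omega> x *\<^sub>R frechet_derivative \<phi> (at x) b \<partial>lborel)"
    using \<Omega> by (intro integral_restrict_space) simp
  ultimately show ?thesis by (simp only:)
qed

lemma test_components_bounded:
  fixes F :: "'a::euclidean_space \<Rightarrow> 'b::euclidean_space"
  assumes "\<And>b. b \<in> Basis \<Longrightarrow> (\<lambda>x. F x \<bullet> b) \<in> test_functions \<Omega>"
  shows "F \<in> borel_measurable borel" "\<exists>B. \<forall>x. norm (F x) \<le> B"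
proof -
  show "F \<in> borel_measurable borel"
    using test_functions_borel[OF assms] by (subst borel_measurable_euclidean_space) auto
  have "\<forall>b\<in>Basis. \<exists>B. \<forall>x. \<bar>F x \<bullet> b\<bar> \<le> B"
    using test_functions_bounded[OF assms] by metis
  then obtain B where B: "\<And>b x. b \<in> Basis \<Longrightarrow> \<bar>F x \<bullet> b\<bar> \<le> B b" by metis
  have "norm (F x) \<le> sum B Basis" for x
    using norm_le_l1[of "F x"] sum_mono[of Basis "\<lambda>b. \<bar>F x \<bullet> b\<bar>" B] B by fastforce
  then show "\<exists>B. \<forall>x. norm (F x) \<le> B" by blast
qed

lemma Lp_3_bounded:
  assumes \<Omega>: "\<Omega> \<in> sets borel" "bounded \<Omega>" and F: "F \<in> borel_measurable borel" "\<exists>B. \<forall>x. norm (F x) \<le> B"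
  shows "F \<in> Lp 3 \<Omega>"
proof -
  interpret finite_measure "vol \<Omega>" by (rule finite_measure_vol[OF \<Omega>])
  obtain B where B: "\<And>x. norm (F x) \<le> B" using F(2) by blast
  have [measurable]: "F \<in> borel_measurable (vol \<Omega>)" using F(1) by (rule measurable_vol)
  have "integrable (vol \<Omega>) (\<lambda>x. norm (F x) ^ 3)"
    by (rule integrable_const_bound[where B = "B ^ 3"]) (auto intro!: power_mono B)
  then show ?thesis by (simp add: Lp_3_iff)
qed

lemma norm_diff_cubed_le: "norm (a - b) ^ 3 \<le> 8 * (norm a ^ 3 + norm b ^ 3)"
proof -
  define m where "m = max (norm a) (norm b)"
  have "norm (a - b) \<le> norm a + norm b" by (rule norm_triangle_ineq4)
  then have "norm (a - b) \<le> 2 * m" by (simp add: m_def)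
  then have "norm (a - b) ^ 3 \<le> (2 * m) ^ 3" by (intro power_mono) auto
  also have "\<dots> \<le> 8 * (norm a ^ 3 + norm b ^ 3)"
    by (auto simp: m_def max_def power_mult_distrib)
  finally show ?thesis .
qed

lemma Lp_3_diff:
  assumes "u \<in> Lp 3 \<Omega>" "v \<in> Lp 3 \<Omega>"
  shows "(\<lambda>x. u x - v x) \<in> Lp 3 \<Omega>"
    and "(\<integral>x. norm (u x - v x) ^ 3 \<partial>vol \<Omega>) \<le> 8 * ((\<integral>x. norm (u x) ^ 3 \<partial>vol \<Omega>) + (\<integral>x. norm (v x) ^ 3 \<partial>vol \<Omega>))"
proof -
  have [measurable]: "u \<in> borel_measurable (vol \<Omega>)" "v \<in> borel_measurable (vol \<Omega>)"
    using assms by (simp_all add: Lp_3_iff)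
  have dom: "integrable (vol \<Omega>) (\<lambda>x. 8 * (norm (u x) ^ 3 + norm (v x) ^ 3))"
    using assms by (simp add: Lp_3_iff)
  have i: "integrable (vol \<Omega>) (\<lambda>x. norm (u x - v x) ^ 3)"
    by (rule Bochner_Integration.integrable_bound[OF dom])
       (auto intro!: AE_I2 order_trans[OF norm_diff_cubed_le])
  then show "(\<lambda>x. u x - v x) \<in> Lp 3 \<Omega>" by (simp add: Lp_3_iff)
  have "(\<integral>x. norm (u x - v x) ^ 3 \<partial>vol \<Omega>) \<le> (\<integral>x. 8 * (norm (u x) ^ 3 + norm (v x) ^ 3) \<partial>vol \<Omega>)"
    by (rule integral_mono[OF i dom norm_diff_cubed_le])
  then show "(\<integral>x. norm (u x - v x) ^ 3 \<partial>vol \<Omega>) \<le> 8 * ((\<integral>x. norm (u x) ^ 3 \<partial>vol \<Omega>) + (\<integral>x. norm (v x) ^ 3 \<partial>vol \<Omega>))"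
    using assms by (simp add: Lp_3_iff)
qed

lemma abs_trace_le: "\<bar>trace (M :: real ^ 'd ^ 'd)\<bar> \<le> real CARD('d) * norm M"
proof -
  have "\<bar>M $ i $ i\<bar> \<le> norm M" for i
    using component_le_norm_cart[of "M $ i" i] Finite_Cartesian_Product.norm_nth_le[of M i] by linarith
  then have "(\<Sum>i\<in>UNIV. \<bar>M $ i $ i\<bar>) \<le> (\<Sum>i\<in>(UNIV :: 'd set). norm M)"
    by (intro sum_mono)
  then show ?thesis
    unfolding trace_def by (intro order_trans[OF sum_abs]) simp
qed

lemma matrix_frechet_derivative_nth:
  fixes \<phi> :: "real ^ 'd \<Rightarrow> real ^ 'd"
  assumes "\<And>i. (\<lambda>x. \<phi> x $ i) \<in> test_functions \<Omega>"
  shows "matrix (frechet_derivative \<phi> (at x)) $ i $ j = frechet_derivative (\<lambda>x. \<phi> x $ i) (at x) (axis j 1)"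
proof -
  let ?D = "\<lambda>h. \<chi> i. frechet_derivative (\<lambda>x. \<phi> x $ i) (at x) h"
  have "(\<phi> has_derivative ?D) (at x)"
    by (subst has_derivative_componentwise_within)
       (auto simp: Basis_vec_def inner_axis intro!: test_functions_has_derivative assms)
  then have "frechet_derivative \<phi> (at x) = ?D" by (metis frechet_derivative_at)
  then show ?thesis by (simp add: matrix_def)
qed

text \<open>
  The integrand equals \<open>u \<bullet> \<nabla>(|\<phi>|\<^sup>2 / 2)\<close>. Since \<open>|\<phi>|\<^sup>2\<close> is again a test function, the definition of
  the weak gradient of \<open>u\<close> moves the derivative onto \<open>u\<close> and produces \<open>- (div u) |\<phi>|\<^sup>2 / 2\<close>.
\<close>

lemma trilinear_orthogonality:
  fixes \<phi> u :: "real ^ 'd \<Rightarrow> real ^ 'd"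
  assumes \<Omega>: "\<Omega> \<in> sets borel" "bounded \<Omega>"
    and \<phi>: "\<And>i. (\<lambda>x. \<phi> x $ i) \<in> test_functions \<Omega>"
    and u: "L2_on (vol \<Omega>) u" "L2_on (vol \<Omega>) A" "has_weak_gradient \<Omega> u A"
    and div: "AE x in vol \<Omega>. trace (A x) = 0"
  shows "(\<integral>x. (matrix (frechet_derivative \<phi> (at x)) *v u x) \<bullet> \<phi> x \<partial>vol \<Omega>) = 0"
proof -
  define \<psi> where "\<psi> x = (\<Sum>i\<in>UNIV. \<phi> x $ i * \<phi> x $ i)" for x
  have C: "C_k k (\<lambda>x. \<phi> x $ i)" for k i using \<phi>[of i] by (simp add: test_functions_def)
  have \<psi>: "\<psi> \<in> test_functions \<Omega>"
  proof -
    have "(\<lambda>x. \<phi> x $ i * \<phi> x $ i) \<in> test_functions \<Omega>" for i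
      by (rule test_functions_mult[OF \<phi> C])
    from test_functions_sum[OF finite_class.finite_UNIV this] show ?thesis
      unfolding \<psi>_def[abs_def] .
  qed
  have d\<psi>: "frechet_derivative \<psi> (at x) h = 2 * (\<Sum>i\<in>UNIV. \<phi> x $ i * frechet_derivative (\<lambda>x. \<phi> x $ i) (at x) h)" for x h
  proof -
    have "(\<psi> has_derivative (\<lambda>h. \<Sum>i\<in>UNIV. \<phi> x $ i * frechet_derivative (\<lambda>x. \<phi> x $ i) (at x) h
        + frechet_derivative (\<lambda>x. \<phi> x $ i) (at x) h * \<phi> x $ i)) (at x)"
      unfolding \<psi>_def[abs_def]
      by (intro has_derivative_sum has_derivative_mult test_functions_has_derivative[OF \<phi>])
    from frechet_derivative_at[OF this]
    have "frechet_derivative \<psi> (at x) = (\<lambda>h. \<Sum>i\<in>UNIV. \<phi> x $ i * frechet_derivative (\<lambda>x. \<phi> x $ i) (at x) h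
        + frechet_derivative (\<lambda>x. \<phi> x $ i) (at x) h * \<phi> x $ i)"
      by (rule sym)
    then show ?thesis by (simp add: sum_distrib_left algebra_simps)
  qed
  have pw: "(matrix (frechet_derivative \<phi> (at x)) *v u x) \<bullet> \<phi> x
      = (\<Sum>j\<in>UNIV. u x \<bullet> axis j (frechet_derivative \<psi> (at x) (axis j 1))) / 2" for x
  proof -
    have "(matrix (frechet_derivative \<phi> (at x)) *v u x) \<bullet> \<phi> x
        = (\<Sum>i\<in>UNIV. \<Sum>j\<in>UNIV. frechet_derivative (\<lambda>x. \<phi> x $ i) (at x) (axis j 1) * u x $ j * \<phi> x $ i)"
      by (simp add: inner_vec_def matrix_vector_mult_def sum_distrib_right matrix_frechet_derivative_nth[OF \<phi>])
    also have "\<dots> = (\<Sum>j\<in>UNIV. \<Sum>i\<in>UNIV. frechet_derivative (\<lambda>x. \<phi> x $ i) (at x) (axis j 1) * u x $ j * \<phi> x $ i)"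
      by (rule sum.swap)
    also have "\<dots> = (\<Sum>j\<in>UNIV. u x \<bullet> axis j (frechet_derivative \<psi> (at x) (axis j 1))) / 2"
      unfolding sum_divide_distrib
      by (intro sum.cong) (auto simp: inner_axis d\<psi> sum_distrib_left mult_ac)
    finally show ?thesis .
  qed
  note tf = gradient_test_fields[OF \<Omega> \<psi>]
  have "(\<integral>x. (\<Sum>j\<in>UNIV. u x \<bullet> axis j (frechet_derivative \<psi> (at x) (axis j 1))) \<partial>vol \<Omega>)
      = (\<Sum>j\<in>UNIV. \<integral>x. u x \<bullet> axis j (frechet_derivative \<psi> (at x) (axis j 1)) \<partial>vol \<Omega>)"
    by (intro Bochner_Integration.integral_sum L2_on_inner(1) u tf)
  also have "\<dots> = (\<Sum>j\<in>UNIV. - (\<integral>x. A x \<bullet> axis j (axis j (\<psi> x)) \<partial>vol \<Omega>))"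
    using u(3) \<psi> unfolding has_weak_gradient_iff_pairing[OF \<Omega> u(1,2)] by simp
  also have "\<dots> = - (\<integral>x. (\<Sum>j\<in>UNIV. A x \<bullet> axis j (axis j (\<psi> x))) \<partial>vol \<Omega>)"
    unfolding sum_negf
    by (intro arg_cong[where f = uminus] Bochner_Integration.integral_sum[symmetric] L2_on_inner(1) u tf)
  also have "(\<integral>x. (\<Sum>j\<in>UNIV. A x \<bullet> axis j (axis j (\<psi> x))) \<partial>vol \<Omega>) = 0"
  proof (rule integral_eq_zero_AE)
    show "AE x in vol \<Omega>. (\<Sum>j\<in>UNIV. A x \<bullet> axis j (axis j (\<psi> x))) = 0"
      using div
    proof eventually_elim
      case (elim x)
      have "(\<Sum>j\<in>UNIV. A x \<bullet> axis j (axis j (\<psi> x))) = trace (A x) * \<psi> x"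
        by (simp add: inner_axis trace_def sum_distrib_right)
      with elim show ?case by simp
    qed
  qed
  finally show ?thesis by (simp add: pw)
qed

text \<open>
  Let \<open>\<phi>\<^sub>n\<close> be test fields that tend to \<open>u\<close> in \<open>W\<^sup>1\<^sup>,\<^sup>3\<close>. Their divergence has mean zero, hence so has
  \<open>div u\<close>; thus \<open>div u\<close> is itself an admissible \<open>q\<close>, and the hypothesis shows \<open>div u = 0\<close>. Now
  \<open>trilinear_orthogonality\<close> applies to every \<open>\<phi>\<^sub>n\<close>, and the integrand is a product of three factors
  that converge or are fixed in \<open>L\<^sup>3\<close>, which allows passing to the limit.
\<close>

lemma convection_vanishes:
  fixes u :: "real ^ 'd \<Rightarrow> real ^ 'd"
  assumes op: "open \<Omega>" and bd: "bounded \<Omega>" and u: "u \<in> Xspace \<Omega>"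
    and div: "\<And>q. q \<in> Qspace \<Omega> \<Longrightarrow> L2_inner \<Omega> q (weak_div \<Omega> u) = 0"
  shows "L2_inner \<Omega> (\<lambda>x. weak_grad \<Omega> u x *v u x) u = 0"
proof -
  let ?V = "vol \<Omega>"
  have \<Omega>: "\<Omega> \<in> sets borel" "bounded \<Omega>" using op bd by auto
  interpret V: finite_measure ?V by (rule finite_measure_vol[OF \<Omega>])
  define A where "A = weak_grad \<Omega> u"
  have uW: "u \<in> W1 3 \<Omega>" and uz: "zero_on_boundary 3 \<Omega> u" using u by (auto simp: Xspace_def)
  note W = W1_weak_grad[OF op uW, folded A_def]
  note L2 = L2_on_of_Lp_3[OF \<Omega> W(1)] L2_on_of_Lp_3[OF \<Omega> W(2)]
  note [measurable] = L2_onD[OF L2(1)] L2_onD[OF L2(2)]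
  obtain \<phi> where \<phi>: "\<And>n i. (\<lambda>x. \<phi> n x $ i) \<in> test_functions \<Omega>"
    and lim1: "(\<lambda>n. Lp_norm 3 \<Omega> (\<lambda>x. \<phi> n x - u x)) \<longlonglongrightarrow> 0"
    and lim2: "(\<lambda>n. Lp_norm 3 \<Omega> (\<lambda>x. matrix (frechet_derivative (\<phi> n) (at x)) - A x)) \<longlonglongrightarrow> 0"
    using uz by (auto simp: zero_on_boundary_def A_def)
  define G where "G n x = matrix (frechet_derivative (\<phi> n) (at x))" for n x
  have G_nth: "G n x $ i $ j = frechet_derivative (\<lambda>x. \<phi> n x $ i) (at x) (axis j 1)" for n x i j
    unfolding G_def by (rule matrix_frechet_derivative_nth[OF \<phi>])
  have axisB: "(axis j 1 :: real ^ 'd) \<in> Basis" for j by (simp add: axis_in_Basis_iff)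
  have phi3: "\<phi> n \<in> Lp 3 \<Omega>" for n
    by (rule Lp_3_bounded[OF \<Omega>]; rule test_components_bounded[where \<Omega> = \<Omega>])
       (auto simp: Basis_vec_def inner_axis intro: \<phi>)
  have G3: "G n \<in> Lp 3 \<Omega>" for n
    by (rule Lp_3_bounded[OF \<Omega>]; rule test_components_bounded[where \<Omega> = \<Omega>])
       (auto simp: Basis_vec_def inner_axis G_nth intro!: test_functions_partial \<phi> axisB)
  have [measurable]: "\<phi> n \<in> borel_measurable ?V" "G n \<in> borel_measurable ?V" for n
    using phi3[of n] G3[of n] by (simp_all add: Lp_3_iff)
  have cube_lim1: "(\<lambda>n. \<integral>x. norm (\<phi> n x - u x) ^ 3 \<partial>?V) \<longlonglongrightarrow> 0"
    using tendsto_power[OF lim1, of 3] by (simp add: Lp_norm_3_cubed)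
  have cube_lim2: "(\<lambda>n. \<integral>x. norm (G n x - A x) ^ 3 \<partial>?V) \<longlonglongrightarrow> 0"
    using tendsto_power[OF lim2, of 3] by (simp add: Lp_norm_3_cubed G_def)
  note d1 = Lp_3_diff(1)[OF phi3 W(1), unfolded Lp_3_iff, THEN conjunct2]
  note d2 = Lp_3_diff(1)[OF G3 W(2), unfolded Lp_3_iff, THEN conjunct2]
  have i3: "integrable ?V (\<lambda>x. norm (u x) ^ 3)" "integrable ?V (\<lambda>x. norm (A x) ^ 3)"
      "integrable ?V (\<lambda>x. norm (\<phi> n x) ^ 3)" for n
    using W(1,2) phi3[of n] by (simp_all add: Lp_3_iff)
  obtain B1 where B1: "\<And>n. (\<integral>x. norm (\<phi> n x - u x) ^ 3 \<partial>?V) \<le> B1"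
    using convergent_imp_Bseq[OF convergentI[OF cube_lim1]] by (auto simp: Bseq_def)
  have tr_meas [measurable]: "(\<lambda>x. trace (A x)) \<in> borel_measurable ?V"
    by (rule borel_measurable_continuous_on[of trace])
       (auto simp: trace_def intro!: continuous_intros L2_onD[OF L2(2)])
  have trL2: "L2_on ?V (\<lambda>x. trace (A x))"
  proof (rule L2_on_bound[OF _ tr_meas])
    show "L2_on ?V (\<lambda>x. real CARD('d) *\<^sub>R A x)"
      using L2(2) by (simp add: L2_on_def power_mult_distrib)
  qed (use abs_trace_le in auto)
  \<comment> \<open>The mean of the divergence is a limit of zeros.\<close>
  have tr_int0: "(\<integral>x. trace (A x) \<partial>?V) = 0"
  proof -
    have lim: "(\<lambda>n. real CARD('d) * (\<integral>x. norm (G n x - A x) * 1 * 1 \<partial>?V)) \<longlonglongrightarrow> real CARD('d) * 0"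
      by (intro tendsto_mult_left triple_product_tendsto_0[where B = "measure ?V (space ?V)"] d2 cube_lim2)
         (auto simp: G3 Lp_3_iff)
    have bnd: "\<bar>\<integral>x. trace (A x) \<partial>?V\<bar> \<le> real CARD('d) * (\<integral>x. norm (G n x - A x) * 1 * 1 \<partial>?V)" for n
    proof -
      have Gi: "integrable ?V (\<lambda>x. G n x $ i $ i)" for i
      proof -
        have "L2_on ?V (\<lambda>x. frechet_derivative (\<lambda>x. \<phi> n x $ i) (at x) (axis i 1) *\<^sub>R (1::real))"
          by (rule L2_on_test_function_scaleR[OF \<Omega> test_functions_partial[OF \<phi> axisB]])
        then show ?thesis
          using L2_on_imp_integrable[OF V.finite_measure_axioms] by (simp add: G_nth)
      qed
      then have trG: "integrable ?V (\<lambda>x. trace (G n x))" by (simp add: trace_def)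
      have "(\<integral>x. trace (G n x) \<partial>?V) = (\<Sum>i\<in>UNIV. \<integral>x. G n x $ i $ i \<partial>?V)"
        unfolding trace_def using Gi by (intro Bochner_Integration.integral_sum) auto
      also have "\<dots> = 0"
        unfolding G_nth using integral_partial_derivative_eq_0[OF \<phi> axisB \<Omega>(1)] by simp
      finally have "(\<integral>x. trace (A x) \<partial>?V) = - (\<integral>x. trace (G n x) - trace (A x) \<partial>?V)"
        using trG L2_on_imp_integrable[OF V.finite_measure_axioms trL2] by simp
      then have "\<bar>\<integral>x. trace (A x) \<partial>?V\<bar> \<le> (\<integral>x. \<bar>trace (G n x) - trace (A x)\<bar> \<partial>?V)"
        using integral_abs_bound[of ?V "\<lambda>x. trace (G n x) - trace (A x)"] by simp
      also have "\<dots> \<le> (\<integral>x. real CARD('d) * norm (G n x - A x) \<partial>?V)"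
      proof (rule integral_mono)
        show "integrable ?V (\<lambda>x. \<bar>trace (G n x) - trace (A x)\<bar>)"
          using trG L2_on_imp_integrable[OF V.finite_measure_axioms trL2] by simp
        show "integrable ?V (\<lambda>x. real CARD('d) * norm (G n x - A x))"
          using triple_product_integrable(1)[of "\<lambda>x. norm (G n x - A x)" ?V "\<lambda>_. 1" "\<lambda>_. 1"] d2[of n] by simp
        show "\<bar>trace (G n x) - trace (A x)\<bar> \<le> real CARD('d) * norm (G n x - A x)" for x
          using abs_trace_le[of "G n x - A x"] by (simp add: trace_sub)
      qed
      finally show ?thesis by simp
    qed
    have "\<bar>\<integral>x. trace (A x) \<partial>?V\<bar> \<le> real CARD('d) * 0"
      by (rule LIMSEQ_le_const[OF lim]) (use bnd in blast)
    then show ?thesis by simp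
  qed
  have div0: "AE x in ?V. trace (A x) = 0"
  proof -
    have "(\<lambda>x. trace (A x)) \<in> Qspace \<Omega>"
      using trL2 tr_int0 by (simp add: Qspace_def Lp_2_iff)
    from div[OF this] have "(\<integral>x. trace (A x) * trace (A x) \<partial>?V) = 0"
      by (simp add: L2_inner_def weak_div_def A_def)
    then have "AE x in ?V. trace (A x) * trace (A x) = 0"
      using L2_on_inner(1)[OF trL2 trL2] by (subst (asm) integral_nonneg_eq_0_iff_AE) auto
    then show ?thesis by eventually_elim simp
  qed
  have zero: "(\<integral>x. (G n x *v u x) \<bullet> \<phi> n x \<partial>?V) = 0" for n
    unfolding G_def by (rule trilinear_orthogonality[OF \<Omega> \<phi> L2 W(3) div0])
  \<comment> \<open>The error splits into \<open>((\<nabla>\<phi>\<^sub>n - \<nabla>u) u) \<bullet> \<phi>\<^sub>n\<close> and \<open>((\<nabla>u) u) \<bullet> (\<phi>\<^sub>n - u)\<close>; in both one factor tends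
    to zero in \<open>L\<^sup>3\<close> and the other two stay bounded.\<close>
  have bound: "\<bar>(M *v v) \<bullet> z\<bar> \<le> norm M * norm v * norm z" for M :: "real ^ 'd ^ 'd" and v z :: "real ^ 'd"
    by (rule order_trans[OF Cauchy_Schwarz_ineq2]) (intro mult_right_mono norm_matrix_vector_mult_le norm_ge_zero)
  have mv_meas: "(\<lambda>x. (M x *v v x) \<bullet> z x) \<in> borel_measurable ?V"
    if "M \<in> borel_measurable ?V" "v \<in> borel_measurable ?V" "z \<in> borel_measurable ?V"
    for M :: "real ^ 'd \<Rightarrow> real ^ 'd ^ 'd" and v z :: "real ^ 'd \<Rightarrow> real ^ 'd"
  proof -
    have [measurable]: "(\<lambda>x. M x $ i $ j) \<in> borel_measurable ?V" "(\<lambda>x. v x $ i) \<in> borel_measurable ?V"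
        "(\<lambda>x. z x $ i) \<in> borel_measurable ?V" for i j
      using that by (auto intro!: borel_measurable_continuous_on[of "\<lambda>y. y $ i $ j"]
        borel_measurable_continuous_on[of "\<lambda>y. y $ i"] continuous_intros)
    show ?thesis
      by (simp add: inner_vec_def matrix_vector_mult_def)
  qed
  have mv_int: "integrable ?V (\<lambda>x. (M x *v v x) \<bullet> z x)"
    if "M \<in> Lp 3 \<Omega>" "v \<in> Lp 3 \<Omega>" "z \<in> Lp 3 \<Omega>"
    for M :: "real ^ 'd \<Rightarrow> real ^ 'd ^ 'd" and v z :: "real ^ 'd \<Rightarrow> real ^ 'd"
    by (rule Bochner_Integration.integrable_bound[OF triple_product_integrable(1)[of "\<lambda>x. norm (M x)" _ "\<lambda>x. norm (v x)" "\<lambda>x. norm (z x)"]])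
       (use that bound in \<open>auto simp: Lp_3_iff intro!: mv_meas AE_I2\<close>)
  let ?e = "\<lambda>n. (\<integral>x. norm (G n x - A x) * norm (u x) * norm (\<phi> n x) \<partial>?V)
      + (\<integral>x. norm (\<phi> n x - u x) * norm (A x) * norm (u x) \<partial>?V)"
  have lim: "?e \<longlonglongrightarrow> 0 + 0"
  proof (rule tendsto_add)
    have "(\<integral>x. norm (\<phi> n x) ^ 3 \<partial>?V) \<le> 8 * (B1 + (\<integral>x. norm (u x) ^ 3 \<partial>?V))" for n
    proof -
      have "(\<lambda>x. - u x) \<in> Lp 3 \<Omega>" using W(1) by (simp add: Lp_3_iff)
      from Lp_3_diff(2)[OF Lp_3_diff(1)[OF phi3[of n] W(1)] this]
      show ?thesis using B1[of n] by simp
    qed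
    moreover have "0 \<le> B1"
      using B1[of 0] by (rule order_trans[rotated]) simp
    moreover have "0 \<le> (\<integral>x. norm (u x) ^ 3 \<partial>?V)" by simp
    ultimately show "(\<lambda>n. \<integral>x. norm (G n x - A x) * norm (u x) * norm (\<phi> n x) \<partial>?V) \<longlonglongrightarrow> 0"
      by (intro triple_product_tendsto_0[where B = "8 * (B1 + (\<integral>x. norm (u x) ^ 3 \<partial>?V))"] d2 i3 cube_lim2)
         auto
    show "(\<lambda>n. \<integral>x. norm (\<phi> n x - u x) * norm (A x) * norm (u x) \<partial>?V) \<longlonglongrightarrow> 0"
      by (intro triple_product_tendsto_0[where B = "max (\<integral>x. norm (A x) ^ 3 \<partial>?V) (\<integral>x. norm (u x) ^ 3 \<partial>?V)"] d1 i3 cube_lim1)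
         auto
  qed
  have bnd: "\<bar>\<integral>x. (A x *v u x) \<bullet> u x \<partial>?V\<bar> \<le> ?e n" for n
  proof -
    note t1 = triple_product_integrable(1)[of "\<lambda>x. norm (G n x - A x)" ?V "\<lambda>x. norm (u x)" "\<lambda>x. norm (\<phi> n x)", OF _ _ _ _ _ _ d2 i3(1) i3(3)]
    note t2 = triple_product_integrable(1)[of "\<lambda>x. norm (\<phi> n x - u x)" ?V "\<lambda>x. norm (A x)" "\<lambda>x. norm (u x)", OF _ _ _ _ _ _ d1 i3(2) i3(1)]
    have "(\<integral>x. (A x *v u x) \<bullet> u x \<partial>?V) = (\<integral>x. (A x *v u x) \<bullet> u x - (G n x *v u x) \<bullet> \<phi> n x \<partial>?V)"
      using mv_int[OF W(2) W(1) W(1)] mv_int[OF G3[of n] W(1) phi3[of n]] zero[of n] by simp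
    also have "\<bar>\<dots>\<bar> \<le> (\<integral>x. \<bar>(A x *v u x) \<bullet> u x - (G n x *v u x) \<bullet> \<phi> n x\<bar> \<partial>?V)"
      by (rule integral_abs_bound)
    also have "\<dots> \<le> (\<integral>x. norm (G n x - A x) * norm (u x) * norm (\<phi> n x) + norm (\<phi> n x - u x) * norm (A x) * norm (u x) \<partial>?V)"
    proof (rule integral_mono)
      show "integrable ?V (\<lambda>x. \<bar>(A x *v u x) \<bullet> u x - (G n x *v u x) \<bullet> \<phi> n x\<bar>)"
        using mv_int[OF W(2) W(1) W(1)] mv_int[OF G3[of n] W(1) phi3[of n]] by simp
      show "integrable ?V (\<lambda>x. norm (G n x - A x) * norm (u x) * norm (\<phi> n x) + norm (\<phi> n x - u x) * norm (A x) * norm (u x))"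
        using t1 t2 by simp
      fix x
      have "(A x *v u x) \<bullet> u x - (G n x *v u x) \<bullet> \<phi> n x
          = - (((G n x - A x) *v u x) \<bullet> \<phi> n x) - (A x *v u x) \<bullet> (\<phi> n x - u x)"
        by (simp add: matrix_vector_mult_diff_rdistrib inner_diff_left inner_diff_right)
      then show "\<bar>(A x *v u x) \<bullet> u x - (G n x *v u x) \<bullet> \<phi> n x\<bar>
          \<le> norm (G n x - A x) * norm (u x) * norm (\<phi> n x) + norm (\<phi> n x - u x) * norm (A x) * norm (u x)"
        using bound[of "G n x - A x" "u x" "\<phi> n x"] bound[of "A x" "u x" "\<phi> n x - u x"]
        by (simp add: mult_ac)
    qed
    also have "\<dots> = ?e n" using t1 t2 by simp
    finally show ?thesis .
  qed
  have "\<bar>\<integral>x. (A x *v u x) \<bullet> u x \<partial>?V\<bar> \<le> 0 + 0"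
    by (rule LIMSEQ_le_const[OF lim]) (use bnd in blast)
  then show ?thesis by (simp add: L2_inner_def A_def)
qed

section \<open>Gronwall's inequality\<close>

lemma continuous_on_primitive:
  assumes e: "integrable (vol {0<..<T::real}) e"
  shows "continuous_on S (\<lambda>t. \<integral>r. (if r < t then e r else 0 :: real) \<partial>vol {0<..<T})"
proof (rule continuous_on_sequentiallyI)
  let ?N = "vol {0<..<T}"
  fix t :: "nat \<Rightarrow> real" and a assume t: "t \<longlonglongrightarrow> a"
  have [measurable]: "(\<lambda>r. r) \<in> borel_measurable ?N" by (simp add: measurable_vol)
  note [measurable] = borel_measurable_integrable[OF e]
  show "(\<lambda>n. \<integral>r. (if r < t n then e r else 0) \<partial>?N) \<longlonglongrightarrow> (\<integral>r. (if r < a then e r else 0) \<partial>?N)"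
  proof (rule integral_dominated_convergence[where w = "\<lambda>r. \<bar>e r\<bar>"])
    have "AE r in ?N. r \<noteq> a"
      by (auto simp: AE_restrict_space_iff intro: AE_mp[OF AE_lborel_singleton[of a]])
    then show "AE r in ?N. (\<lambda>n. if r < t n then e r else 0) \<longlonglongrightarrow> (if r < a then e r else 0)"
    proof eventually_elim
      case (elim r)
      then consider "r < a" | "a < r" by linarith
      then show ?case
      proof cases
        case 1
        have "\<forall>\<^sub>F n in sequentially. (if r < t n then e r else 0) = e r"
          using order_tendstoD(1)[OF t 1] by eventually_elim simp
        with 1 show ?thesis by (simp add: tendsto_eventually)
      next
        case 2
        have "\<forall>\<^sub>F n in sequentially. (if r < t n then e r else 0) = 0"
          using order_tendstoD(2)[OF t 2] by eventually_elim simp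
        with 2 show ?thesis by (simp add: tendsto_eventually)
      qed
    qed
  qed (use e in auto)
qed

text \<open>
  The right-hand side is the value at \<open>T\<close> of the solution \<open>y\<close> of \<open>y' = C - \<alpha> y\<close>, \<open>y(0) = E(0)\<close>. If
  \<open>E(T) > y(T)\<close>, consider the last time \<open>s\<close> with \<open>E(s) \<le> y(s)\<close>. On \<open>(s,T]\<close> the energy exceeds \<open>y\<close>, so
  it increases less than \<open>y\<close> does, a contradiction. The argument uses the inequality only in
  integrated form, so it is enough to have it at almost every time.
\<close>

lemma gronwall_exponential_decay:
  fixes E e :: "real \<Rightarrow> real"
  assumes T: "0 < T" and \<alpha>: "0 < \<alpha>" and e: "integrable (vol {0<..<T}) e"
    and E: "\<And>t. t \<in> {0..T} \<Longrightarrow> E t = E 0 + (\<integral>r. (if r < t then e r else 0) \<partial>vol {0<..<T})"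
    and le: "AE r in vol {0<..<T}. e r \<le> C - \<alpha> * E r"
  shows "E T \<le> exp (- \<alpha> * T) * (E 0 + C / \<alpha> * (exp (\<alpha> * T) - 1))"
proof -
  let ?N = "vol {0<..<T}"
  have [measurable]: "(\<lambda>r. r) \<in> borel_measurable ?N" by (simp add: measurable_vol)
  note [measurable] = borel_measurable_integrable[OF e]
  define y where "y t = C / \<alpha> + (E 0 - C / \<alpha>) * exp (- \<alpha> * t)" for t
  have dy: "(y has_real_derivative C - \<alpha> * y t) (at t)" for t
    unfolding y_def using \<alpha> by (auto intro!: derivative_eq_intros simp: field_simps)
  have cy: "continuous_on S y" for S
    using dy by (intro continuous_at_imp_continuous_on ballI DERIV_isCont)
  have "continuous_on {0..T} (\<lambda>t. E 0 + (\<integral>r. (if r < t then e r else 0) \<partial>?N))"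
    by (intro continuous_intros continuous_on_primitive e)
  then have cE: "continuous_on {0..T} E"
    by (rule continuous_on_eq) (rule E[symmetric])
  have "E T \<le> y T"
  proof (rule ccontr)
    assume neg: "\<not> E T \<le> y T"
    define S where "S = {0..T} \<inter> (\<lambda>s. E s - y s) -` {..0}"
    have "closed S"
      unfolding S_def by (intro continuous_closed_preimage continuous_on_diff cE cy closed_atLeastAtMost closed_atMost)
    moreover have "bounded S"
      by (rule bounded_subset[of "{0..T}"]) (auto simp: S_def)
    ultimately have "compact S" by (simp add: compact_eq_bounded_closed)
    moreover have "0 \<in> S" using T by (auto simp: S_def y_def)
    ultimately obtain s where s: "s \<in> S" "\<And>r. r \<in> S \<Longrightarrow> r \<le> s"
      using compact_attains_sup[of S] by blast
    have s': "0 \<le> s" "s < T" "E s \<le> y s"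
      using s(1) neg by (auto simp: S_def less_le)
    have gt: "y r < E r" if "s < r" "r \<le> T" for r
      using s(2)[of r] that s' by (force simp: S_def)
    define c where "c r = C - \<alpha> * y r" for r
    have cc: "continuous_on A c" for A unfolding c_def by (intro continuous_intros cy)
    have "E T - E s = (\<integral>r. (if r < T then e r else 0) \<partial>?N) - (\<integral>r. (if r < s then e r else 0) \<partial>?N)"
    proof -
      have "T \<in> {0..T}" "s \<in> {0..T}" using T s' by auto
      from E[OF this(1)] E[OF this(2)] show ?thesis by linarith
    qed
    also have "\<dots> = (\<integral>r. (if r < T then e r else 0) - (if r < s then e r else 0) \<partial>?N)"
      by (intro Bochner_Integration.integral_diff[symmetric] Bochner_Integration.integrable_bound[OF e]) auto
    also have "\<dots> \<le> (\<integral>r. (if s \<le> r then c r else 0) \<partial>?N)"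
    proof (rule integral_mono_AE)
      show "integrable ?N (\<lambda>r. (if r < T then e r else 0) - (if r < s then e r else 0))"
        by (rule Bochner_Integration.integrable_bound[OF e]) auto
      have "c \<in> borel_measurable borel" by (rule borel_measurable_continuous_onI[OF cc])
      then have [measurable]: "c \<in> borel_measurable ?N" by (rule measurable_vol)
      show "integrable ?N (\<lambda>r. if s \<le> r then c r else 0)"
        by (rule Bochner_Integration.integrable_bound[OF integrable_vol_continuous[OF cc]]) auto
      have "AE r in ?N. r \<noteq> s"
        by (auto simp: AE_restrict_space_iff intro: AE_mp[OF AE_lborel_singleton[of s]])
      with le AE_space show "AE r in ?N. (if r < T then e r else 0) - (if r < s then e r else 0) \<le> (if s \<le> r then c r else 0)"
      proof eventually_elim
        case (elim r)
        show ?case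
        proof (cases "s < r")
          case True
          then have "\<alpha> * y r \<le> \<alpha> * E r"
            using gt[of r] elim(2) \<alpha> by (simp add: space_restrict_space)
          with True elim show ?thesis by (simp add: c_def space_restrict_space)
        qed (use elim in \<open>auto simp: space_restrict_space\<close>)
      qed
    qed
    also have "\<dots> = y T - y s"
      unfolding c_def using s' cc[unfolded c_def] by (intro integral_vol_FTC dy) auto
    finally show False using neg s' by simp
  qed
  also have "y T = exp (- \<alpha> * T) * (E 0 + C / \<alpha> * (exp (\<alpha> * T) - 1))"
    by (simp add: y_def algebra_simps exp_minus)
  finally show ?thesis .
qed

section \<open>The energy balance\<close>

lemma AE_vol_Ioo: "(AE t\<in>{0<..<T} in lborel. P t) \<longleftrightarrow> (AE t in vol {0<..<T::real}. P t)"
  by (simp add: AE_restrict_space_iff)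

lemma Lp_norm_2_sq: "(Lp_norm 2 S u)\<^sup>2 = (\<integral>x. (norm (u x))\<^sup>2 \<partial>vol S)"
  by (simp add: Lp_norm_2)

lemma Lp_norm_cong_AE:
  assumes "u \<in> borel_measurable (vol S)" "v \<in> borel_measurable (vol S)" "AE x in vol S. u x = v x"
  shows "Lp_norm p S u = Lp_norm p S v"
proof -
  note [measurable] = assms(1,2)
  have "(\<integral>x. norm (u x) powr p \<partial>vol S) = (\<integral>x. norm (v x) powr p \<partial>vol S)"
    by (rule integral_cong_AE) (measurable, use assms(3) in \<open>auto elim: eventually_mono\<close>)
  then show ?thesis by (simp add: Lp_norm_def)
qed

text \<open>
  Being in \<open>L\<^sup>\<infinity>(0,T; H\<^sup>1)\<close> controls the gradient at almost every time only. Starting from one such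
  time \<open>s\<close> and adding the primitive of the gradient of \<open>w\<^sub>t\<close> reaches every \<open>t\<close> in \<open>[0,T]\<close>, with a
  gradient that is jointly measurable in time and space.
\<close>

lemma strong_solution_gradient:
  fixes w :: "real \<Rightarrow> real ^ 'd \<Rightarrow> real ^ 'd"
  assumes op: "open \<Omega>" and bd: "bounded \<Omega>" and T: "0 < T"
    and w: "w \<in> Bochner_W1 (Linf {0<..<T}) 2 T \<Omega>" and cont: "continuous_into_L2 T \<Omega> w"
    and wt: "wt \<in> Bochner_W1 (Lp 1 {0<..<T}) 2 T \<Omega>" and weak: "has_weak_time_derivative T \<Omega> w wt"
  obtains Gt G0 where
    "L1_L2 (vol {0<..<T}) (vol \<Omega>) Gt" "L2_on (vol \<Omega>) G0"
    "AE r in vol {0<..<T}. has_weak_gradient \<Omega> (wt r) (Gt r)"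
    "\<And>t. t \<in> {0..T} \<Longrightarrow> has_weak_gradient \<Omega> (w t) (evolve T G0 Gt t)"
proof -
  let ?N = "vol {0<..<T}" and ?V = "vol \<Omega>"
  have \<Omega>: "\<Omega> \<in> sets borel" "bounded \<Omega>" using op bd by auto
  interpret V: finite_measure ?V by (rule finite_measure_vol[OF \<Omega>])
  note sf = V.sigma_finite_measure_axioms
  obtain G where G: "G \<in> Bochner_Lp (Linf {0<..<T}) 2 T \<Omega>" "AE t in ?N. has_weak_gradient \<Omega> (w t) (G t)"
    using w unfolding Bochner_W1_def AE_vol_Ioo by blast
  obtain Gt where Gt: "Gt \<in> Bochner_Lp (Lp 1 {0<..<T}) 2 T \<Omega>" "AE t in ?N. has_weak_gradient \<Omega> (wt t) (Gt t)"
    using wt unfolding Bochner_W1_def AE_vol_Ioo by blast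
  have L: "L1_L2 ?N ?V w" "L1_L2 ?N ?V wt" "L1_L2 ?N ?V G" "L1_L2 ?N ?V Gt"
    using w wt G(1) Gt(1) by (auto simp: Bochner_W1_def intro: Bochner_Lp_L1_L2)
  have "emeasure ?N (space ?N) = ennreal T"
    using T by (simp add: space_restrict_space emeasure_restrict_space)
  then have ne: "ae_filter ?N \<noteq> bot"
    using T by (simp add: ae_filter_eq_bot_iff)
  have "AE t in ?N. t \<in> space ?N \<and> has_weak_gradient \<Omega> (w t) (G t) \<and> L2_on ?V (G t)"
    using AE_space G(2) L1_L2_section[OF L(3)] by eventually_elim simp
  from eventually_happens'[OF ne this]
  obtain s where s: "s \<in> {0<..<T}" "has_weak_gradient \<Omega> (w s) (G s)" "L2_on ?V (G s)"
    by (auto simp: space_restrict_space)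
  have L2w: "L2_on ?V (w t)" if "t \<in> {0..T}" for t
    using cont that by (simp add: continuous_into_L2_def Lp_2_iff)
  have z1: "L2_on ?V (evolve T (\<lambda>_. 0) wt t)" and z2: "L2_on ?V (evolve T (\<lambda>_. 0) Gt t)" for t
    by (rule evolve_integrable(1)[OF sf]; use L in \<open>simp add: L2_on_def\<close>)+
  note hz = has_weak_gradient_time_integral[OF \<Omega> L(2) L(4) Gt(2)]
  define G0 where "G0 x = G s x + - evolve T (\<lambda>_. 0) Gt s x" for x
  have G0: "L2_on ?V G0"
    unfolding G0_def by (intro L2_on_add L2_on_uminus s z2)
  have "has_weak_gradient \<Omega> (w t) (evolve T G0 Gt t)" if t: "t \<in> {0..T}" for t
  proof -
    have s0: "s \<in> {0..T}" using s(1) by simp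
    note gs = has_weak_gradient_add[OF \<Omega> L2w[OF s0] s(3,2) L2_on_uminus[OF z1] L2_on_uminus[OF z2] has_weak_gradient_uminus[OF hz[of s]]]
    note l1 = L2_on_add[OF L2w[OF s0] L2_on_uminus[OF z1[of s]]]
    note l2 = L2_on_add[OF s(3) L2_on_uminus[OF z2[of s]]]
    note g = has_weak_gradient_add[OF \<Omega> l1 l2 gs z1[of t] z2[of t] hz[of t]]
    have "AE x in ?V. w t x = w s x + - evolve T (\<lambda>_. 0) wt s x + evolve T (\<lambda>_. 0) wt t x"
      using weak_time_derivative_evolve[OF \<Omega> L(1,2) weak cont t] weak_time_derivative_evolve[OF \<Omega> L(1,2) weak cont s0]
    proof eventually_elim
      case (elim x)
      then show ?case by (simp add: evolve_zero_add[of T "w 0"])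
    qed
    from has_weak_gradient_cong_AE[OF \<Omega> L2_on_add[OF l1 z1[of t]] L2_on_add[OF l2 z2[of t]] L2w[OF t] this g]
    have "has_weak_gradient \<Omega> (w t) (\<lambda>x. G s x + - evolve T (\<lambda>_. 0) Gt s x + evolve T (\<lambda>_. 0) Gt t x)" .
    also have "(\<lambda>x. G s x + - evolve T (\<lambda>_. 0) Gt s x + evolve T (\<lambda>_. 0) Gt t x) = evolve T G0 Gt t"
      by (auto simp: evolve_zero_add[of T G0] G0_def)
    finally show ?thesis .
  qed
  with L(4) G0 Gt(2) show ?thesis by (rule that)
qed

text \<open>
  The equation tested with the solution: convection and pressure drop out, and the two viscous terms
  become norms.
\<close>

lemma csm_momentum_energy:
  fixes w wt :: "real ^ 'd \<Rightarrow> real ^ 'd"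
  assumes op: "open \<Omega>" and bd: "bounded \<Omega>" and w: "w \<in> Xspace \<Omega>" and p: "p \<in> Qspace \<Omega>"
    and div: "\<forall>q\<in>Qspace \<Omega>. L2_inner \<Omega> q (weak_div \<Omega> w) = 0"
    and mom: "csm_momentum \<nu> Cs \<delta> \<mu> \<Omega> f w wt p w"
  shows "L2_inner \<Omega> wt w + Cs ^ 4 / \<mu>\<^sup>2 * \<delta>\<^sup>2 * L2_inner \<Omega> (weak_grad \<Omega> wt) (weak_grad \<Omega> w)
    = L2_inner \<Omega> f w - \<nu> * (Lp_norm 2 \<Omega> (weak_grad \<Omega> w))\<^sup>2 - (Cs * \<delta>)\<^sup>2 * Lp_norm 3 \<Omega> (weak_grad \<Omega> w) ^ 3"
proof -
  let ?A = "weak_grad \<Omega> w"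
  have "L2_inner \<Omega> (\<lambda>x. ?A x *v w x) w = 0"
    using convection_vanishes[OF op bd w] div by blast
  moreover have "L2_inner \<Omega> p (weak_div \<Omega> w) = 0" using div p by blast
  moreover have "L2_inner \<Omega> ?A ?A = (Lp_norm 2 \<Omega> ?A)\<^sup>2"
    by (simp add: L2_inner_def Lp_norm_2_sq power2_norm_eq_inner)
  moreover have "L2_inner \<Omega> (\<lambda>x. ((Cs * \<delta>)\<^sup>2 * norm (?A x)) *\<^sub>R ?A x) ?A = (Cs * \<delta>)\<^sup>2 * Lp_norm 3 \<Omega> ?A ^ 3"
  proof -
    have "(((Cs * \<delta>)\<^sup>2 * norm (?A x)) *\<^sub>R ?A x) \<bullet> ?A x = (Cs * \<delta>)\<^sup>2 * norm (?A x) ^ 3" for x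
      by (simp add: power3_eq_cube power2_norm_eq_inner[symmetric] power2_eq_square)
    then show ?thesis unfolding L2_inner_def Lp_norm_3_cubed by (simp only: integral_mult_right_zero)
  qed
  ultimately show ?thesis
    using mom by (simp add: csm_momentum_def)
qed

text \<open>
  Writing \<open>w\<close> and its gradient as primitives in time makes \<open>E\<close> absolutely continuous with a density
  that pairs \<open>w\<^sub>t\<close> with \<open>w\<close>, and \<open>csm_momentum_energy\<close> evaluates this density. For the cubic term only
  measurability in time is asserted: the solution class bounds the square of the \<open>L\<^sup>3\<close> norm in time,
  and the integrability of the cube follows from the other conclusions.
\<close>

lemma strong_solution_energy_balance:
  fixes w :: "real \<Rightarrow> real ^ 'd \<Rightarrow> real ^ 'd"
  assumes op: "open \<Omega>" and bd: "bounded \<Omega>" and T: "0 < T" and f: "f \<in> Lp 2 \<Omega>"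
    and sol: "strong_solution \<nu> Cs \<delta> \<mu> \<Omega> f T w"
  defines "E \<equiv> \<lambda>t. (Lp_norm 2 \<Omega> (w t))\<^sup>2 + Cs ^ 4 / \<mu>\<^sup>2 * \<delta>\<^sup>2 * (Lp_norm 2 \<Omega> (weak_grad \<Omega> (w t)))\<^sup>2"
  obtains e where "integrable (vol {0<..<T}) e"
    and "\<forall>t\<in>{0..T}. w t \<in> W1 2 \<Omega>"
    and "\<forall>t\<in>{0..T}. E t = E 0 + (\<integral>r. (if r < t then e r else 0) \<partial>vol {0<..<T})"
    and "AE r in vol {0<..<T}. w r \<in> Xspace \<Omega> \<and> e r = 2 * (L2_inner \<Omega> f (w r)
      - \<nu> * (Lp_norm 2 \<Omega> (weak_grad \<Omega> (w r)))\<^sup>2 - (Cs * \<delta>)\<^sup>2 * Lp_norm 3 \<Omega> (weak_grad \<Omega> (w r)) ^ 3)"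
    and "integrable (vol {0<..<T}) (\<lambda>r. L2_inner \<Omega> f (w r))"
    and "integrable (vol {0<..<T}) (\<lambda>r. (Lp_norm 2 \<Omega> (weak_grad \<Omega> (w r)))\<^sup>2)"
    and "(\<lambda>r. Lp_norm 3 \<Omega> (weak_grad \<Omega> (w r)) ^ 3) \<in> borel_measurable (vol {0<..<T})"
proof -
  let ?N = "vol {0<..<T}" and ?V = "vol \<Omega>"
  have \<Omega>: "\<Omega> \<in> sets borel" "bounded \<Omega>" using op bd by auto
  interpret N: finite_measure ?N by (rule finite_measure_vol) auto
  interpret V: finite_measure ?V by (rule finite_measure_vol[OF \<Omega>])
  note sf = V.sigma_finite_measure_axioms
  define \<kappa> where "\<kappa> = Cs ^ 4 / \<mu>\<^sup>2 * \<delta>\<^sup>2"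
  have wS: "w \<in> solution_class T \<Omega>" and cont: "continuous_into_L2 T \<Omega> w"
    using sol by (auto simp: strong_solution_def)
  then have wB: "w \<in> Bochner_W1 (Linf {0<..<T}) 2 T \<Omega>" by (simp add: solution_class_def)
  obtain wt p where wt: "wt \<in> Bochner_W1 (Lp 1 {0<..<T}) 2 T \<Omega>"
    and weak: "has_weak_time_derivative T \<Omega> w wt"
    and X: "AE t\<in>{0<..<T} in lborel. w t \<in> Xspace \<Omega> \<and> p t \<in> Qspace \<Omega>"
    and mom: "\<forall>v \<in> solution_class T \<Omega>. (AE t\<in>{0<..<T} in lborel. v t \<in> Xspace \<Omega>) \<longrightarrow>
        (AE t\<in>{0<..<T} in lborel. csm_momentum \<nu> Cs \<delta> \<mu> \<Omega> f (w t) (wt t) (p t) (v t))"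
    and div: "AE t\<in>{0<..<T} in lborel. \<forall>q\<in>Qspace \<Omega>. L2_inner \<Omega> q (weak_div \<Omega> (w t)) = 0"
    using sol unfolding strong_solution_def by blast
  have "AE t\<in>{0<..<T} in lborel. w t \<in> Xspace \<Omega>"
    using X by eventually_elim simp
  then have mom': "AE t\<in>{0<..<T} in lborel. csm_momentum \<nu> Cs \<delta> \<mu> \<Omega> f (w t) (wt t) (p t) (w t)"
    using mom wS by blast
  obtain Gt G0 where Gt: "L1_L2 ?N ?V Gt" and G0: "L2_on ?V G0"
    and wtG: "AE r in ?N. has_weak_gradient \<Omega> (wt r) (Gt r)"
    and wG: "\<And>t. t \<in> {0..T} \<Longrightarrow> has_weak_gradient \<Omega> (w t) (evolve T G0 Gt t)"
    using strong_solution_gradient[OF op bd T wB cont wt weak] by blast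
  define H where "H = evolve T G0 Gt"
  define U where "U = evolve T (w 0) wt"
  have L: "L1_L2 ?N ?V w" "L1_L2 ?N ?V wt"
    using wB wt by (auto simp: Bochner_W1_def intro: Bochner_Lp_L1_L2)
  have L2w: "L2_on ?V (w t)" if "t \<in> {0..T}" for t
    using cont that by (simp add: continuous_into_L2_def Lp_2_iff)
  have w0: "L2_on ?V (w 0)" using L2w[of 0] T by simp
  have L2H: "L2_on ?V (H t)" and L2U: "L2_on ?V (U t)" for t
    unfolding H_def U_def by (rule evolve_integrable(1)[OF sf Gt G0] evolve_integrable(1)[OF sf L(2) w0])+
  have wU: "AE x in ?V. w t x = U t x" if "t \<in> {0..T}" for t
    unfolding U_def by (rule weak_time_derivative_evolve[OF \<Omega> L weak cont that])
  note wg = weak_grad_unique[OF op wG, folded H_def]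
  have normU: "(Lp_norm 2 \<Omega> (w t))\<^sup>2 = (\<integral>x. (norm (U t x))\<^sup>2 \<partial>?V)" if t: "t \<in> {0..T}" for t
    using Lp_norm_cong_AE[OF L2_onD[OF L2w[OF t]] L2_onD[OF L2U] wU[OF t]] by (simp add: Lp_norm_2_sq)
  have normH: "Lp_norm q \<Omega> (weak_grad \<Omega> (w t)) = Lp_norm q \<Omega> (H t)" if t: "t \<in> {0..T}" for t q
    by (rule Lp_norm_cong_AE[OF wg(2)[OF t] L2_onD[OF L2H] wg(1)[OF t]])
  have E_eq: "E t = (\<integral>x. (norm (U t x))\<^sup>2 \<partial>?V) + \<kappa> * (\<integral>x. (norm (H t x))\<^sup>2 \<partial>?V)" if t: "t \<in> {0..T}" for t
    unfolding E_def normU[OF t] normH[OF t] \<kappa>_def unfolding Lp_norm_2_sq ..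
  define eU where "eU r = (\<integral>x. wt r x \<bullet> U r x \<partial>?V)" for r
  define eH where "eH r = (\<integral>x. Gt r x \<bullet> H r x \<partial>?V)" for r
  note en1 = evolve_energy[OF sf L(2) w0, folded U_def, folded eU_def]
  note en2 = evolve_energy[OF sf Gt G0, folded H_def, folded eH_def]
  define e where "e r = 2 * (eU r + \<kappa> * eH r)" for r
  show ?thesis
  proof (rule that)
    show "integrable ?N e"
      unfolding e_def[abs_def] using en1(1) en2(1) by simp
    show "\<forall>t\<in>{0..T}. w t \<in> W1 2 \<Omega>"
    proof
      fix t assume t: "t \<in> {0..T}"
      show "w t \<in> W1 2 \<Omega>"
        using L2w[OF t] L2H[of t] wG[OF t] by (auto simp: W1_def Lp_2_iff H_def)
    qed
    show "\<forall>t\<in>{0..T}. E t = E 0 + (\<integral>r. (if r < t then e r else 0) \<partial>?N)"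
    proof
      fix t assume t: "t \<in> {0..T}"
      have i: "integrable ?N (\<lambda>r. if r < t then g r else 0)" if g: "integrable ?N g" for g :: "real \<Rightarrow> real"
      proof (rule Bochner_Integration.integrable_bound[OF g])
        have [measurable]: "(\<lambda>r. r) \<in> borel_measurable ?N" by (simp add: measurable_vol)
        note [measurable] = borel_measurable_integrable[OF g]
        show "(\<lambda>r. if r < t then g r else 0) \<in> borel_measurable ?N" by measurable
      qed auto
      have "E t = (\<integral>x. (norm (U t x))\<^sup>2 \<partial>?V) + \<kappa> * (\<integral>x. (norm (H t x))\<^sup>2 \<partial>?V)"
        by (rule E_eq[OF t])
      also have "\<dots> = (\<integral>x. (norm (U 0 x))\<^sup>2 \<partial>?V) + \<kappa> * (\<integral>x. (norm (H 0 x))\<^sup>2 \<partial>?V)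
          + (2 * (\<integral>r. (if r < t then eU r else 0) \<partial>?N) + \<kappa> * (2 * (\<integral>r. (if r < t then eH r else 0) \<partial>?N)))"
        unfolding en1(2)[of t] en2(2)[of t] by (simp add: U_def H_def algebra_simps)
      also have "(\<integral>x. (norm (U 0 x))\<^sup>2 \<partial>?V) + \<kappa> * (\<integral>x. (norm (H 0 x))\<^sup>2 \<partial>?V) = E 0"
        using E_eq[of 0] T by simp
      also have "2 * (\<integral>r. (if r < t then eU r else 0) \<partial>?N) + \<kappa> * (2 * (\<integral>r. (if r < t then eH r else 0) \<partial>?N))
          = (\<integral>r. 2 * (if r < t then eU r else 0) + \<kappa> * (2 * (if r < t then eH r else 0)) \<partial>?N)"
        using i[OF en1(1)] i[OF en2(1)] by simp
      also have "\<dots> = (\<integral>r. (if r < t then e r else 0) \<partial>?N)"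
        by (intro Bochner_Integration.integral_cong) (auto simp: e_def algebra_simps)
      finally show "E t = E 0 + (\<integral>r. (if r < t then e r else 0) \<partial>?N)" .
    qed
    show "AE r in ?N. w r \<in> Xspace \<Omega> \<and> e r = 2 * (L2_inner \<Omega> f (w r)
      - \<nu> * (Lp_norm 2 \<Omega> (weak_grad \<Omega> (w r)))\<^sup>2 - (Cs * \<delta>)\<^sup>2 * Lp_norm 3 \<Omega> (weak_grad \<Omega> (w r)) ^ 3)"
      using X[unfolded AE_vol_Ioo] mom'[unfolded AE_vol_Ioo] div[unfolded AE_vol_Ioo] wtG L1_L2_section[OF L(2)]
        L1_L2_section[OF Gt] AE_space
    proof eventually_elim
      case (elim r)
      have r: "r \<in> {0..T}" using elim(7) by (auto simp: space_restrict_space)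
      have "L2_inner \<Omega> (wt r) (w r) = eU r"
        unfolding L2_inner_def eU_def
      proof (rule integral_cong_AE)
        show "AE x in ?V. wt r x \<bullet> w r x = wt r x \<bullet> U r x"
          using wU[OF r] by eventually_elim simp
      qed (use L2_onD[OF elim(5)] L2_onD[OF L2w[OF r]] L2_onD[OF L2U] in measurable)
      moreover have "L2_inner \<Omega> (weak_grad \<Omega> (wt r)) (weak_grad \<Omega> (w r)) = eH r"
        unfolding L2_inner_def eH_def
      proof (rule integral_cong_AE)
        show "AE x in ?V. weak_grad \<Omega> (wt r) x \<bullet> weak_grad \<Omega> (w r) x = Gt r x \<bullet> H r x"
          using wg(1)[OF r] weak_grad_unique(1)[OF op elim(4)] by eventually_elim simp
      qed (use L2_onD[OF elim(6)] weak_grad_unique(2)[OF op elim(4)] wg(2)[OF r] L2_onD[OF L2H] in measurable)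
      ultimately show ?case
        using csm_momentum_energy[OF op bd _ _ elim(3,2)] elim(1) by (simp add: e_def \<kappa>_def)
    qed
    show "integrable ?N (\<lambda>r. L2_inner \<Omega> f (w r))"
    proof -
      have "L2_on ?V f" using f by (simp add: Lp_2_iff)
      from L1_L2_integrable_inner[OF N.sigma_finite_measure_axioms sf L(1) this]
      show ?thesis by (simp add: L2_inner_def inner_commute)
    qed
    have cong: "h \<in> borel_measurable ?N \<longleftrightarrow> h' \<in> borel_measurable ?N" "integrable ?N h \<longleftrightarrow> integrable ?N h'"
      if "\<And>r. r \<in> {0..T} \<Longrightarrow> h r = h' r" for h h' :: "real \<Rightarrow> real"
      using that by (auto simp: space_restrict_space intro!: measurable_cong Bochner_Integration.integrable_cong)
    have "integrable ?N (\<lambda>r. (\<integral>x. (norm (H r x))\<^sup>2 \<partial>?V))"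
      unfolding en2(2) by (intro integrable_vol_continuous continuous_intros continuous_on_primitive en2(1))
    then show "integrable ?N (\<lambda>r. (Lp_norm 2 \<Omega> (weak_grad \<Omega> (w r)))\<^sup>2)"
      by (rule cong(2)[THEN iffD1, rotated]) (simp only: normH Lp_norm_2_sq[symmetric])
    have [measurable]: "(\<lambda>r. r) \<in> borel_measurable ?N" by (simp add: measurable_vol)
    have [measurable]: "(\<lambda>(x, t). H t x) \<in> borel_measurable (?V \<Otimes>\<^sub>M borel)"
      unfolding H_def using Gt L2_onD[OF G0] by (intro evolve_measurable) (auto simp: L1_L2_def)
    have "(\<lambda>q. case (snd q, fst q) of (x, t) \<Rightarrow> H t x) \<in> borel_measurable (?N \<Otimes>\<^sub>M ?V)"
      by measurable
    then have [measurable]: "(\<lambda>(r, x). H r x) \<in> borel_measurable (?N \<Otimes>\<^sub>M ?V)"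
      by (simp add: case_prod_unfold)
    have "(\<lambda>r. \<integral>x. norm (H r x) ^ 3 \<partial>?V) \<in> borel_measurable ?N" by measurable
    then show "(\<lambda>r. Lp_norm 3 \<Omega> (weak_grad \<Omega> (w r)) ^ 3) \<in> borel_measurable ?N"
      by (rule cong(1)[THEN iffD1, rotated]) (simp only: normH Lp_norm_3_cubed[symmetric])
  qed
qed

lemma lebesgue_Icc_eq_vol:
  fixes F :: "real \<Rightarrow> real"
  assumes F: "integrable (vol {0<..<T}) F" and T: "0 < T"
  shows "set_integrable lebesgue {0..T} F"
    and "(LINT t:{0..T}|lebesgue. F t) = (\<integral>t. F t \<partial>vol {0<..<T})"
proof -
  define F' where "F' t = indicator {0<..<T} t *\<^sub>R F t" for t
  have F': "integrable lborel F'"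
    using F by (simp add: integrable_restrict_space F'_def[abs_def])
  have split: "indicator {0..T} t *\<^sub>R F t = F' t + (indicator {0} t * F 0 + indicator {T} t * F T)" for t
    using T by (auto simp: F'_def split: split_indicator)
  have ind: "has_bochner_integral lborel (\<lambda>t. indicator {0} t * F 0 + indicator {T} t * F T) 0"
    by (auto simp: has_bochner_integral_iff)
  have *: "integrable lborel (\<lambda>t. indicator {0..T} t *\<^sub>R F t)"
      "(\<integral>t. indicator {0..T} t *\<^sub>R F t \<partial>lborel) = (\<integral>t. F' t \<partial>lborel)"
    unfolding split using F' ind by (auto simp: has_bochner_integral_iff)
  then show "set_integrable lebesgue {0..T} F"
    unfolding set_integrable_def by (subst integrable_completion) (auto dest: borel_measurable_integrable)
  have "(LINT t:{0..T}|lebesgue. F t) = (\<integral>t. indicator {0..T} t *\<^sub>R F t \<partial>lborel)"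
    unfolding set_lebesgue_integral_def using *(1)
    by (intro integral_completion) (auto dest: borel_measurable_integrable)
  also have "\<dots> = (\<integral>t. F t \<partial>vol {0<..<T})"
    unfolding *(2) F'_def by (rule integral_restrict_space[symmetric]) simp
  finally show "(LINT t:{0..T}|lebesgue. F t) = (\<integral>t. F t \<partial>vol {0<..<T})" .
qed

lemma Cauchy_Schwarz_L2_inner:
  assumes "f \<in> Lp 2 \<Omega>" "u \<in> Lp 2 \<Omega>"
  shows "L2_inner \<Omega> f u \<le> Lp_norm 2 \<Omega> f * Lp_norm 2 \<Omega> u"
  using L2_on_inner(2)[of "vol \<Omega>" f u] assms by (simp add: L2_inner_def Lp_norm_2 Lp_2_iff)

lemma Lp_norm_nonneg [simp]: "0 \<le> Lp_norm p S u"
  by (simp add: Lp_norm_def)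

text \<open>
  After \<open>b \<le> c d\<close> this is \<open>0 \<le> (c a - s d)\<^sup>2\<close>.
\<close>

lemma forcing_bound:
  fixes a b d c s :: real
  assumes "0 \<le> a" "b \<le> c * d" "0 < s"
  shows "a * b \<le> c\<^sup>2 / (2 * s) * a\<^sup>2 + s / 2 * d\<^sup>2"
proof -
  have "a * b \<le> a * (c * d)" using assms by (intro mult_left_mono)
  also have "0 \<le> (c * a - s * d)\<^sup>2 / (2 * s)" using assms by simp
  then have "a * (c * d) \<le> c\<^sup>2 / (2 * s) * a\<^sup>2 + s / 2 * d\<^sup>2"
    using assms by (simp add: power2_eq_square field_simps)
  finally show ?thesis .
qed

text \<open>
  Of the dissipation \<open>2 \<nu> d\<^sup>2\<close> the forcing takes \<open>\<nu> d\<^sup>2 / 2\<close>. In the remainder,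
  \<open>\<nu> d\<^sup>2 / 2\<close> dominates \<open>\<alpha> b\<^sup>2\<close> by the Poincare inequality and the first bound on \<open>\<alpha>\<close>, and \<open>\<nu> d\<^sup>2\<close>
  dominates \<open>\<alpha> \<kappa> d\<^sup>2\<close> by the second.
\<close>

lemma energy_dissipation_bound:
  fixes a b d c \<nu> \<kappa> \<alpha> X :: real
  assumes a: "0 \<le> a" and b: "0 \<le> b" "b \<le> c * d" and c: "0 < c" and \<nu>: "0 < \<nu>" and \<kappa>: "0 < \<kappa>"
    and \<alpha>: "0 \<le> \<alpha>" "\<alpha> \<le> \<nu> / (2 * c\<^sup>2)" "\<alpha> \<le> \<nu> / \<kappa>" and X: "0 \<le> X" and i: "i \<le> a * b"
  shows "2 * (i - \<nu> * d\<^sup>2 - X) \<le> 2 / \<nu> * c\<^sup>2 * a\<^sup>2 - \<alpha> * (b\<^sup>2 + \<kappa> * d\<^sup>2)"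
proof -
  have "\<alpha> * b\<^sup>2 \<le> \<nu> / (2 * c\<^sup>2) * (c * d)\<^sup>2"
    using \<alpha> b by (intro mult_mono power_mono) auto
  also have "\<dots> = \<nu> / 2 * d\<^sup>2" using c by (simp add: field_simps)
  finally have 1: "\<alpha> * b\<^sup>2 \<le> \<nu> / 2 * d\<^sup>2" .
  have "\<alpha> * \<kappa> \<le> \<nu>" using \<alpha>(3) \<kappa> by (simp add: field_simps)
  then have 2: "\<alpha> * \<kappa> * d\<^sup>2 \<le> \<nu> * d\<^sup>2" by (intro mult_right_mono) auto
  have "a * b \<le> c\<^sup>2 / (2 * (\<nu> / 2)) * a\<^sup>2 + \<nu> / 2 / 2 * d\<^sup>2"
    using forcing_bound[OF a b(2), of "\<nu> / 2"] \<nu> by simp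
  then have 3: "2 * i \<le> 2 / \<nu> * c\<^sup>2 * a\<^sup>2 + \<nu> / 2 * d\<^sup>2"
    using i by simp
  from 1 2 3 X show ?thesis by (simp add: algebra_simps)
qed

section \<open>Stability of the Corrected Smagorinsky Model\<close>

theorem theorem4p3:
  fixes \<Omega> :: "(real ^ 'd) set"
    and f :: "real ^ 'd \<Rightarrow> real ^ 'd"
    and w :: "real \<Rightarrow> real ^ 'd \<Rightarrow> real ^ 'd"
    and \<nu> Cs \<delta> \<mu> C_PF \<alpha> C :: real
  assumes dim: "CARD('d) = 2 \<or> CARD('d) = 3"
    and domain: "regular_domain \<Omega>"
    and params: "\<nu> > 0" "Cs > 0" "\<delta> > 0" "\<mu> > 0"
    and C_PF_pos: "C_PF > 0"
    and poincare: "\<And>u. u \<in> Xspace \<Omega> \<Longrightarrow> Lp_norm 2 \<Omega> u \<le> C_PF * Lp_norm 2 \<Omega> (weak_grad \<Omega> u)"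
    and f: "f \<in> Lp 2 \<Omega>"
    and sol: "\<And>T. T > 0 \<Longrightarrow> strong_solution \<nu> Cs \<delta> \<mu> \<Omega> f T w"
    and alpha: "\<alpha> = min (\<nu> / (2 * C_PF\<^sup>2)) (\<mu>\<^sup>2 * \<nu> / (Cs ^ 4 * \<delta>\<^sup>2))"
    and C: "C = 2 / \<nu> * C_PF\<^sup>2 * (Lp_norm 2 \<Omega> f)\<^sup>2"
  shows
    \<comment> \<open>the norms in the estimates are those of genuine \<open>H\<^sup>1\<close> functions, for every \<open>t\<close>\<close>
    "(\<forall>t\<ge>0. w t \<in> W1 2 \<Omega>)
     \<and>
     (\<forall>T>0. (Lp_norm 2 \<Omega> (w T))\<^sup>2 + Cs ^ 4 / \<mu>\<^sup>2 * \<delta>\<^sup>2 * (Lp_norm 2 \<Omega> (weak_grad \<Omega> (w T)))\<^sup>2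
        \<le> exp (- \<alpha> * T) *
          ((Lp_norm 2 \<Omega> (w 0))\<^sup>2 + Cs ^ 4 / \<mu>\<^sup>2 * \<delta>\<^sup>2 * (Lp_norm 2 \<Omega> (weak_grad \<Omega> (w 0)))\<^sup>2
           + C / \<alpha> * (exp (\<alpha> * T) - 1)))
     \<and>
     (\<exists>C' :: real. (SUP t\<in>{0..}. ereal ((Lp_norm 2 \<Omega> (w t))\<^sup>2
          + Cs ^ 4 * \<delta>\<^sup>2 / \<mu>\<^sup>2 * (Lp_norm 2 \<Omega> (weak_grad \<Omega> (w t)))\<^sup>2)) \<le> ereal C')
     \<and>
     (\<exists>R :: real \<Rightarrow> real. R \<in> O[at_top](\<lambda>T. 1 / T) \<and>
        (\<forall>T>0.
           set_integrable lebesgue {0..T} (\<lambda>t. \<nu> / 2 * (Lp_norm 2 \<Omega> (weak_grad \<Omega> (w t)))\<^sup>2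
             + (Cs * \<delta>)\<^sup>2 * (Lp_norm 3 \<Omega> (weak_grad \<Omega> (w t))) ^ 3) \<and>
           R T + 1 / measure lborel \<Omega> * (1 / T) *
             (LINT t:{0..T}|lebesgue. \<nu> / 2 * (Lp_norm 2 \<Omega> (weak_grad \<Omega> (w t)))\<^sup>2
               + (Cs * \<delta>)\<^sup>2 * (Lp_norm 3 \<Omega> (weak_grad \<Omega> (w t))) ^ 3)
           \<le> 1 / measure lborel \<Omega> * (1 / T) *
             (LINT t:{0..T}|lebesgue. C_PF\<^sup>2 / (2 * \<nu>) * (Lp_norm 2 \<Omega> f)\<^sup>2)))"
proof -
  have op: "open \<Omega>" and bd: "bounded \<Omega>" using domain by (auto simp: regular_domain_def)
  define \<kappa> where "\<kappa> = Cs ^ 4 / \<mu>\<^sup>2 * \<delta>\<^sup>2"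
  define c3 where "c3 = (Cs * \<delta>)\<^sup>2"
  define E where "E t = (Lp_norm 2 \<Omega> (w t))\<^sup>2 + \<kappa> * (Lp_norm 2 \<Omega> (weak_grad \<Omega> (w t)))\<^sup>2" for t
  define D where "D t = \<nu> / 2 * (Lp_norm 2 \<Omega> (weak_grad \<Omega> (w t)))\<^sup>2 + c3 * Lp_norm 3 \<Omega> (weak_grad \<Omega> (w t)) ^ 3" for t
  define F where "F = C_PF\<^sup>2 / (2 * \<nu>) * (Lp_norm 2 \<Omega> f)\<^sup>2"
  have \<kappa>: "\<kappa> > 0" and c3: "c3 > 0" using params by (simp_all add: \<kappa>_def c3_def)
  have \<alpha>_pos: "\<alpha> > 0" using params C_PF_pos by (simp add: alpha)
  have \<alpha>_le: "\<alpha> \<le> \<nu> / (2 * C_PF\<^sup>2)" "\<alpha> \<le> \<nu> / \<kappa>"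
    by (auto simp: alpha \<kappa>_def mult.commute)
  have C_nonneg: "C \<ge> 0" using params by (simp add: C)
  have E_nonneg: "E t \<ge> 0" for t using \<kappa> by (simp add: E_def)
  have step: "w T \<in> W1 2 \<Omega> \<and> w 0 \<in> W1 2 \<Omega>
      \<and> E T \<le> exp (- \<alpha> * T) * (E 0 + C / \<alpha> * (exp (\<alpha> * T) - 1))
      \<and> integrable (vol {0<..<T}) D \<and> (E T - E 0) / 2 + (\<integral>t. D t \<partial>vol {0<..<T}) \<le> (\<integral>t. F \<partial>vol {0<..<T})"
    if T: "T > 0" for T
  proof -
    let ?N = "vol {0<..<T}"
    interpret N: finite_measure ?N by (rule finite_measure_vol) auto
    obtain e where e: "integrable ?N e"
      and W1: "\<forall>t\<in>{0..T}. w t \<in> W1 2 \<Omega>"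
      and bal: "\<forall>t\<in>{0..T}. E t = E 0 + (\<integral>r. (if r < t then e r else 0) \<partial>?N)"
      and e_eq: "AE r in ?N. w r \<in> Xspace \<Omega> \<and> e r = 2 * (L2_inner \<Omega> f (w r)
        - \<nu> * (Lp_norm 2 \<Omega> (weak_grad \<Omega> (w r)))\<^sup>2 - c3 * Lp_norm 3 \<Omega> (weak_grad \<Omega> (w r)) ^ 3)"
      and int_f: "integrable ?N (\<lambda>r. L2_inner \<Omega> f (w r))"
      and int_2: "integrable ?N (\<lambda>r. (Lp_norm 2 \<Omega> (weak_grad \<Omega> (w r)))\<^sup>2)"
      and meas_3: "(\<lambda>r. Lp_norm 3 \<Omega> (weak_grad \<Omega> (w r)) ^ 3) \<in> borel_measurable ?N"
      by (rule strong_solution_energy_balance[OF op bd T f sol[OF T]])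
        (rule that[unfolded E_def \<kappa>_def c3_def])
    have rate: "AE r in ?N. e r \<le> C - \<alpha> * E r \<and> e r / 2 + D r \<le> F"
      using e_eq AE_space
    proof eventually_elim
      case (elim r)
      then have r: "r \<in> {0..T}" by (simp add: space_restrict_space)
      let ?a = "Lp_norm 2 \<Omega> f" and ?b = "Lp_norm 2 \<Omega> (w r)" and ?d = "Lp_norm 2 \<Omega> (weak_grad \<Omega> (w r))"
      have b: "?b \<le> C_PF * ?d" using poincare elim by blast
      have "w r \<in> Lp 2 \<Omega>" using W1 r by (simp add: W1_def)
      then have i: "L2_inner \<Omega> f (w r) \<le> ?a * ?b" by (rule Cauchy_Schwarz_L2_inner[OF f])
      have "?a * ?b \<le> F + \<nu> / 2 * ?d\<^sup>2"
        unfolding F_def by (rule forcing_bound[OF _ b]) (use params in auto)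
      moreover have "e r / 2 = L2_inner \<Omega> f (w r) - \<nu> * ?d\<^sup>2 - c3 * Lp_norm 3 \<Omega> (weak_grad \<Omega> (w r)) ^ 3"
        using elim by simp
      ultimately have "e r / 2 + D r \<le> F"
        using i unfolding D_def by (simp add: field_simps)
      moreover have "e r \<le> C - \<alpha> * E r"
        using energy_dissipation_bound[OF _ _ b C_PF_pos params(1) \<kappa> _ \<alpha>_le _ i] elim c3 \<alpha>_pos
        by (simp add: C E_def)
      ultimately show ?case by simp
    qed
    \<comment> \<open>All other terms of the energy balance are integrable in time, so the cubic one is as well.\<close>
    have "integrable ?N (\<lambda>r. c3 * Lp_norm 3 \<Omega> (weak_grad \<Omega> (w r)) ^ 3)"
    proof (rule integrable_cong_AE_imp)
      show "integrable ?N (\<lambda>r. L2_inner \<Omega> f (w r) - \<nu> * (Lp_norm 2 \<Omega> (weak_grad \<Omega> (w r)))\<^sup>2 - e r / 2)"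
        using e int_f int_2 by simp
      show "AE r in ?N. L2_inner \<Omega> f (w r) - \<nu> * (Lp_norm 2 \<Omega> (weak_grad \<Omega> (w r)))\<^sup>2 - e r / 2
          = c3 * Lp_norm 3 \<Omega> (weak_grad \<Omega> (w r)) ^ 3"
        using e_eq by eventually_elim (simp add: field_simps)
    qed (use meas_3 in measurable)
    then have D: "integrable ?N D" unfolding D_def using int_2 by simp
    have "E T \<le> exp (- \<alpha> * T) * (E 0 + C / \<alpha> * (exp (\<alpha> * T) - 1))"
      by (rule gronwall_exponential_decay[OF T \<alpha>_pos e bal[rule_format]]) (use rate in \<open>auto elim: eventually_mono\<close>)
    moreover have "(E T - E 0) / 2 + (\<integral>t. D t \<partial>?N) \<le> (\<integral>t. F \<partial>?N)"
    proof -
      have "E T - E 0 = (\<integral>r. (if r < T then e r else 0) \<partial>?N)" using bal[rule_format, of T] T by simp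
      also have "\<dots> = (\<integral>r. e r \<partial>?N)"
        by (intro Bochner_Integration.integral_cong) (auto simp: space_restrict_space)
      finally have "(E T - E 0) / 2 + (\<integral>t. D t \<partial>?N) = (\<integral>r. e r / 2 + D r \<partial>?N)"
        using e D by simp
      also have "\<dots> \<le> (\<integral>t. F \<partial>?N)"
        by (rule integral_mono_AE) (use e D rate in \<open>auto elim: eventually_mono\<close>)
      finally show ?thesis .
    qed
    ultimately show ?thesis using W1 T D by simp
  qed
  have E_bound: "E t \<le> E 0 + C / \<alpha>" if "t \<ge> 0" for t
  proof (cases "t = 0")
    case False
    then have "E t \<le> exp (- \<alpha> * t) * (E 0 + C / \<alpha> * (exp (\<alpha> * t) - 1))" using step[of t] that by simp
    also have "\<dots> = exp (- \<alpha> * t) * E 0 + (1 - exp (- \<alpha> * t)) * (C / \<alpha>)"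
      by (simp add: algebra_simps exp_minus)
    also have "\<dots> \<le> 1 * E 0 + 1 * (C / \<alpha>)"
      using E_nonneg[of 0] C_nonneg \<alpha>_pos that by (intro add_mono mult_right_mono) auto
    finally show ?thesis by simp
  qed (use C_nonneg \<alpha>_pos in simp)
  \<comment> \<open>Half the increment of the energy, which stays bounded, averaged over \<open>[0,T]\<close> and \<open>\<Omega>\<close>.\<close>
  define R where "R T = 1 / measure lborel \<Omega> * (1 / T) * ((E T - E 0) / 2)" for T
  show ?thesis
  proof (intro conjI allI impI)
    show "w t \<in> W1 2 \<Omega>" if "t \<ge> 0" for t
      using step[of t] step[of 1] that by (cases "t = 0") auto
    show "(Lp_norm 2 \<Omega> (w T))\<^sup>2 + Cs ^ 4 / \<mu>\<^sup>2 * \<delta>\<^sup>2 * (Lp_norm 2 \<Omega> (weak_grad \<Omega> (w T)))\<^sup>2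
        \<le> exp (- \<alpha> * T) *
          ((Lp_norm 2 \<Omega> (w 0))\<^sup>2 + Cs ^ 4 / \<mu>\<^sup>2 * \<delta>\<^sup>2 * (Lp_norm 2 \<Omega> (weak_grad \<Omega> (w 0)))\<^sup>2
           + C / \<alpha> * (exp (\<alpha> * T) - 1))" if "T > 0" for T
      using step[OF that] unfolding E_def \<kappa>_def by blast
    have "(SUP t\<in>{0..}. ereal ((Lp_norm 2 \<Omega> (w t))\<^sup>2
          + Cs ^ 4 * \<delta>\<^sup>2 / \<mu>\<^sup>2 * (Lp_norm 2 \<Omega> (weak_grad \<Omega> (w t)))\<^sup>2)) \<le> ereal (E 0 + C / \<alpha>)"
    proof (rule SUP_least)
      fix t :: real assume "t \<in> {0..}"
      then show "ereal ((Lp_norm 2 \<Omega> (w t))\<^sup>2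
          + Cs ^ 4 * \<delta>\<^sup>2 / \<mu>\<^sup>2 * (Lp_norm 2 \<Omega> (weak_grad \<Omega> (w t)))\<^sup>2) \<le> ereal (E 0 + C / \<alpha>)"
        using E_bound[of t] unfolding ereal_less_eq by (simp add: E_def \<kappa>_def)
    qed
    then show "\<exists>C' :: real. (SUP t\<in>{0..}. ereal ((Lp_norm 2 \<Omega> (w t))\<^sup>2
          + Cs ^ 4 * \<delta>\<^sup>2 / \<mu>\<^sup>2 * (Lp_norm 2 \<Omega> (weak_grad \<Omega> (w t)))\<^sup>2)) \<le> ereal C'" by blast
    have R: "R \<in> O[at_top](\<lambda>T. 1 / T)"
    proof (rule bigoI)
      have bound: "norm (R T) \<le> 1 / measure lborel \<Omega> * ((E 0 + C / \<alpha>) / 2) * norm (1 / T)" if "T > 0" for T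
      proof -
        have "\<bar>E T - E 0\<bar> \<le> E 0 + C / \<alpha>"
          using E_bound[of T] E_nonneg[of T] E_nonneg[of 0] divide_nonneg_pos[OF C_nonneg \<alpha>_pos] that
          by linarith
        then have "1 / measure lborel \<Omega> * (1 / T) * (\<bar>E T - E 0\<bar> / 2)
            \<le> 1 / measure lborel \<Omega> * (1 / T) * ((E 0 + C / \<alpha>) / 2)"
          using that by (intro mult_left_mono divide_right_mono) auto
        then show ?thesis using that by (simp add: R_def abs_mult mult_ac)
      qed
      show "\<forall>\<^sub>F T in at_top. norm (R T) \<le> 1 / measure lborel \<Omega> * ((E 0 + C / \<alpha>) / 2) * norm (1 / T)"
        by (intro eventually_mono[OF eventually_gt_at_top[of 0]] bound)
    qed
    have "set_integrable lebesgue {0..T} D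
        \<and> R T + 1 / measure lborel \<Omega> * (1 / T) * (LINT t:{0..T}|lebesgue. D t)
          \<le> 1 / measure lborel \<Omega> * (1 / T) * (LINT t:{0..T}|lebesgue. F)" if T: "T > 0" for T
    proof
      interpret N: finite_measure "vol {0<..<T}" by (rule finite_measure_vol) auto
      have D: "integrable (vol {0<..<T}) D"
        and le: "(E T - E 0) / 2 + (\<integral>t. D t \<partial>vol {0<..<T}) \<le> (\<integral>t. F \<partial>vol {0<..<T})"
        using step[OF T] by auto
      show "set_integrable lebesgue {0..T} D" by (rule lebesgue_Icc_eq_vol(1)[OF D T])
      have "R T + 1 / measure lborel \<Omega> * (1 / T) * (\<integral>t. D t \<partial>vol {0<..<T})
          = 1 / measure lborel \<Omega> * (1 / T) * ((E T - E 0) / 2 + (\<integral>t. D t \<partial>vol {0<..<T}))"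
        by (simp only: R_def distrib_left)
      also have "\<dots> \<le> 1 / measure lborel \<Omega> * (1 / T) * (\<integral>t. F \<partial>vol {0<..<T})"
        using T le by (intro mult_left_mono) auto
      finally show "R T + 1 / measure lborel \<Omega> * (1 / T) * (LINT t:{0..T}|lebesgue. D t)
          \<le> 1 / measure lborel \<Omega> * (1 / T) * (LINT t:{0..T}|lebesgue. F)"
        unfolding lebesgue_Icc_eq_vol(2)[OF D T] lebesgue_Icc_eq_vol(2)[OF N.integrable_const T] .
    qed
    with R show "\<exists>R :: real \<Rightarrow> real. R \<in> O[at_top](\<lambda>T. 1 / T) \<and>
        (\<forall>T>0.
           set_integrable lebesgue {0..T} (\<lambda>t. \<nu> / 2 * (Lp_norm 2 \<Omega> (weak_grad \<Omega> (w t)))\<^sup>2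
             + (Cs * \<delta>)\<^sup>2 * (Lp_norm 3 \<Omega> (weak_grad \<Omega> (w t))) ^ 3) \<and>
           R T + 1 / measure lborel \<Omega> * (1 / T) *
             (LINT t:{0..T}|lebesgue. \<nu> / 2 * (Lp_norm 2 \<Omega> (weak_grad \<Omega> (w t)))\<^sup>2
               + (Cs * \<delta>)\<^sup>2 * (Lp_norm 3 \<Omega> (weak_grad \<Omega> (w t))) ^ 3)
           \<le> 1 / measure lborel \<Omega> * (1 / T) *
             (LINT t:{0..T}|lebesgue. C_PF\<^sup>2 / (2 * \<nu>) * (Lp_norm 2 \<Omega> f)\<^sup>2))"
      unfolding D_def c3_def F_def by blast
  qed
qed

end
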